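(* Let $n\in\mathbb{N}=\{1,2,\dots\}$ and let $\{E_m\}_{m\ge 0}$ be the $SU(2)$-equivariant subproduct system of the irreducible representation $\rho_n$ described in the context. Then for all $k,l\in\mathbb{N}_0$ there exists an $SU(2)$-equivariant unitary isomorphism \[E_k\otimes E_l\;\cong\;E_{k+l}\oplus E_{k+l-2}\oplus\dots\oplus E_{|k-l|},\] where $SU(2)$ acts on $E_k\otimes E_l$ diagonally.
   Context: Let $f_0,f_1$ be the standard basis of $\mathbb{C}^2$ and $\rho:SU(2)\to U(\mathbb{C}^2)$ the fundamental representation. For $n\in\mathbb{N}$ let $L_n\subseteq(\mathbb{C}^2)^{\otimes n}$ be the subspace of symmetric tensors (vectors fixed by all permutations of the tensor factors) and $\rho_n:SU(2)\to U(L_n)$ the irreducible representation obtained by restricting $\rho^{\otimes n}$. Define $\det(\rho_n,L_n)=\{\xi\in L_n\otimes L_n:(\rho_n(g)\otimes\rho_n(g))\xi=\xi\ \forall g\in SU(2)\}$. For $m\ge2$ put $K_m=\sum_{i=1}^{m-1}L_n^{\otimes(i-1)}\otimes\det(\rho_n,L_n)\otimes L_n^{\otimes(m-i-1)}\subseteq L_n^{\otimes m}$ and $E_m=K_m^\perp\subseteq L_n^{\otimes m}$; put $E_1=L_n$, $E_0=\mathbb{C}$. Each $E_m$ is invariant under $\rho_n^{\otimes m}$ (trivial action on $E_0$), which gives the $SU(2)$-action on $E_m$. *)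

theory Defs
  imports Complex_Main "HOL-Combinatorics.Permutations"
begin

text \<open>Concrete model. The basis vectors f0, f1 of C^2 are indexed by False, True.
  The tensor power (C^2)^{\<otimes>N} is modelled as the space of functions
  bool list \<Rightarrow> complex supported on lists of length N (coordinates in the
  product basis). Tensoring is concatenation of index words, so that
  L_n^{\<otimes>m} \<subseteq> (C^2)^{\<otimes>(n*m)} and E_k \<otimes> E_l \<subseteq> (C^2)^{\<otimes>(n*(k+l))}.\<close>

definition lists_len :: "nat \<Rightarrow> bool list set" where
  "lists_len N = {w. length w = N}"

definition vec :: "nat \<Rightarrow> (bool list \<Rightarrow> complex) set" where
  "vec N = {f. \<forall>w. length w \<noteq> N \<longrightarrow> f w = 0}"

definition cinner :: "nat \<Rightarrow> (bool list \<Rightarrow> complex) \<Rightarrow> (bool list \<Rightarrow> complex) \<Rightarrow> complex" where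
  "cinner N f g = (\<Sum>w\<in>lists_len N. cnj (f w) * g w)"

definition cspan :: "(bool list \<Rightarrow> complex) set \<Rightarrow> (bool list \<Rightarrow> complex) set" where
  "cspan S = {f. \<exists>T c. finite T \<and> T \<subseteq> S \<and> f = (\<lambda>w. \<Sum>x\<in>T. c x * x w)}"

definition tprod :: "nat \<Rightarrow> (bool list \<Rightarrow> complex) \<Rightarrow> (bool list \<Rightarrow> complex) \<Rightarrow> (bool list \<Rightarrow> complex)" where
  "tprod a x y = (\<lambda>w. x (take a w) * y (drop a w))"

definition tens :: "nat \<Rightarrow> (bool list \<Rightarrow> complex) set \<Rightarrow> (bool list \<Rightarrow> complex) set \<Rightarrow> (bool list \<Rightarrow> complex) set" where
  "tens a A B = cspan {tprod a x y | x y. x \<in> A \<and> y \<in> B}"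

fun tpow :: "nat \<Rightarrow> nat \<Rightarrow> (bool list \<Rightarrow> complex) set \<Rightarrow> (bool list \<Rightarrow> complex) set" where
  "tpow d 0 A = vec 0"
| "tpow d (Suc m) A = tens (d * m) (tpow d m A) A"

definition SU2 :: "(bool \<Rightarrow> bool \<Rightarrow> complex) set" where
  "SU2 = {g. (\<forall>i j. (\<Sum>k\<in>UNIV. cnj (g k i) * g k j) = (if i = j then 1 else 0))
            \<and> g False False * g True True - g False True * g True False = 1}"

definition act :: "(bool \<Rightarrow> bool \<Rightarrow> complex) \<Rightarrow> nat \<Rightarrow> (bool list \<Rightarrow> complex) \<Rightarrow> (bool list \<Rightarrow> complex)" where
  "act g N f = (\<lambda>w. if length w = N
      then (\<Sum>v\<in>lists_len N. (\<Prod>i<N. g (w ! i) (v ! i)) * f v) else 0)"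

definition perm_factors :: "(nat \<Rightarrow> nat) \<Rightarrow> nat \<Rightarrow> (bool list \<Rightarrow> complex) \<Rightarrow> (bool list \<Rightarrow> complex)" where
  "perm_factors \<sigma> N f = (\<lambda>w. if length w = N then f (map (\<lambda>i. w ! \<sigma> i) [0..<N]) else 0)"

definition Lsym :: "nat \<Rightarrow> (bool list \<Rightarrow> complex) set" where
  "Lsym n = {f \<in> vec n. \<forall>\<sigma>. \<sigma> permutes {..<n} \<longrightarrow> perm_factors \<sigma> n f = f}"

definition detsp :: "nat \<Rightarrow> (bool list \<Rightarrow> complex) set" where
  "detsp n = {\<xi> \<in> tens n (Lsym n) (Lsym n). \<forall>g\<in>SU2. act g (2 * n) \<xi> = \<xi>}"

text \<open>K_m = sum over i=1..m-1 of L^{(i-1)} \<otimes> det \<otimes> L^{(m-i-1)}; here i' = i - 1.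
  For m < 2 the sum is empty, i.e. K_m = 0.\<close>
definition Kspace :: "nat \<Rightarrow> nat \<Rightarrow> (bool list \<Rightarrow> complex) set" where
  "Kspace n m = cspan (\<Union>i\<in>{i. i + 2 \<le> m}.
      tens (n * (i + 2)) (tens (n * i) (tpow n i (Lsym n)) (detsp n)) (tpow n (m - i - 2) (Lsym n)))"

definition orth :: "nat \<Rightarrow> (bool list \<Rightarrow> complex) set \<Rightarrow> (bool list \<Rightarrow> complex) set \<Rightarrow> (bool list \<Rightarrow> complex) set" where
  "orth N K A = {f \<in> A. \<forall>h\<in>K. cinner N h f = 0}"

text \<open>E_m = K_m^\<perp> in L_n^{\<otimes>m}. (For m = 0 this is vec 0 = C, for m = 1 it is L_n.)\<close>
definition Esp :: "nat \<Rightarrow> nat \<Rightarrow> (bool list \<Rightarrow> complex) set" where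
  "Esp n m = orth (n * m) (Kspace n m) (tpow n m (Lsym n))"

definition DS :: "nat \<Rightarrow> nat \<Rightarrow> nat \<Rightarrow> (nat \<Rightarrow> bool list \<Rightarrow> complex) set" where
  "DS n k l = {F. \<forall>j. (j \<le> min k l \<longrightarrow> F j \<in> Esp n (k + l - 2 * j))
                    \<and> (min k l < j \<longrightarrow> F j = (\<lambda>_. 0))}"

definition ds_inner :: "nat \<Rightarrow> nat \<Rightarrow> nat \<Rightarrow> (nat \<Rightarrow> bool list \<Rightarrow> complex) \<Rightarrow> (nat \<Rightarrow> bool list \<Rightarrow> complex) \<Rightarrow> complex" where
  "ds_inner n k l F G = (\<Sum>j\<le>min k l. cinner (n * (k + l - 2 * j)) (F j) (G j))"

definition ds_act :: "nat \<Rightarrow> nat \<Rightarrow> nat \<Rightarrow> (bool \<Rightarrow> bool \<Rightarrow> complex) \<Rightarrow> (nat \<Rightarrow> bool list \<Rightarrow> complex) \<Rightarrow> (nat \<Rightarrow> bool list \<Rightarrow> complex)" where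
  "ds_act n k l g F = (\<lambda>j. if j \<le> min k l then act g (n * (k + l - 2 * j)) (F j) else (\<lambda>_. 0))"

end

theory Submission
  imports Defs "HOL-Library.Function_Algebras"
begin

text \<open>Invariance under the torus and under plane rotations shows that the determinant of \<open>L\<^sub>n\<close> is
  spanned by a single vector \<open>\<delta>\<close>, so \<open>E\<^sub>m\<close> is the joint kernel of the contractions \<open>C\<^sub>i\<close> with
  \<open>\<delta>\<close> in neighbouring slots, and \<open>E\<^sub>k \<otimes> E\<^sub>l\<close> the joint kernel of all of them except the one, \<open>C\<close>,
  across the tensor sign. Hence \<open>E\<^sub>k\<^sub>+\<^sub>l\<close> is the kernel of \<open>C\<close> on \<open>E\<^sub>k \<otimes> E\<^sub>l\<close>, and \<open>C\<close> maps into
  \<open>E\<^sub>k\<^sub>-\<^sub>1 \<otimes> E\<^sub>l\<^sub>-\<^sub>1\<close>. The Temperley--Lieb relations between contractions and insertions of \<open>\<delta>\<close> give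
  an explicit adjoint \<open>D\<close> of \<open>C\<close> and the identity \<open>C D = \<alpha> + \<beta> D' C'\<close>, where \<open>D'\<close> and \<open>C'\<close> are the same
  operators one level down, \<open>\<alpha> > 0\<close> and \<open>\<beta> \<ge> 0\<close>. By induction \<open>C D\<close> is a positive scalar on every
  summand of \<open>E\<^sub>k\<^sub>-\<^sub>1 \<otimes> E\<^sub>l\<^sub>-\<^sub>1\<close>, so rescaling \<open>D\<close> summand by summand yields an equivariant isometry
  onto the complement of \<open>E\<^sub>k\<^sub>+\<^sub>l\<close>.\<close>

text \<open>The Temperley--Lieb parameters are those of \<open>delta\<close>: a closed loop has the
  value n + 1 = dim L_n, and straightening a zigzag costs the sign (-1)^n, because exchanging the
  two halves of \<open>delta\<close> multiplies it by this sign. With d = n + 1, the quantum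
  integers [k+2] = d [k+1] - [k] enter as the solution of the three-term recursion that cancels
  unwanted contractions. The plain insertion of \<open>delta\<close> across the cut leaves the
  tensor product of the E's, since the contractions overlapping it in one slot do not vanish on it.
  The further terms of D repair this; being insertions away from the cut, they are orthogonal to the
  tensor product, so that D stays adjoint to C. The constants are \<alpha> = [a+2]/[a+1] - [b]/[b+1]
  and \<beta> = [a][b]/([a+1][b+1]), where C starts from E_{a+1} \<otimes> E_{b+1}. Strict growth of
  the quantum integers, a consequence of d \<ge> 2, gives \<alpha> > 0. Surjectivity of the isometry
  comes from inverting C D, which the positive scalars permit.\<close>

definition smul :: "complex \<Rightarrow> ('a \<Rightarrow> complex) \<Rightarrow> ('a \<Rightarrow> complex)" (infixr "\<cdot>" 75) where
  "c \<cdot> f = (\<lambda>w. c * f w)"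

lemma smul_apply: "(c \<cdot> f) w = c * f w"
  by (simp add: smul_def)

text \<open>As simp rules, these are eta-contracted and also rewrite functions not applied to an argument.\<close>

declare plus_fun_apply [simp del] zero_fun_apply [simp del] minus_apply [simp del] uminus_apply [simp del]

interpretation fv: vector_space "smul :: complex \<Rightarrow> ('a \<Rightarrow> complex) \<Rightarrow> _"
  by standard (auto simp: fun_eq_iff algebra_simps smul_apply plus_fun_apply)

lemma sum_fun_apply: "(\<Sum>i\<in>A. f i) w = (\<Sum>i\<in>A. f i w)"
  for f :: "'i \<Rightarrow> 'a \<Rightarrow> 'b::comm_monoid_add"
  by (induction A rule: infinite_finite_induct) (auto simp: plus_fun_apply zero_fun_apply)

lemmas pointwise = plus_fun_apply zero_fun_apply minus_apply smul_apply sum_fun_apply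

lemma cspan_eq_span: "cspan S = fv.span S"
proof -
  have "(\<lambda>w. \<Sum>x\<in>T. c x * x w) = (\<Sum>x\<in>T. c x \<cdot> x)" for T and c :: "(bool list \<Rightarrow> complex) \<Rightarrow> complex"
    by (simp add: fun_eq_iff pointwise)
  then show ?thesis
    by (auto simp: cspan_def fv.span_explicit)
qed

subsection \<open>Words\<close>

lemma lists_len_eq: "lists_len N = {w. set w \<subseteq> UNIV \<and> length w = N}"
  by (auto simp: lists_len_def)

lemma finite_lists_len [simp]: "finite (lists_len N)"
  unfolding lists_len_eq by (rule finite_lists_length_eq) simp

lemma in_lists_len [simp]: "w \<in> lists_len N \<longleftrightarrow> length w = N"
  by (simp add: lists_len_def)

lemma lists_len_0 [simp]: "lists_len 0 = {[]}"
  by (auto simp: lists_len_def)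

lemma lists_len_Suc: "lists_len (Suc N) = Cons False ` lists_len N \<union> Cons True ` lists_len N"
  by (auto simp: lists_len_def length_Suc_conv image_iff)

lemma sum_lists_len_Suc:
  "(\<Sum>w\<in>lists_len (Suc N). F w) = (\<Sum>w\<in>lists_len N. F (False # w)) + (\<Sum>w\<in>lists_len N. F (True # w))"
proof -
  have "(\<Sum>w\<in>lists_len (Suc N). F w) = (\<Sum>w\<in>Cons False ` lists_len N. F w) + (\<Sum>w\<in>Cons True ` lists_len N. F w)"
    unfolding lists_len_Suc by (rule sum.union_disjoint) auto
  then show ?thesis
    by (simp add: sum.reindex)
qed

lemma sum_lists_len_add:
  "(\<Sum>w\<in>lists_len (p + q). F w) = (\<Sum>u\<in>lists_len p. \<Sum>v\<in>lists_len q. F (u @ v))"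
proof (induction p arbitrary: F)
  case (Suc p)
  show ?case
    by (simp add: sum_lists_len_Suc Suc)
qed simp

lemma vecD: "f \<in> vec N \<Longrightarrow> length w \<noteq> N \<Longrightarrow> f w = 0"
  by (simp add: vec_def)

lemma vec_eqI:
  assumes "f \<in> vec N" "g \<in> vec N" "\<And>w. length w = N \<Longrightarrow> f w = g w"
  shows "f = g"
  using assms by (auto simp: vec_def fun_eq_iff) metis

lemma subspace_vec: "fv.subspace (vec N)"
  by (auto simp: fv.subspace_def vec_def pointwise)

lemma word_split:
  assumes "length w = p + q"
  obtains u v where "w = u @ v" "length u = p" "length v = q"
  using assms by (metis append_take_drop_id length_append add_left_cancel length_take min.absorb2 le_add1)

lemma word_split3:
  assumes "length w = p + (q + r)"
  obtains u v x where "w = u @ v @ x" "length u = p" "length v = q" "length x = r"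
proof -
  obtain u y where "w = u @ y" "length u = p" "length y = q + r"
    using assms by (rule word_split)
  moreover from this(3) obtain v x where "y = v @ x" "length v = q" "length x = r"
    by (rule word_split)
  ultimately show ?thesis
    using that by auto
qed

subsection \<open>Inner products\<close>

lemma cinner_add_left: "cinner N (f + g) h = cinner N f h + cinner N g h"
  by (simp add: cinner_def algebra_simps sum.distrib pointwise)

lemma cinner_add_right: "cinner N h (f + g) = cinner N h f + cinner N h g"
  by (simp add: cinner_def algebra_simps sum.distrib pointwise)

lemma cinner_smul_left: "cinner N (c \<cdot> f) h = cnj c * cinner N f h"
  by (simp add: cinner_def sum_distrib_left algebra_simps pointwise)

lemma cinner_smul_right: "cinner N h (c \<cdot> f) = c * cinner N h f"
  by (simp add: cinner_def sum_distrib_left algebra_simps pointwise)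

lemma cinner_zero_left [simp]: "cinner N 0 h = 0"
  by (simp add: cinner_def pointwise)

lemma cinner_zero_right [simp]: "cinner N h 0 = 0"
  by (simp add: cinner_def pointwise)

lemma cinner_cnj: "cnj (cinner N f g) = cinner N g f"
  by (simp add: cinner_def algebra_simps)

lemma cinner_self_eq_0:
  assumes "f \<in> vec N" "cinner N f f = 0"
  shows "f = 0"
proof -
  have "cinner N f f = of_real (\<Sum>w\<in>lists_len N. (norm (f w))\<^sup>2)"
    unfolding cinner_def of_real_sum
    by (rule sum.cong) (simp_all only: complex_norm_square mult.commute)
  with assms(2) have "(\<Sum>w\<in>lists_len N. (norm (f w))\<^sup>2) = 0"
    by (metis of_real_eq_0_iff)
  then have "\<forall>w\<in>lists_len N. f w = 0"
    by (subst (asm) sum_nonneg_eq_0_iff) auto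
  with assms(1) show ?thesis
    by (auto simp: vec_def fun_eq_iff pointwise)
qed

subsection \<open>Tensor products by slices\<close>

text \<open>Subspaces of a coordinate space are coordinatised by evaluations, so that the coefficients
  of a tensor with respect to such a basis of the left factor are themselves slices.\<close>

lemma subspace_eval_coords:
  assumes "finite X" "fv.subspace A" "\<And>f x. f \<in> A \<Longrightarrow> x \<notin> X \<Longrightarrow> f x = 0"
  shows "\<exists>D e. D \<subseteq> X \<and> (\<forall>x\<in>D. e x \<in> A) \<and> (\<forall>f\<in>A. f = (\<Sum>x\<in>D. f x \<cdot> e x))"
  using assms
proof (induction X arbitrary: A rule: finite_induct)
  case empty
  then have "\<forall>f\<in>A. f = 0"
    by (auto simp: fun_eq_iff pointwise)
  then show ?case
    by (intro exI[of _ "{}"] exI[of _ "\<lambda>_. 0"]) simp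
next
  case (insert z X)
  note sub = insert.prems(1)
  show ?case
  proof (cases "\<forall>f\<in>A. f z = 0")
    case True
    have "\<exists>D e. D \<subseteq> X \<and> (\<forall>x\<in>D. e x \<in> A) \<and> (\<forall>f\<in>A. f = (\<Sum>x\<in>D. f x \<cdot> e x))"
    proof (rule insert.IH[OF sub])
      fix f x
      assume "f \<in> A" "x \<notin> X"
      with True insert.prems(2)[of f x] show "f x = 0"
        by (cases "x = z") auto
    qed
    then show ?thesis
      by (elim exE conjE) (intro exI conjI, auto)
  next
    case False
    then obtain b where b: "b \<in> A" "b z \<noteq> 0"
      by blast
    \<comment> \<open>One step of Gaussian elimination: a pivot with value 1 at the new point splits
      A into its multiples and the members of A that vanish at z.\<close>
    define a where "a = (1 / b z) \<cdot> b"
    have a: "a \<in> A" "a z = 1"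
      using b sub by (auto simp: a_def smul_apply[of _ _ z] intro: fv.subspace_scale)
    define A' where "A' = {f \<in> A. f z = 0}"
    have "\<exists>D e. D \<subseteq> X \<and> (\<forall>x\<in>D. e x \<in> A') \<and> (\<forall>f\<in>A'. f = (\<Sum>x\<in>D. f x \<cdot> e x))"
    proof (rule insert.IH)
      show "fv.subspace A'"
        using sub by (auto simp: A'_def fv.subspace_def smul_apply[of _ _ z] plus_fun_apply[of _ _ z] zero_fun_apply[of z])
    next
      fix f x
      assume "f \<in> A'" "x \<notin> X"
      with insert.prems(2)[of f x] show "f x = 0"
        by (cases "x = z") (auto simp: A'_def)
    qed
    then obtain D e where D: "D \<subseteq> X" "\<forall>x\<in>D. e x \<in> A'" "\<forall>f\<in>A'. f = (\<Sum>x\<in>D. f x \<cdot> e x)"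
      by (elim exE conjE)
    have fin: "finite D" and zD: "z \<notin> D"
      using D(1) insert.hyps finite_subset by auto
    \<comment> \<open>The pivot is corrected by its own coordinates over D, so that the coefficient
      at every x in D is \<open>f x\<close> itself and not \<open>f x - f z * a x\<close>.\<close>
    define e' where "e' = e(z := a - (\<Sum>x\<in>D. a x \<cdot> e x))"
    have eA: "e x \<in> A" if "x \<in> D" for x
      using D(2) that by (auto simp: A'_def)
    have "e' x \<in> A" if "x \<in> insert z D" for x
      using that eA a sub
      by (auto simp: e'_def intro!: fv.subspace_diff fv.subspace_sum fv.subspace_scale)
    moreover have "f = (\<Sum>x\<in>insert z D. f x \<cdot> e' x)" if f: "f \<in> A" for f
    proof -
      have "f - f z \<cdot> a \<in> A'"
        using f a sub by (auto simp: A'_def smul_apply[of _ _ z] minus_apply[of _ _ z] intro!: fv.subspace_diff fv.subspace_scale)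
      then have *: "f - f z \<cdot> a = (\<Sum>x\<in>D. (f - f z \<cdot> a) x \<cdot> e x)"
        using D(3) by blast
      have "(\<Sum>x\<in>insert z D. f x \<cdot> e' x) = f z \<cdot> e' z + (\<Sum>x\<in>D. f x \<cdot> e x)"
        using fin zD by (auto simp: e'_def intro!: sum.cong)
      also have "\<dots> = f z \<cdot> a + (\<Sum>x\<in>D. (f - f z \<cdot> a) x \<cdot> e x)"
        by (simp add: e'_def pointwise fv.scale_right_diff_distrib fv.scale_left_diff_distrib
            sum_subtractf fv.scale_sum_right)
      also have "\<dots> = f"
        using * by simp
      finally show ?thesis ..
    qed
    ultimately show ?thesis
      using D(1) by (intro exI[of _ "insert z D"] exI[of _ e']) auto
  qed
qed

text \<open>A tensor is seen as a matrix whose columns must lie in A and whose rows must lie in B.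
  This describes A \<otimes> B as an intersection, which can be tested word by word, whereas
  membership in a span needs a decomposition.\<close>

definition slices :: "nat \<Rightarrow> nat \<Rightarrow> (bool list \<Rightarrow> complex) set \<Rightarrow> (bool list \<Rightarrow> complex) set \<Rightarrow> (bool list \<Rightarrow> complex) set" where
  "slices a b A B = {f \<in> vec (a + b). (\<forall>v. length v = b \<longrightarrow> (\<lambda>u. f (u @ v)) \<in> A)
      \<and> (\<forall>u. length u = a \<longrightarrow> (\<lambda>v. f (u @ v)) \<in> B)}"

text \<open>Expanding every column in an evaluation basis of A writes f as a sum of e_x \<otimes>
  f(x, -). The right factors are rows of f and hence lie in B.\<close>

lemma tens_eq_slices:
  assumes A: "fv.subspace A" "A \<subseteq> vec a" and B: "fv.subspace B" "B \<subseteq> vec b"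
  shows "tens a A B = slices a b A B"
proof
  have "fv.subspace (slices a b A B)"
    using A(1) B(1) subspace_vec[of "a + b"]
    by (auto simp: slices_def fv.subspace_def plus_fun_def zero_fun_def smul_def)
  moreover have "tprod a x y \<in> slices a b A B" if "x \<in> A" "y \<in> B" for x y
  proof -
    have x: "x \<in> vec a" and y: "y \<in> vec b"
      using that A B by auto
    have 0: "tprod a x y w = 0" if "length w \<noteq> a + b" for w
      using vecD[OF x, of "take a w"] vecD[OF y, of "drop a w"] that
      by (cases "a \<le> length w") (auto simp: tprod_def)
    have "(\<lambda>u. tprod a x y (u @ v)) = y v \<cdot> x" if "length v = b" for v
    proof
      fix u
      show "tprod a x y (u @ v) = (y v \<cdot> x) u"
        unfolding smul_apply
        using vecD[OF x, of u] 0[of "u @ v"] that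
        by (cases "length u = a") (auto simp: tprod_def)
    qed
    moreover have "(\<lambda>v. tprod a x y (u @ v)) = x u \<cdot> y" if "length u = a" for u
      using that by (simp add: tprod_def fun_eq_iff pointwise)
    ultimately show ?thesis
      using 0 \<open>x \<in> A\<close> \<open>y \<in> B\<close> A(1) B(1) by (auto simp: slices_def vec_def fv.subspace_scale)
  qed
  ultimately show "tens a A B \<subseteq> slices a b A B"
    unfolding tens_def cspan_eq_span by (intro fv.span_minimal) auto
next
  have "\<exists>D e. D \<subseteq> lists_len a \<and> (\<forall>x\<in>D. e x \<in> A) \<and> (\<forall>f\<in>A. f = (\<Sum>x\<in>D. f x \<cdot> e x))"
    by (rule subspace_eval_coords[OF finite_lists_len A(1)]) (use A(2) in \<open>auto simp: vec_def\<close>)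
  then obtain D e where D: "D \<subseteq> lists_len a" "\<forall>x\<in>D. e x \<in> A" "\<forall>f\<in>A. f = (\<Sum>x\<in>D. f x \<cdot> e x)"
    by (elim exE conjE)
  show "slices a b A B \<subseteq> tens a A B"
  proof
    fix f
    assume f: "f \<in> slices a b A B"
    have tp: "tprod a (e x) (\<lambda>v. f (x @ v)) \<in> fv.span {tprod a x y |x y. x \<in> A \<and> y \<in> B}" if "x \<in> D" for x
      using that D f by (intro fv.span_base CollectI exI[of _ "e x"] exI[of _ "\<lambda>v. f (x @ v)"])
        (auto simp: slices_def)
    have sp: "(\<Sum>x\<in>D. tprod a (e x) (\<lambda>v. f (x @ v))) \<in> fv.span {tprod a x y |x y. x \<in> A \<and> y \<in> B}"
      by (intro fv.span_sum tp)
    have "f = (\<Sum>x\<in>D. tprod a (e x) (\<lambda>v. f (x @ v)))"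
    proof
      fix w
      show "f w = (\<Sum>x\<in>D. tprod a (e x) (\<lambda>v. f (x @ v))) w"
      proof (cases "length w = a + b")
        case True
        then obtain u v where w: "w = u @ v" "length u = a" "length v = b"
          by (rule word_split)
        then have "(\<lambda>u. f (u @ v)) \<in> A"
          using f by (simp add: slices_def)
        then have "(\<lambda>u. f (u @ v)) = (\<Sum>x\<in>D. f (x @ v) \<cdot> e x)"
          using D(3) by blast
        then have "f (u @ v) = (\<Sum>x\<in>D. f (x @ v) \<cdot> e x) u"
          by (rule fun_cong)
        then show ?thesis
          using w by (simp add: pointwise tprod_def mult.commute)
      next
        case False
        have "tprod a (e x) (\<lambda>v. f (x @ v)) w = 0" if "x \<in> D" for x
        proof (cases "length w \<ge> a")
          case True
          with D that False have "length (x @ drop a w) \<noteq> a + b"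
            by auto
          then have "f (x @ drop a w) = 0"
            using f by (auto simp: slices_def vec_def)
          then show ?thesis by (simp add: tprod_def)
        next
          case False
          then have "e x (take a w) = 0"
            using D that A(2) by (auto simp: vec_def)
          then show ?thesis by (simp add: tprod_def)
        qed
        then show ?thesis
          using f False by (simp add: pointwise slices_def vec_def)
      qed
    qed
    with sp show "f \<in> tens a A B"
      unfolding tens_def cspan_eq_span by simp
  qed
qed

lemma subspace_slices:
  "fv.subspace A \<Longrightarrow> fv.subspace B \<Longrightarrow> fv.subspace (slices a b A B)"
  using subspace_vec[of "a + b"]
  by (auto simp: slices_def fv.subspace_def plus_fun_def zero_fun_def smul_def)

lemma slices_subset_vec: "slices a b A B \<subseteq> vec (a + b)"
  by (auto simp: slices_def)

subsection \<open>The invariant vector\<close>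

definition cnt :: "bool list \<Rightarrow> nat" where
  "cnt w = count_list w True"

lemma cnt_simps [simp]:
  "cnt [] = 0" "cnt (True # w) = Suc (cnt w)" "cnt (False # w) = cnt w" "cnt (u @ w) = cnt u + cnt w"
  by (simp_all add: cnt_def)

lemma cnt_le: "cnt w \<le> length w"
  by (simp add: cnt_def count_le_length)

text \<open>There are \<open>N choose j\<close> words of length N with j letters True; the induction
  step is Pascal's rule.\<close>

lemma sum_lists_len_cnt:
  fixes F :: "nat \<Rightarrow> complex"
  shows "(\<Sum>w\<in>lists_len N. F (cnt w)) = (\<Sum>j\<le>N. of_nat (N choose j) * F j)"
proof (induction N arbitrary: F)
  case (Suc N)
  have *: "(\<Sum>j\<le>N. of_nat (N choose j) * F j) = F 0 + (\<Sum>j\<le>N. of_nat (N choose Suc j) * F (Suc j))"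
    using sum.atMost_Suc[of "\<lambda>j. of_nat (N choose j) * F j" N]
      sum.atMost_Suc_shift[of "\<lambda>j. of_nat (N choose j) * F j" N]
    by (simp add: binomial_eq_0)
  have "(\<Sum>w\<in>lists_len (Suc N). F (cnt w))
      = (\<Sum>j\<le>N. of_nat (N choose j) * F j) + (\<Sum>j\<le>N. of_nat (N choose j) * F (Suc j))"
    by (simp add: sum_lists_len_Suc Suc[of F] Suc[of "\<lambda>j. F (Suc j)"])
  also have "\<dots> = F 0 + (\<Sum>j\<le>N. of_nat (Suc N choose Suc j) * F (Suc j))"
    unfolding * by (simp add: sum.distrib algebra_simps)
  also have "\<dots> = (\<Sum>j\<le>Suc N. of_nat (Suc N choose j) * F j)"
    by (subst sum.atMost_Suc_shift) simp
  finally show ?case .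
qed simp

lemma sum_lists_len_cnt_eq:
  assumes "i \<le> N"
  shows "(\<Sum>w\<in>lists_len N. if cnt w = i then c else 0) = of_nat (N choose i) * (c::complex)"
  using assms by (subst sum_lists_len_cnt) (simp add: if_distrib sum.delta cong: if_cong)

text \<open>Up to a scalar, the n-th power of f0 \<otimes> f1 - f1 \<otimes> f0 with each half
  symmetrised. The scaling gives the value 1 at the word of n letters False followed by n letters
  True.\<close>

definition delta :: "nat \<Rightarrow> bool list \<Rightarrow> complex" where
  "delta n w = (if length w = 2 * n \<and> cnt w = n
     then (-1) ^ cnt (take n w) / of_nat (n choose cnt (take n w)) else 0)"

lemma delta_append:
  "length a = n \<Longrightarrow> length b = n \<Longrightarrow>
    delta n (a @ b) = (if cnt a + cnt b = n then (-1) ^ cnt a / of_nat (n choose cnt a) else 0)"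
  by (auto simp: delta_def)

lemma delta_eq_0: "length w \<noteq> 2 * n \<Longrightarrow> delta n w = 0"
  by (simp add: delta_def)

lemma cnj_delta [simp]: "cnj (delta n w) = delta n w"
  by (simp add: delta_def)

lemma sum_lists_len_double:
  "(\<Sum>w\<in>lists_len (2 * n). F w) = (\<Sum>a\<in>lists_len n. \<Sum>b\<in>lists_len n. F (a @ b))"
  by (simp add: mult_2 sum_lists_len_add)

text \<open>Each weight j contributes exactly 1: there are \<open>n choose j\<close> left halves,
  and each of them contributes the reciprocal of this number. The total n + 1 is the loop
  value.\<close>

lemma delta_norm: "(\<Sum>w\<in>lists_len (2 * n). delta n w * delta n w) = of_nat (n + 1)"
proof -
  have "(\<Sum>b\<in>lists_len n. delta n (a @ b) * delta n (a @ b)) = 1 / of_nat (n choose cnt a)"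
    if "length a = n" for a
  proof -
    have le: "cnt a \<le> n"
      using cnt_le[of a] that by simp
    then have ne: "(of_nat (n choose cnt a) :: complex) \<noteq> 0"
      by simp
    have "(\<Sum>b\<in>lists_len n. delta n (a @ b) * delta n (a @ b))
        = (\<Sum>b\<in>lists_len n. if cnt b = n - cnt a then 1 / (of_nat (n choose cnt a))\<^sup>2 else 0)"
      using that le
      by (intro sum.cong) (auto simp: delta_append power2_eq_square times_divide_times_eq power_mult_distrib[symmetric])
    also have "\<dots> = of_nat (n choose (n - cnt a)) * (1 / (of_nat (n choose cnt a))\<^sup>2)"
      using le by (intro sum_lists_len_cnt_eq) auto
    also have "\<dots> = 1 / of_nat (n choose cnt a)"
      using le ne by (simp add: binomial_symmetric[of "cnt a" n, symmetric] power2_eq_square)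
    finally show ?thesis .
  qed
  then have "(\<Sum>w\<in>lists_len (2 * n). delta n w * delta n w)
      = (\<Sum>a\<in>lists_len n. 1 / of_nat (n choose cnt a))"
    by (simp add: sum_lists_len_double)
  also have "\<dots> = (\<Sum>j\<le>n. 1)"
    by (subst sum_lists_len_cnt) (auto intro!: sum.cong)
  finally show ?thesis
    by simp
qed

text \<open>Contracting two overlapping copies of the invariant vector
  symmetrises a slot and produces the sign.\<close>

lemma delta_delta:
  assumes "length a = n" "length c = n"
  shows "(\<Sum>b\<in>lists_len n. delta n (a @ b) * delta n (b @ c))
      = (if cnt a = cnt c then (-1) ^ n / of_nat (n choose cnt c) else 0)"
proof -
  have le: "cnt c \<le> n"
    using cnt_le[of c] assms by simp
  then have ne: "(of_nat (n choose cnt c) :: complex) \<noteq> 0"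
    by simp
  have "delta n (a @ b) * delta n (b @ c) = (if cnt b = n - cnt c then
      (if cnt a = cnt c then (-1) ^ n / (of_nat (n choose cnt c))\<^sup>2 else 0) else 0)"
    if "length b = n" for b
  proof (cases "cnt b = n - cnt c")
    case True
    have "((-1) ^ cnt c * (-1) ^ (n - cnt c) :: complex) = (-1) ^ n"
      using le by (simp flip: power_add)
    moreover have "cnt a + cnt b = n \<longleftrightarrow> cnt a = cnt c" "cnt b + cnt c = n"
      using True le by auto
    moreover have "(-1) ^ cnt b = ((-1) ^ (n - cnt c) :: complex)" "n choose cnt b = n choose cnt c"
      using True binomial_symmetric[OF le] by simp_all
    ultimately show ?thesis
      unfolding if_P[OF True] using assms that
      by (auto simp: delta_append power2_eq_square times_divide_times_eq)
  next
    case False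
    then have "cnt b + cnt c \<noteq> n"
      by simp
    then show ?thesis
      using assms that False by (simp add: delta_append)
  qed
  then have "(\<Sum>b\<in>lists_len n. delta n (a @ b) * delta n (b @ c)) = (\<Sum>b\<in>lists_len n. if cnt b = n - cnt c then
      (if cnt a = cnt c then (-1) ^ n / (of_nat (n choose cnt c))\<^sup>2 else 0) else 0)"
    by (intro sum.cong) auto
  also have "\<dots> = of_nat (n choose (n - cnt c)) * (if cnt a = cnt c then (-1) ^ n / (of_nat (n choose cnt c))\<^sup>2 else 0)"
    using le by (intro sum_lists_len_cnt_eq) auto
  also have "\<dots> = (if cnt a = cnt c then (-1) ^ n / of_nat (n choose cnt c) else 0)"
    using le ne by (simp add: binomial_symmetric[of "cnt c" n, symmetric] power2_eq_square)
  finally show ?thesis .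
qed

text \<open>By \<open>delta_delta\<close> two copies of \<open>delta\<close> sharing a block average
  over the words of equal \<open>cnt\<close>, up to the sign. A function of \<open>cnt\<close> is
  fixed by the average. The two parts are the two orientations of the zigzag.\<close>

lemma zigzag:
  assumes h: "\<And>a b. length a = n \<Longrightarrow> length b = n \<Longrightarrow> cnt a = cnt b \<Longrightarrow> h a = h b" and c: "length c = n"
  shows "(\<Sum>a\<in>lists_len n. \<Sum>b\<in>lists_len n. delta n (a @ b) * delta n (b @ c) * h a) = (-1) ^ n * h c"
    and "(\<Sum>b\<in>lists_len n. \<Sum>a\<in>lists_len n. delta n (b @ a) * delta n (c @ b) * h a) = (-1) ^ n * h c"
proof -
  have le: "cnt c \<le> n"
    using cnt_le[of c] c by simp
  have *: "(\<Sum>a\<in>lists_len n. (if cnt a = cnt c then (-1) ^ n / of_nat (n choose cnt c) else 0) * h a)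
      = (-1) ^ n * h c"
  proof -
    have "(\<Sum>a\<in>lists_len n. (if cnt a = cnt c then (-1) ^ n / of_nat (n choose cnt c) else 0) * h a)
      = (\<Sum>a\<in>lists_len n. if cnt a = cnt c then (-1) ^ n / of_nat (n choose cnt c) * h c else 0)"
    proof (intro sum.cong refl)
      fix a
      assume "a \<in> lists_len n"
      then show "(if cnt a = cnt c then (-1) ^ n / of_nat (n choose cnt c) else 0) * h a
          = (if cnt a = cnt c then (-1) ^ n / of_nat (n choose cnt c) * h c else 0)"
        using h[of a c] c by (cases "cnt a = cnt c") auto
    qed
    then show ?thesis
      using le by (simp add: sum_lists_len_cnt_eq)
  qed
  show "(\<Sum>a\<in>lists_len n. \<Sum>b\<in>lists_len n. delta n (a @ b) * delta n (b @ c) * h a) = (-1) ^ n * h c"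
    using c * by (simp add: delta_delta flip: sum_distrib_right)
  have "(\<Sum>b\<in>lists_len n. \<Sum>a\<in>lists_len n. delta n (b @ a) * delta n (c @ b) * h a)
      = (\<Sum>a\<in>lists_len n. (\<Sum>b\<in>lists_len n. delta n (c @ b) * delta n (b @ a)) * h a)"
    by (subst sum.swap) (simp add: sum_distrib_left mult_ac)
  also have "\<dots> = (-1) ^ n * h c"
    unfolding *[symmetric] using c by (intro sum.cong) (auto simp: delta_delta)
  finally show "(\<Sum>b\<in>lists_len n. \<Sum>a\<in>lists_len n. delta n (b @ a) * delta n (c @ b) * h a) = (-1) ^ n * h c" .
qed

subsection \<open>Insertion and contraction\<close>

definition Ins :: "nat \<Rightarrow> nat \<Rightarrow> (bool list \<Rightarrow> complex) \<Rightarrow> (bool list \<Rightarrow> complex)" where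
  "Ins n p f = (\<lambda>w. delta n (take (2 * n) (drop p w)) * f (take p w @ drop (p + 2 * n) w))"

text \<open>The position p counts letters, not tensor slots. As \<open>delta\<close> is real, no
  conjugation appears although this is the adjoint of \<open>Ins\<close> (see
  \<open>cinner_Ins\<close>).\<close>

definition Con :: "nat \<Rightarrow> nat \<Rightarrow> (bool list \<Rightarrow> complex) \<Rightarrow> (bool list \<Rightarrow> complex)" where
  "Con n p f = (\<lambda>w. \<Sum>v\<in>lists_len (2 * n). delta n v * f (take p w @ v @ drop p w))"

text \<open>Symmetry of the block of n letters starting at p. It is phrased by \<open>cnt\<close>
  because words of equal length and equal \<open>cnt\<close> are exactly the permutations of each
  other, and because \<open>zigzag\<close> asks for this form.\<close>

definition symat :: "nat \<Rightarrow> nat \<Rightarrow> (bool list \<Rightarrow> complex) \<Rightarrow> bool" where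
  "symat n p f \<longleftrightarrow> (\<forall>x a b y. length x = p \<and> length a = n \<and> length b = n \<and> cnt a = cnt b
      \<longrightarrow> f (x @ a @ y) = f (x @ b @ y))"

lemma symatD:
  "symat n p f \<Longrightarrow> length x = p \<Longrightarrow> length a = n \<Longrightarrow> length b = n \<Longrightarrow> cnt a = cnt b
    \<Longrightarrow> f (x @ a @ y) = f (x @ b @ y)"
  unfolding symat_def by blast

lemma Ins_append: "length x = p \<Longrightarrow> length v = 2 * n \<Longrightarrow> Ins n p f (x @ v @ y) = delta n v * f (x @ y)"
  by (simp add: Ins_def)

lemma Con_append: "length x = p \<Longrightarrow> Con n p f (x @ y) = (\<Sum>v\<in>lists_len (2 * n). delta n v * f (x @ v @ y))"
  by (simp add: Con_def)

lemma Ins_vec: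
  assumes "f \<in> vec N" "M = N + 2 * n" "1 \<le> n"
  shows "Ins n p f \<in> vec M"
proof -
  have "Ins n p f w = 0" if "length w \<noteq> N + 2 * n" for w
  proof (cases "length (take (2 * n) (drop p w)) = 2 * n")
    case True
    then have "length (take p w @ drop (p + 2 * n) w) \<noteq> N"
      using that assms(3) by (auto simp: min_def split: if_splits)
    then show ?thesis
      using assms(1) by (simp add: Ins_def vec_def)
  qed (simp add: Ins_def delta_eq_0)
  then show ?thesis
    by (simp add: vec_def assms(2))
qed

lemma Con_vec:
  assumes "f \<in> vec M" "M = N + 2 * n"
  shows "Con n p f \<in> vec N"
proof -
  have "f (take p w @ v @ drop p w) = 0" if "length w \<noteq> N" "length v = 2 * n" for w v
    by (rule vecD[OF assms(1)]) (use that assms(2) in auto)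
  then show ?thesis
    by (simp add: vec_def Con_def)
qed

lemma Ins_add: "Ins n p (f + g) = Ins n p f + Ins n p g"
  by (simp add: Ins_def fun_eq_iff algebra_simps pointwise)

lemma Ins_smul: "Ins n p (c \<cdot> f) = c \<cdot> Ins n p f"
  by (simp add: Ins_def fun_eq_iff pointwise)

lemma Ins_zero [simp]: "Ins n p 0 = 0"
  by (simp add: Ins_def fun_eq_iff pointwise)

lemma Con_add: "Con n p (f + g) = Con n p f + Con n p g"
  by (simp add: Con_def fun_eq_iff algebra_simps sum.distrib pointwise)

lemma Con_smul: "Con n p (c \<cdot> f) = c \<cdot> Con n p f"
  by (simp add: Con_def fun_eq_iff sum_distrib_left algebra_simps pointwise)

lemma Con_zero [simp]: "Con n p 0 = 0"
  by (simp add: Con_def fun_eq_iff pointwise)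

lemma Con_sum: "Con n p (\<Sum>i\<in>A. f i) = (\<Sum>i\<in>A. Con n p (f i))"
  by (induction A rule: infinite_finite_induct) (simp_all add: Con_add)

lemma Con_Ins_same:
  assumes f: "f \<in> vec N" and p: "p \<le> N" and n: "1 \<le> n"
  shows "Con n p (Ins n p f) = of_nat (n + 1) \<cdot> f"
proof (rule vec_eqI[of _ N])
  show "Con n p (Ins n p f) \<in> vec N" "of_nat (n + 1) \<cdot> f \<in> vec N"
    using f n by (auto intro!: Con_vec[of _ "N + 2 * n"] Ins_vec fv.subspace_scale[OF subspace_vec])
next
  fix w :: "bool list" assume "length w = N"
  with p have "length w = p + (N - p)" by simp
  then obtain x y where w: "w = x @ y" "length x = p" "length y = N - p"
    by (rule word_split)
  have "Con n p (Ins n p f) w = (\<Sum>v\<in>lists_len (2 * n). delta n v * delta n v * f w)"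
    using w by (auto simp: Con_append Ins_append intro!: sum.cong)
  then show "Con n p (Ins n p f) w = (of_nat (n + 1) \<cdot> f) w"
    by (simp only: delta_norm pointwise flip: sum_distrib_right)
qed

text \<open>The contracted block \<open>a @ b\<close> and the inserted block \<open>b @ c\<close>
  overlap in \<open>b\<close> only, so this is a zigzag; symmetry of f in the slot at p lets it be
  straightened.\<close>

lemma Con_Ins_up:
  assumes f: "f \<in> vec N" and p: "p + n \<le> N" and n: "1 \<le> n" and s: "symat n p f"
  shows "Con n p (Ins n (p + n) f) = (-1) ^ n \<cdot> f"
proof (rule vec_eqI[of _ N])
  show "Con n p (Ins n (p + n) f) \<in> vec N" "(-1) ^ n \<cdot> f \<in> vec N"
    using f n by (auto intro!: Con_vec[of _ "N + 2 * n"] Ins_vec fv.subspace_scale[OF subspace_vec])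
next
  fix w :: "bool list" assume "length w = N"
  with p have "length w = p + (n + (N - p - n))" by simp
  then obtain x c y where w: "w = x @ c @ y" "length x = p" "length c = n"
    by (rule word_split3)
  have I: "Ins n (p + n) f (x @ a @ b @ c @ y) = delta n (b @ c) * f (x @ a @ y)"
    if "length a = n" "length b = n" for a b
    using Ins_append[of "x @ a" "p + n" "b @ c" n f y] w that by simp
  have "Con n p (Ins n (p + n) f) w = (\<Sum>a\<in>lists_len n. \<Sum>b\<in>lists_len n. delta n (a @ b) * delta n (b @ c) * f (x @ a @ y))"
    using w by (auto simp: Con_append sum_lists_len_double I intro!: sum.cong)
  also have "\<dots> = (-1) ^ n * f (x @ c @ y)"
    using w by (intro zigzag(1) symatD[OF s])
  finally show "Con n p (Ins n (p + n) f) w = ((-1) ^ n \<cdot> f) w"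
    by (simp add: w pointwise)
qed

lemma Con_Ins_down:
  assumes f: "f \<in> vec N" and p: "p + n \<le> N" and n: "1 \<le> n" and s: "symat n p f"
  shows "Con n (p + n) (Ins n p f) = (-1) ^ n \<cdot> f"
proof (rule vec_eqI[of _ N])
  show "Con n (p + n) (Ins n p f) \<in> vec N" "(-1) ^ n \<cdot> f \<in> vec N"
    using f n by (auto intro!: Con_vec[of _ "N + 2 * n"] Ins_vec fv.subspace_scale[OF subspace_vec])
next
  fix w :: "bool list" assume "length w = N"
  with p have "length w = p + (n + (N - p - n))" by simp
  then obtain x c y where w: "w = x @ c @ y" "length x = p" "length c = n"
    by (rule word_split3)
  have I: "Ins n p f (x @ c @ b @ a @ y) = delta n (c @ b) * f (x @ a @ y)"
    if "length a = n" "length b = n" for a b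
    using Ins_append[of x p "c @ b" n f "a @ y"] w that by simp
  have "Con n (p + n) (Ins n p f) w = (\<Sum>b\<in>lists_len n. \<Sum>a\<in>lists_len n. delta n (b @ a) * delta n (c @ b) * f (x @ a @ y))"
    using w Con_append[of "x @ c" "p + n" n "Ins n p f" y]
    by (auto simp: sum_lists_len_double I intro!: sum.cong)
  also have "\<dots> = (-1) ^ n * f (x @ c @ y)"
    using w by (intro zigzag(2) symatD[OF s])
  finally show "Con n (p + n) (Ins n p f) w = ((-1) ^ n \<cdot> f) w"
    by (simp add: w pointwise)
qed

text \<open>The two operators touch disjoint letters. Contracting on the left removes 2n letters,
  which moves the insertion from q + 2n to q.\<close>

lemma Con_Ins_far:
  assumes f: "f \<in> vec (K + 2 * n)" and p: "p \<le> q" "q \<le> K" and n: "1 \<le> n"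
  shows "Con n p (Ins n (q + 2 * n) f) = Ins n q (Con n p f)"
proof (rule vec_eqI[of _ "K + 2 * n"])
  show "Con n p (Ins n (q + 2 * n) f) \<in> vec (K + 2 * n)" "Ins n q (Con n p f) \<in> vec (K + 2 * n)"
    using f n by (auto intro!: Con_vec Ins_vec)
next
  fix w :: "bool list" assume "length w = K + 2 * n"
  with p have "length w = p + ((q - p) + (2 * n + (K - q)))" by simp
  then obtain x m v y where w: "w = x @ m @ v @ y" "length x = p" "length m = q - p" "length v = 2 * n"
    by (elim word_split3 word_split) auto
  have I: "Ins n (q + 2 * n) f (x @ u @ m @ v @ y) = delta n v * f (x @ u @ m @ y)"
    if "length u = 2 * n" for u
    using Ins_append[of "x @ u @ m" "q + 2 * n" v n f y] w p that by simp
  have J: "Ins n q (Con n p f) w = delta n v * Con n p f (x @ m @ y)"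
    using Ins_append[of "x @ m" q v n "Con n p f" y] w p by simp
  show "Con n p (Ins n (q + 2 * n) f) w = Ins n q (Con n p f) w"
    unfolding J using w by (auto simp: Con_append I sum_distrib_left intro!: sum.cong)
qed

lemma Con_Ins_far':
  assumes f: "f \<in> vec (K + 2 * n)" and p: "p \<le> q" "q \<le> K" and n: "1 \<le> n"
  shows "Con n (q + 2 * n) (Ins n p f) = Ins n p (Con n q f)"
proof (rule vec_eqI[of _ "K + 2 * n"])
  show "Con n (q + 2 * n) (Ins n p f) \<in> vec (K + 2 * n)" "Ins n p (Con n q f) \<in> vec (K + 2 * n)"
    using f n by (auto intro!: Con_vec Ins_vec)
next
  fix w :: "bool list" assume "length w = K + 2 * n"
  with p have "length w = p + (2 * n + ((q - p) + (K - q)))" by simp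
  then obtain x v m y where w: "w = x @ v @ m @ y" "length x = p" "length m = q - p" "length v = 2 * n"
    by (elim word_split3 word_split) auto
  have I: "Con n (q + 2 * n) (Ins n p f) w = (\<Sum>u\<in>lists_len (2 * n). delta n u * Ins n p f (x @ v @ m @ u @ y))"
    using Con_append[of "x @ v @ m" "q + 2 * n" n "Ins n p f" y] w p by simp
  have J: "Con n q f (x @ m @ y) = (\<Sum>u\<in>lists_len (2 * n). delta n u * f (x @ m @ u @ y))"
    using Con_append[of "x @ m" q n f y] w p by simp
  show "Con n (q + 2 * n) (Ins n p f) w = Ins n p (Con n q f) w"
    unfolding I using w by (auto simp: Ins_append J sum_distrib_left intro!: sum.cong)
qed

lemma Con_Con:
  assumes f: "f \<in> vec (K + 2 * n + 2 * n)" and p: "p \<le> q" "q \<le> K" and n: "1 \<le> n"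
  shows "Con n p (Con n (q + 2 * n) f) = Con n q (Con n p f)"
proof (rule vec_eqI[of _ K])
  show "Con n p (Con n (q + 2 * n) f) \<in> vec K" "Con n q (Con n p f) \<in> vec K"
    using f by (auto intro!: Con_vec)
next
  fix w :: "bool list" assume "length w = K"
  with p have "length w = p + ((q - p) + (K - q))" by simp
  then obtain x m y where w: "w = x @ m @ y" "length x = p" "length m = q - p"
    by (rule word_split3)
  have I: "Con n (q + 2 * n) f (x @ u @ m @ y) = (\<Sum>v\<in>lists_len (2 * n). delta n v * f (x @ u @ m @ v @ y))"
    if "length u = 2 * n" for u
    using Con_append[of "x @ u @ m" "q + 2 * n" n f y] w p that by simp
  have J: "Con n q (Con n p f) w = (\<Sum>v\<in>lists_len (2 * n). delta n v * Con n p f (x @ m @ v @ y))"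
    using Con_append[of "x @ m" q n "Con n p f" y] w p by simp
  have "Con n p (Con n (q + 2 * n) f) w
      = (\<Sum>u\<in>lists_len (2 * n). \<Sum>v\<in>lists_len (2 * n). delta n v * (delta n u * f (x @ u @ m @ v @ y)))"
    using w by (auto simp: Con_append I sum_distrib_left intro!: sum.cong)
  also have "\<dots> = Con n q (Con n p f) w"
    unfolding J using w by (subst sum.swap) (auto simp: Con_append sum_distrib_left intro!: sum.cong)
  finally show "Con n p (Con n (q + 2 * n) f) w = Con n q (Con n p f) w" .
qed

lemma cinner_Ins:
  assumes p: "p \<le> K" and M: "M = K + 2 * n"
  shows "cinner M (Ins n p f) g = cinner K f (Con n p g)"
proof -
  obtain r where K: "K = p + r"
    using p le_Suc_ex by blast
  have M': "M = p + (2 * n + r)"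
    using K M by simp
  have "cinner M (Ins n p f) g = (\<Sum>x\<in>lists_len p. \<Sum>v\<in>lists_len (2 * n). \<Sum>y\<in>lists_len r.
      delta n v * cnj (f (x @ y)) * g (x @ v @ y))"
    unfolding cinner_def M' sum_lists_len_add by (intro sum.cong) (auto simp: Ins_append)
  also have "\<dots> = (\<Sum>x\<in>lists_len p. \<Sum>y\<in>lists_len r. \<Sum>v\<in>lists_len (2 * n).
      delta n v * cnj (f (x @ y)) * g (x @ v @ y))"
    by (intro sum.cong refl sum.swap)
  also have "\<dots> = cinner K f (Con n p g)"
    unfolding cinner_def K sum_lists_len_add
    by (auto intro!: sum.cong simp: Con_append sum_distrib_left)
  finally show ?thesis .
qed

subsection \<open>The group action\<close>

text \<open>The matrix entry of the tensor power of g between two basis words, as a product over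
  lists so that it splits along concatenation.\<close>

definition mon :: "(bool \<Rightarrow> bool \<Rightarrow> complex) \<Rightarrow> bool list \<Rightarrow> bool list \<Rightarrow> complex" where
  "mon g w v = prod_list (map2 g w v)"

lemma mon_simps [simp]:
  "mon g [] v = 1" "mon g (a # w) (b # v) = g a b * mon g w v"
  by (simp_all add: mon_def)

lemma mon_append: "length u = length u' \<Longrightarrow> mon g (u @ w) (u' @ w') = mon g u u' * mon g w w'"
  by (simp add: mon_def)

lemma prod_eq_mon: "length w = length v \<Longrightarrow> (\<Prod>i<length w. g (w ! i) (v ! i)) = mon g w v"
proof (induction w v rule: list_induct2)
  case (Cons x xs y ys)
  then show ?case
    by (simp add: prod.lessThan_Suc_shift del: prod.lessThan_Suc)
qed simp

lemma mon_transpose: "length w = length v \<Longrightarrow> mon (\<lambda>i j. g j i) v w = mon g w v"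
  by (induction w v rule: list_induct2) auto

lemma mon_replicate: "mon g (replicate (length a) i) a = g i False ^ (length a - cnt a) * g i True ^ cnt a"
proof (induction a)
  case (Cons x a)
  then show ?case
    using cnt_le[of a] by (cases x) (auto simp: Suc_diff_le)
qed simp

lemma mon_permute_list:
  assumes "\<sigma> permutes {..<n}" "length x = n" "length y = n"
  shows "mon g (permute_list \<sigma> x) (permute_list \<sigma> y) = mon g x y"
proof -
  have "(\<Prod>i<n. g (x ! i) (y ! i)) = (\<Prod>i<n. g (x ! \<sigma> i) (y ! \<sigma> i))"
    using prod.permute[OF assms(1), of "\<lambda>i. g (x ! i) (y ! i)"] by (simp add: comp_def)
  also have "\<dots> = (\<Prod>i<n. g (permute_list \<sigma> x ! i) (permute_list \<sigma> y ! i))"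
    using assms by (intro prod.cong) (auto simp: permute_list_nth)
  finally show ?thesis
    using prod_eq_mon[of x y g] prod_eq_mon[of "permute_list \<sigma> x" "permute_list \<sigma> y" g] assms by simp
qed

lemma act_apply: "length w = N \<Longrightarrow> act g N f w = (\<Sum>v\<in>lists_len N. mon g w v * f v)"
  by (auto simp: act_def simp flip: prod_eq_mon intro!: sum.cong)

lemma act_vec [simp]: "act g N f \<in> vec N"
  by (simp add: vec_def act_def)

lemma act_add: "act g N (f + h) = act g N f + act g N h"
  by (simp add: act_def fun_eq_iff algebra_simps sum.distrib pointwise)

lemma act_smul: "act g N (c \<cdot> f) = c \<cdot> act g N f"
  by (simp add: act_def fun_eq_iff sum_distrib_left algebra_simps pointwise)

lemma act_zero [simp]: "act g N 0 = 0"
  by (simp add: act_def fun_eq_iff pointwise)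

lemma act_sum: "act g N (\<Sum>i\<in>A. f i) = (\<Sum>i\<in>A. act g N (f i))"
  by (induction A rule: infinite_finite_induct) (simp_all add: act_add)

lemma SU2_entries:
  assumes "g \<in> SU2"
  shows "g True True = cnj (g False False)" "g False True = - cnj (g True False)"
    and "cnj (g False False) * g False False + cnj (g True False) * g True False = 1"
proof -
  let ?a = "g False False" and ?b = "g False True" and ?c = "g True False" and ?d = "g True True"
  have uni: "\<And>i j. (\<Sum>k\<in>UNIV. cnj (g k i) * g k j) = (if i = j then 1 else 0)"
    and det: "?a * ?d - ?b * ?c = 1"
    using assms by (auto simp: SU2_def)
  have 1: "cnj ?a * ?a + cnj ?c * ?c = 1"
    using uni[of False False] by (simp add: UNIV_bool)
  have 2: "cnj ?a * ?b + cnj ?c * ?d = 0"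
    using uni[of False True] by (simp add: UNIV_bool)
  show "cnj ?a * ?a + cnj ?c * ?c = 1"
    by (fact 1)
  \<comment> \<open>The right side is a combination of the defects in the norm of the first column,
    the determinant, and the orthogonality of the columns. All three are zero.\<close>
  have "?d - cnj ?a = (1 - (cnj ?a * ?a + cnj ?c * ?c)) * ?d + cnj ?a * (?a * ?d - ?b * ?c - 1)
      + ?c * (cnj ?a * ?b + cnj ?c * ?d)"
    by algebra
  then show "?d = cnj ?a"
    using 1 2 det by simp
  have "?b + cnj ?c = (1 - (cnj ?a * ?a + cnj ?c * ?c)) * ?b - cnj ?c * (?a * ?d - ?b * ?c - 1)
      + ?a * (cnj ?a * ?b + cnj ?c * ?d)"
    by algebra
  then show "?b = - cnj ?c"
    using 1 2 det by (simp add: eq_neg_iff_add_eq_0)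
qed

lemma SU2_transpose:
  assumes "g \<in> SU2"
  shows "(\<lambda>i j. g j i) \<in> SU2"
  using SU2_entries[OF assms]
  by (auto simp: SU2_def UNIV_bool all_bool_eq algebra_simps)

lemma SU2_det: "g \<in> SU2 \<Longrightarrow> g False False * g True True - g False True * g True False = 1"
  by (simp add: SU2_def)

subsection \<open>Symmetric tensors\<close>

lemma count_False: "count_list w False + cnt w = length w"
  by (induction w) (auto simp: cnt_def)

lemma mset_eq_if_cnt_eq:
  assumes "length a = length b" "cnt a = cnt b"
  shows "mset a = mset b"
proof (rule multiset_eqI)
  fix x
  show "count (mset a) x = count (mset b) x"
    using assms count_False[of a] count_False[of b] by (cases x) (auto simp: count_mset cnt_def)
qed

lemma cnt_permute_list:
  assumes "\<sigma> permutes {..<length a}"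
  shows "cnt (permute_list \<sigma> a) = cnt a"
  using mset_permute_list[OF assms] by (simp add: cnt_def flip: count_mset)

lemma cnt_eq_permute_list:
  assumes "length a = n" "length b = n" "cnt a = cnt b"
  obtains \<sigma> where "\<sigma> permutes {..<n}" "permute_list \<sigma> b = a"
  using mset_eq_permutation[OF mset_eq_if_cnt_eq[of a b]] assms by auto

text \<open>Two words of the same length and the same \<open>cnt\<close> differ by a permutation, so
  a symmetric tensor is a function of the weight \<open>cnt\<close> alone.\<close>

lemma Lsym_eq: "Lsym n = {f \<in> vec n. \<forall>a b. length a = n \<and> length b = n \<and> cnt a = cnt b \<longrightarrow> f a = f b}"
proof (intro equalityI subsetI CollectI conjI allI impI)
  fix f a b
  assume f: "f \<in> Lsym n" and ab: "length a = n \<and> length b = n \<and> cnt a = cnt b"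
  then obtain \<sigma> where \<sigma>: "\<sigma> permutes {..<n}" "permute_list \<sigma> b = a"
    using cnt_eq_permute_list by metis
  from f \<sigma>(1) have "perm_factors \<sigma> n f = f"
    by (simp add: Lsym_def)
  then have "f b = perm_factors \<sigma> n f b"
    by simp
  then show "f a = f b"
    using \<sigma> ab by (simp add: perm_factors_def permute_list_def)
next
  fix f assume f': "f \<in> {f \<in> vec n. \<forall>a b. length a = n \<and> length b = n \<and> cnt a = cnt b \<longrightarrow> f a = f b}"
  then have f: "f \<in> vec n"
    and fc: "\<And>a b. length a = n \<Longrightarrow> length b = n \<Longrightarrow> cnt a = cnt b \<Longrightarrow> f a = f b"
    by blast+
  have "perm_factors \<sigma> n f = f" if \<sigma>: "\<sigma> permutes {..<n}" for \<sigma>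
  proof
    fix w
    show "perm_factors \<sigma> n f w = f w"
    proof (cases "length w = n")
      case True
      then have "cnt (permute_list \<sigma> w) = cnt w"
        using \<sigma> cnt_permute_list by blast
      then have "f (permute_list \<sigma> w) = f w"
        using True by (intro fc) auto
      then show ?thesis
        using True by (simp add: perm_factors_def permute_list_def)
    qed (use f in \<open>auto simp: perm_factors_def vec_def\<close>)
  qed
  then show "f \<in> Lsym n"
    using f by (simp add: Lsym_def)
qed (simp add: Lsym_def)

lemma Lsym_subset_vec: "Lsym n \<subseteq> vec n"
  by (auto simp: Lsym_def)

lemma LsymI:
  "f \<in> vec n \<Longrightarrow> (\<And>a b. length a = n \<Longrightarrow> length b = n \<Longrightarrow> cnt a = cnt b \<Longrightarrow> f a = f b) \<Longrightarrow> f \<in> Lsym n"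
  unfolding Lsym_eq by blast

lemma LsymD:
  "f \<in> Lsym n \<Longrightarrow> length a = n \<Longrightarrow> length b = n \<Longrightarrow> cnt a = cnt b \<Longrightarrow> f a = f b"
  unfolding Lsym_eq by blast

lemma subspace_Lsym: "fv.subspace (Lsym n)"
  unfolding fv.subspace_def
proof (intro conjI ballI allI)
  show "0 \<in> Lsym n"
    by (rule LsymI) (simp_all add: pointwise fv.subspace_0[OF subspace_vec])
next
  fix f h assume fh: "f \<in> Lsym n" "h \<in> Lsym n"
  show "f + h \<in> Lsym n"
  proof (rule LsymI)
    show "f + h \<in> vec n"
      using fh Lsym_subset_vec by (intro fv.subspace_add[OF subspace_vec]) auto
    fix a b assume "length a = n" "length b = n" "cnt a = cnt b"
    then show "(f + h) a = (f + h) b"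
      unfolding plus_fun_apply using fh by (intro arg_cong2[of _ _ _ _ "(+)"] LsymD)
  qed
next
  fix c f assume f: "f \<in> Lsym n"
  show "c \<cdot> f \<in> Lsym n"
  proof (rule LsymI)
    show "c \<cdot> f \<in> vec n"
      using f Lsym_subset_vec by (intro fv.subspace_scale[OF subspace_vec]) auto
    fix a b assume "length a = n" "length b = n" "cnt a = cnt b"
    then show "(c \<cdot> f) a = (c \<cdot> f) b"
      unfolding smul_apply using f by (intro arg_cong2[of _ _ _ _ "(*)"] LsymD refl)
  qed
qed

lemma bij_permute_list:
  assumes "\<sigma> permutes {..<n}"
  shows "bij_betw (permute_list \<sigma>) (lists_len n) (lists_len n)"
proof (rule bij_betwI[where g = "permute_list (inv \<sigma>)"])
  have inv: "inv \<sigma> permutes {..<n}"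
    by (rule permutes_inv[OF assms])
  show "permute_list (inv \<sigma>) (permute_list \<sigma> x) = x" if "x \<in> lists_len n" for x
    using permute_list_compose[of "inv \<sigma>" x \<sigma>] inv that permutes_inv_o[OF assms] by simp
  show "permute_list \<sigma> (permute_list (inv \<sigma>) x) = x" if "x \<in> lists_len n" for x
    using permute_list_compose[of \<sigma> x "inv \<sigma>"] assms that permutes_inv_o[OF assms] by simp
qed auto

text \<open>The tensor power of g commutes with permutations of the factors: permuting the summation
  word by the permutation that takes b to a turns one sum into the other.\<close>

lemma sum_mon_cnt_cong:
  assumes F: "\<And>a b. length a = n \<Longrightarrow> length b = n \<Longrightarrow> cnt a = cnt b \<Longrightarrow> F a = F b"
    and ab: "length a = n" "length b = n" "cnt a = cnt b"
  shows "(\<Sum>v\<in>lists_len n. mon g a v * F v) = (\<Sum>v\<in>lists_len n. mon g b v * F v)"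
proof -
  obtain \<sigma> where \<sigma>: "\<sigma> permutes {..<n}" "permute_list \<sigma> b = a"
    using ab cnt_eq_permute_list by metis
  have "(\<Sum>v\<in>lists_len n. mon g a v * F v)
      = (\<Sum>v\<in>lists_len n. mon g a (permute_list \<sigma> v) * F (permute_list \<sigma> v))"
    by (rule sum.reindex_bij_betw[OF bij_permute_list[OF \<sigma>(1)], symmetric])
  also have "\<dots> = (\<Sum>v\<in>lists_len n. mon g b v * F v)"
  proof (intro sum.cong refl)
    fix v assume "v \<in> lists_len n"
    then have v: "length v = n" by simp
    then have "F (permute_list \<sigma> v) = F v"
      using \<sigma>(1) cnt_permute_list[of \<sigma> v] by (intro F) auto
    moreover have "mon g a (permute_list \<sigma> v) = mon g b v"
      unfolding \<sigma>(2)[symmetric] using \<sigma>(1) ab(2) v by (rule mon_permute_list)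
    ultimately show "mon g a (permute_list \<sigma> v) * F (permute_list \<sigma> v) = mon g b v * F v"
      by simp
  qed
  finally show ?thesis .
qed

subsection \<open>Invariance of the distinguished vector\<close>

text \<open>The coordinates of f0 \<otimes> f1 - f1 \<otimes> f0, on which g acts by its
  determinant.\<close>

definition omega :: "bool \<Rightarrow> bool \<Rightarrow> complex" where
  "omega i j = (if i = j then 0 else if j then 1 else -1)"

text \<open>The symmetrisation of the \<open>n\<close>-th power of the invariant \<open>omega\<close>: a multiple of \<open>delta\<close>, but
  evidently invariant.\<close>

definition alternant :: "nat \<Rightarrow> bool list \<Rightarrow> complex" where
  "alternant n w = (if length w = 2 * n then
     (\<Sum>\<sigma> | \<sigma> permutes {..<n}. mon omega (take n w) (permute_list \<sigma> (drop n w))) else 0)"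

lemma alternant_append:
  "length a = n \<Longrightarrow> length b = n \<Longrightarrow> alternant n (a @ b) = (\<Sum>\<sigma> | \<sigma> permutes {..<n}. mon omega a (permute_list \<sigma> b))"
  by (simp add: alternant_def)

text \<open>Each pair of letters in corresponding positions is acted on separately and contributes a
  factor det g = 1.\<close>

lemma mon_omega_invariant:
  assumes "g \<in> SU2" "length a = length c"
  shows "(\<Sum>a'\<in>lists_len (length a). \<Sum>c'\<in>lists_len (length a). mon g a a' * mon g c c' * mon omega a' c') = mon omega a c"
  using assms(2)
proof (induction a c rule: list_induct2)
  case (Cons x a y c)
  let ?S = "\<Sum>a'\<in>lists_len (length a). \<Sum>c'\<in>lists_len (length a). mon g a a' * mon g c c' * mon omega a' c'"
  have "(\<Sum>a'\<in>lists_len (length (x # a)). \<Sum>c'\<in>lists_len (length (x # a)).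
      mon g (x # a) a' * mon g (y # c) c' * mon omega a' c')
      = (g x False * g y True - g x True * g y False) * ?S"
    by (simp add: sum_lists_len_Suc omega_def sum.distrib sum_subtractf sum_negf sum_distrib_left algebra_simps)
  \<comment> \<open>This is the determinant of rows x and y of g: zero for equal rows, and otherwise
    det g up to the order of the rows.\<close>
  also have "g x False * g y True - g x True * g y False = omega x y"
    using SU2_det[OF assms(1)] by (cases x; cases y) (auto simp: omega_def algebra_simps)
  finally show ?case
    by (simp add: Cons.IH)
qed simp

text \<open>Invariance holds for every permutation separately: relabelling the right-hand summation
  words by it leaves a letterwise pairing with \<open>omega\<close>.\<close>

lemma alternant_invariant:
  assumes g: "g \<in> SU2"
  shows "act g (2 * n) (alternant n) = alternant n"
proof (rule vec_eqI[of _ "2 * n"])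
  show "alternant n \<in> vec (2 * n)"
    by (simp add: vec_def alternant_def)
next
  fix w :: "bool list"
  assume "length w = 2 * n"
  then have "length w = n + n" by simp
  then obtain a b where w: "w = a @ b" and a: "length a = n" and b: "length b = n"
    by (rule word_split)
  have "act g (2 * n) (alternant n) w
      = (\<Sum>a'\<in>lists_len n. \<Sum>b'\<in>lists_len n. \<Sum>\<sigma> | \<sigma> permutes {..<n}.
          mon g a a' * mon g b b' * mon omega a' (permute_list \<sigma> b'))"
    using a b by (auto simp: w act_apply sum_lists_len_double mon_append alternant_append sum_distrib_left
        intro!: sum.cong)
  also have "\<dots> = (\<Sum>a'\<in>lists_len n. \<Sum>\<sigma> | \<sigma> permutes {..<n}. \<Sum>b'\<in>lists_len n.
          mon g a a' * mon g b b' * mon omega a' (permute_list \<sigma> b'))"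
    by (intro sum.cong refl sum.swap)
  also have "\<dots> = (\<Sum>\<sigma> | \<sigma> permutes {..<n}. \<Sum>a'\<in>lists_len n. \<Sum>b'\<in>lists_len n.
          mon g a a' * mon g b b' * mon omega a' (permute_list \<sigma> b'))"
    by (rule sum.swap)
  also have "\<dots> = (\<Sum>\<sigma> | \<sigma> permutes {..<n}. mon omega a (permute_list \<sigma> b))"
  proof (intro sum.cong refl)
    fix \<sigma> assume "\<sigma> \<in> {\<sigma>. \<sigma> permutes {..<n}}"
    then have \<sigma>: "\<sigma> permutes {..<n}" by simp
    have "(\<Sum>b'\<in>lists_len n. mon g a a' * mon g b b' * mon omega a' (permute_list \<sigma> b'))
        = (\<Sum>c\<in>lists_len n. mon g a a' * mon g (permute_list \<sigma> b) c * mon omega a' c)" for a'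
    proof -
      have "(\<Sum>c\<in>lists_len n. mon g a a' * mon g (permute_list \<sigma> b) c * mon omega a' c)
          = (\<Sum>b'\<in>lists_len n. mon g a a' * mon g (permute_list \<sigma> b) (permute_list \<sigma> b') * mon omega a' (permute_list \<sigma> b'))"
        by (rule sum.reindex_bij_betw[OF bij_permute_list[OF \<sigma>], symmetric])
      also have "\<dots> = (\<Sum>b'\<in>lists_len n. mon g a a' * mon g b b' * mon omega a' (permute_list \<sigma> b'))"
        using b by (intro sum.cong) (auto simp: mon_permute_list[OF \<sigma>])
      finally show ?thesis ..
    qed
    then show "(\<Sum>a'\<in>lists_len n. \<Sum>b'\<in>lists_len n. mon g a a' * mon g b b' * mon omega a' (permute_list \<sigma> b'))
        = mon omega a (permute_list \<sigma> b)"
      using mon_omega_invariant[OF g, of a "permute_list \<sigma> b"] a b by simp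
  qed
  also have "\<dots> = alternant n w"
    using a b by (simp add: w alternant_append)
  finally show "act g (2 * n) (alternant n) w = alternant n w" .
qed simp

lemma alternant_permute_right:
  assumes "\<tau> permutes {..<n}" "length a = n" "length b = n"
  shows "alternant n (a @ permute_list \<tau> b) = alternant n (a @ b)"
proof -
  have "alternant n (a @ permute_list \<tau> b) = (\<Sum>\<sigma> | \<sigma> permutes {..<n}. mon omega a (permute_list (\<tau> \<circ> \<sigma>) b))"
    using assms by (auto simp: alternant_append permute_list_compose intro!: sum.cong)
  also have "\<dots> = alternant n (a @ b)"
    using assms setum_permutations_compose_left[OF assms(1), of "\<lambda>\<sigma>. mon omega a (permute_list \<sigma> b)"]
    by (simp add: alternant_append)
  finally show ?thesis .
qed

lemma alternant_permute_left:
  assumes \<tau>: "\<tau> permutes {..<n}" and a: "length a = n" and b: "length b = n"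
  shows "alternant n (permute_list \<tau> a @ b) = alternant n (a @ b)"
proof -
  have inv: "inv \<tau> permutes {..<n}"
    by (rule permutes_inv[OF \<tau>])
  have *: "mon omega (permute_list \<tau> a) c = mon omega a (permute_list (inv \<tau>) c)" if c: "length c = n" for c
  proof -
    have "permute_list \<tau> (permute_list (inv \<tau>) c) = c"
      using permute_list_compose[of \<tau> c "inv \<tau>"] \<tau> c permutes_inv_o[OF \<tau>] by simp
    then show ?thesis
      using mon_permute_list[OF \<tau>, of a "permute_list (inv \<tau>) c" omega] a c by simp
  qed
  have "alternant n (permute_list \<tau> a @ b) = (\<Sum>\<sigma> | \<sigma> permutes {..<n}. mon omega a (permute_list (\<sigma> \<circ> inv \<tau>) b))"
    using a b inv by (auto simp: alternant_append permute_list_compose * intro!: sum.cong)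
  also have "\<dots> = alternant n (a @ b)"
    using a b sum_permutations_compose_right[OF inv, of "\<lambda>\<sigma>. mon omega a (permute_list \<sigma> b)"]
    by (simp add: alternant_append)
  finally show ?thesis .
qed

lemma alternant_in_detsp: "alternant n \<in> detsp n"
proof -
  have "(\<lambda>u. alternant n (u @ v)) \<in> Lsym n" if v: "length v = n" for v
    unfolding Lsym_eq
  proof (intro CollectI conjI allI impI)
    show "(\<lambda>u. alternant n (u @ v)) \<in> vec n"
      using v by (simp add: vec_def alternant_def)
    fix a b
    assume ab: "length a = n \<and> length b = n \<and> cnt a = cnt b"
    then obtain \<sigma> where "\<sigma> permutes {..<n}" "permute_list \<sigma> b = a"
      using cnt_eq_permute_list by metis
    then show "alternant n (a @ v) = alternant n (b @ v)"
      using alternant_permute_left[of \<sigma> n b v] ab v by simp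
  qed
  moreover have "(\<lambda>v. alternant n (u @ v)) \<in> Lsym n" if u: "length u = n" for u
    unfolding Lsym_eq
  proof (intro CollectI conjI allI impI)
    show "(\<lambda>v. alternant n (u @ v)) \<in> vec n"
      using u by (simp add: vec_def alternant_def)
    fix a b
    assume ab: "length a = n \<and> length b = n \<and> cnt a = cnt b"
    then obtain \<sigma> where "\<sigma> permutes {..<n}" "permute_list \<sigma> b = a"
      using cnt_eq_permute_list by metis
    then show "alternant n (u @ a) = alternant n (u @ b)"
      using alternant_permute_right[of \<sigma> n u b] ab u by simp
  qed
  moreover have "alternant n \<in> vec (n + n)"
    by (simp add: vec_def alternant_def)
  ultimately show ?thesis
    using tens_eq_slices[OF subspace_Lsym Lsym_subset_vec subspace_Lsym Lsym_subset_vec, of n n]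
    by (simp add: detsp_def alternant_invariant slices_def)
qed

text \<open>At this word every permutation contributes 1, so the value is the number of
  permutations.\<close>

lemma alternant_nonzero: "alternant n (replicate n False @ replicate n True) \<noteq> 0"
proof -
  have "permute_list \<sigma> (replicate n True) = replicate n True" if "\<sigma> permutes {..<n}" for \<sigma>
    using that permutes_in_image[OF that] by (intro nth_equalityI) (auto simp: permute_list_nth)
  moreover have "mon omega (replicate n False) (replicate n True) = 1"
    by (induction n) (auto simp: omega_def)
  ultimately have "alternant n (replicate n False @ replicate n True) = (\<Sum>\<sigma> | \<sigma> permutes {..<n}. 1)"
    unfolding alternant_append[OF length_replicate length_replicate] by (intro sum.cong) auto
  also have "\<dots> \<noteq> 0"
    by (simp add: card_permutations)
  finally show ?thesis .
qed

section \<open>Uniqueness of the invariant vector: torus weights and plane rotations\<close>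

lemma detsp_eq_slices:
  "detsp n = {\<xi> \<in> slices n n (Lsym n) (Lsym n). \<forall>g\<in>SU2. act g (2 * n) \<xi> = \<xi>}"
  using tens_eq_slices[OF subspace_Lsym Lsym_subset_vec subspace_Lsym Lsym_subset_vec, of n n]
  by (simp add: detsp_def)

definition diag :: "complex \<Rightarrow> bool \<Rightarrow> bool \<Rightarrow> complex" where
  "diag z i j = (if i = j then (if i then cnj z else z) else 0)"

lemma diag_simps [simp]:
  "diag z True True = cnj z" "diag z False False = z" "diag z True False = 0" "diag z False True = 0"
  by (simp_all add: diag_def)

lemma mon_diag:
  "length w = length v \<Longrightarrow> mon (diag z) w v = (if v = w then z ^ (length w - cnt w) * cnj z ^ cnt w else 0)"
proof (induction w v rule: list_induct2)
  case (Cons x w y v)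
  have "Suc (length w) - cnt w = Suc (length w - cnt w)"
    using cnt_le[of w] by (rule Suc_diff_le)
  then show ?case
    using Cons.IH by (cases x; cases y) simp_all
qed simp

lemma diag_in_SU2:
  assumes "z * cnj z = 1"
  shows "diag z \<in> SU2"
  using assms by (simp add: SU2_def UNIV_bool all_bool_eq mult.commute)

text \<open>A basis word with t letters True has torus weight 2(n - t), and an invariant vector has
  only components of weight zero.\<close>

lemma detsp_weight:
  assumes \<xi>: "\<xi> \<in> detsp n" and w: "length w = 2 * n" "cnt w \<noteq> n"
  shows "\<xi> w = 0"
proof -
  define t where "t = cnt w"
  have t: "t \<le> 2 * n" "t \<noteq> n"
    using w cnt_le[of w] by (auto simp: t_def)
  \<comment> \<open>The angle makes the torus element act on this word by cis pi = -1, which forces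
    \<xi> w = - \<xi> w.\<close>
  define \<theta> where "\<theta> = pi / (2 * (real n - real t))"
  define z where "z = cis \<theta>"
  have z: "z * cnj z = 1"
    by (simp add: z_def cis_cnj cis_mult)
  have "\<xi> w = act (diag z) (2 * n) \<xi> w"
    using \<xi> diag_in_SU2[OF z] by (simp add: detsp_def)
  also have "\<dots> = (\<Sum>v\<in>lists_len (2 * n). if v = w then z ^ (2 * n - t) * cnj z ^ t * \<xi> w else 0)"
    unfolding act_apply[OF w(1)] using w(1) by (intro sum.cong) (auto simp: mon_diag t_def)
  also have "\<dots> = z ^ (2 * n - t) * cnj z ^ t * \<xi> w"
    using w by simp
  also have "z ^ (2 * n - t) * cnj z ^ t = cis (real (2 * n - t) * \<theta> - real t * \<theta>)"
    by (simp add: z_def cis_cnj DeMoivre cis_mult)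
  also have "real (2 * n - t) * \<theta> - real t * \<theta> = (2 * (real n - real t)) * \<theta>"
    using t by (simp add: of_nat_diff algebra_simps)
  also have "\<dots> = pi"
    using t by (simp add: \<theta>_def)
  finally show ?thesis
    by simp
qed

text \<open>The rotation is parametrised by its slope, not its angle: up to one common factor the
  entries are then polynomials in r.\<close>

definition rot :: "real \<Rightarrow> bool \<Rightarrow> bool \<Rightarrow> complex" where
  "rot r i j = of_real (1 / sqrt (1 + r\<^sup>2)) * (if i = j then 1 else if i then of_real r else - of_real r)"

lemma rot_in_SU2: "rot r \<in> SU2"
proof -
  have pos: "1 + r\<^sup>2 > 0"
    by (simp add: add_pos_nonneg)
  have "(1 / sqrt (1 + r\<^sup>2))\<^sup>2 * (1 + r\<^sup>2) = 1"
    using pos by (simp add: power_divide)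
  moreover define k where "k = complex_of_real (1 / sqrt (1 + r\<^sup>2))"
  ultimately have "k\<^sup>2 * of_real (1 + r\<^sup>2) = 1"
    by (metis of_real_1 of_real_mult of_real_power)
  then have "k * k + k * k * (of_real r * of_real r) = 1" 
    by (simp add: power2_eq_square algebra_simps)
  moreover have "cnj k = k"
    by (simp add: k_def)
  ultimately show ?thesis
    unfolding SU2_def rot_def k_def[symmetric]
    by (simp add: UNIV_bool all_bool_eq algebra_simps)
qed

text \<open>Invariance under the rotations, evaluated at this single word, is an identity between polynomials
  in the square of the slope \<open>r\<close>; comparing coefficients gives all values of \<open>\<xi>\<close>.\<close>

lemma detsp_unique:
  assumes \<xi>: "\<xi> \<in> detsp n"
  shows "\<xi> = \<xi> (replicate n False @ replicate n True) \<cdot> delta n"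
proof -
  \<comment> \<open>A standard word for each distribution of the letters. Symmetry in both halves
    and weight zero determine \<xi> by the numbers X 0, ..., X n.\<close>
  define X where "X j = \<xi> ((replicate j True @ replicate (n - j) False) @ (replicate (n - j) True @ replicate j False))" for j
  have sl: "\<xi> \<in> slices n n (Lsym n) (Lsym n)"
    using \<xi> by (simp add: detsp_eq_slices)
  have cnt_rep: "cnt (replicate j b) = (if b then j else 0)" for j b
    by (induction j) (cases b; simp)+
  have \<xi>_X: "\<xi> (a @ b) = X (cnt a)" if ab: "length a = n" "length b = n" "cnt b = n - cnt a" for a b
  proof -
    let ?a = "replicate (cnt a) True @ replicate (n - cnt a) False"
      and ?b = "replicate (n - cnt a) True @ replicate (cnt a) False"
    have le: "cnt a \<le> n"
      using cnt_le[of a] ab by simp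
    have "length ?a = n"
      using le by simp
    moreover have "\<forall>v. length v = n \<longrightarrow> (\<lambda>u. \<xi> (u @ v)) \<in> Lsym n"
      "\<forall>u. length u = n \<longrightarrow> (\<lambda>v. \<xi> (u @ v)) \<in> Lsym n"
      using sl by (simp_all add: slices_def)
    ultimately have "(\<lambda>u. \<xi> (u @ b)) \<in> Lsym n" "(\<lambda>v. \<xi> (?a @ v)) \<in> Lsym n"
      using ab(2) by blast+
    from LsymD[OF this(1), of a ?a] LsymD[OF this(2), of b ?b] show ?thesis
      using ab le by (simp add: X_def cnt_rep)
  qed
  \<comment> \<open>The coefficient of r^(2j) in the invariance identity after clearing
    denominators. One binomial counts the left halves and one the right halves; the subtracted term
    comes from expanding (1 + r^2)^n X 0.\<close>
  define c where "c j = of_nat (n choose j) * of_nat (n choose j) * (-1) ^ j * X j - of_nat (n choose j) * X 0" for j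
  have eq0: "(\<Sum>j\<le>n. c j * (of_real (r\<^sup>2)) ^ j) = 0" for r
  proof -
    define k :: complex where "k = of_real (1 / sqrt (1 + r\<^sup>2))"
    have pos: "1 + r\<^sup>2 > 0"
      by (simp add: add_pos_nonneg)
    then have "(1 / sqrt (1 + r\<^sup>2))\<^sup>2 * (1 + r\<^sup>2) = 1"
      by (simp add: power_divide)
    then have "k\<^sup>2 * of_real (1 + r\<^sup>2) = 1"
      unfolding k_def by (metis of_real_1 of_real_mult of_real_power)
    \<comment> \<open>Here k is the cosine of the rotation; this relation clears the 2n factors k
      from the identity.\<close>
    then have k1: "k ^ n * k ^ n * of_real (1 + r\<^sup>2) ^ n = 1"
      by (metis power_mult_distrib power2_eq_square power_one)
    let ?F = "replicate n False" and ?T = "replicate n True"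
    have "X 0 = \<xi> (?F @ ?T)"
      using \<xi>_X[of ?F ?T] by (simp add: cnt_rep)
    also have "\<dots> = act (rot r) (2 * n) \<xi> (?F @ ?T)"
      using \<xi> rot_in_SU2 by (simp add: detsp_def)
    also have "\<dots> = (\<Sum>a\<in>lists_len n. \<Sum>b\<in>lists_len n. mon (rot r) ?F a * mon (rot r) ?T b * \<xi> (a @ b))"
      by (auto simp: act_apply sum_lists_len_double mon_append intro!: sum.cong)
    also have "\<dots> = (\<Sum>a\<in>lists_len n. \<Sum>b\<in>lists_len n. if cnt b = n - cnt a
        then k ^ n * k ^ n * (-1) ^ cnt a * of_real (r\<^sup>2) ^ cnt a * X (cnt a) else 0)"
    proof (intro sum.cong refl)
      fix a b
      assume "a \<in> lists_len n" "b \<in> lists_len n"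
      then have ab: "length a = n" "length b = n"
        by simp_all
      have le: "cnt a \<le> n" "cnt b \<le> n"
        using cnt_le[of a] cnt_le[of b] ab by auto
      have Fa: "mon (rot r) ?F a = k ^ n * (-1) ^ cnt a * of_real r ^ cnt a"
      proof -
        have "mon (rot r) ?F a = k ^ (n - cnt a) * (- (k * of_real r)) ^ cnt a"
          using mon_replicate[of "rot r" a False] ab by (simp add: rot_def k_def)
        also have "\<dots> = k ^ (n - cnt a) * k ^ cnt a * (-1) ^ cnt a * of_real r ^ cnt a"
          by (subst power_minus) (simp add: power_mult_distrib mult_ac)
        finally show ?thesis
          using le by (simp flip: power_add)
      qed
      have Tb: "mon (rot r) ?T b = k ^ n * of_real r ^ (n - cnt b)"
      proof -
        have "mon (rot r) ?T b = (k * of_real r) ^ (n - cnt b) * k ^ cnt b"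
          using mon_replicate[of "rot r" b True] ab by (simp add: rot_def k_def)
        also have "\<dots> = k ^ (n - cnt b) * k ^ cnt b * of_real r ^ (n - cnt b)"
          by (simp add: power_mult_distrib mult_ac)
        finally show ?thesis
          using le by (simp flip: power_add)
      qed
      show "mon (rot r) ?F a * mon (rot r) ?T b * \<xi> (a @ b) = (if cnt b = n - cnt a
        then k ^ n * k ^ n * (-1) ^ cnt a * of_real (r\<^sup>2) ^ cnt a * X (cnt a) else 0)"
      proof (cases "cnt b = n - cnt a")
        case True
        then have "n - cnt b = cnt a"
          using le by simp
        then show ?thesis
          using \<xi>_X[OF ab True] True
          by (simp add: Fa Tb power2_eq_square power_mult_distrib mult_ac)
      next
        case False
        then have "cnt (a @ b) \<noteq> n"
          using le by auto
        then show ?thesis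
          using detsp_weight[OF \<xi>, of "a @ b"] ab False by simp
      qed
    qed
    also have "\<dots> = (\<Sum>a\<in>lists_len n. of_nat (n choose (n - cnt a))
        * (k ^ n * k ^ n * (-1) ^ cnt a * of_real (r\<^sup>2) ^ cnt a * X (cnt a)))"
      by (intro sum.cong refl sum_lists_len_cnt_eq) simp
    also have "\<dots> = (\<Sum>j\<le>n. of_nat (n choose j) * (of_nat (n choose (n - j))
        * (k ^ n * k ^ n * (-1) ^ j * of_real (r\<^sup>2) ^ j * X j)))"
      by (rule sum_lists_len_cnt)
    also have "\<dots> = k ^ n * k ^ n * (\<Sum>j\<le>n. of_nat (n choose j) * of_nat (n choose j) * (-1) ^ j * X j * of_real (r\<^sup>2) ^ j)"
      unfolding sum_distrib_left
      by (intro sum.cong refl) (simp add: binomial_symmetric[symmetric] mult_ac)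
    finally have "of_real (1 + r\<^sup>2) ^ n * X 0
        = (k ^ n * k ^ n * of_real (1 + r\<^sup>2) ^ n) * (\<Sum>j\<le>n. of_nat (n choose j) * of_nat (n choose j) * (-1) ^ j * X j * of_real (r\<^sup>2) ^ j)"
      by simp
    then have "of_real (1 + r\<^sup>2) ^ n * X 0
        = (\<Sum>j\<le>n. of_nat (n choose j) * of_nat (n choose j) * (-1) ^ j * X j * of_real (r\<^sup>2) ^ j)"
      unfolding k1 by simp
    moreover have "(of_real (1 + r\<^sup>2) :: complex) ^ n = (\<Sum>j\<le>n. of_nat (n choose j) * of_real (r\<^sup>2) ^ j)"
      using binomial_ring[of "of_real (r\<^sup>2) :: complex" 1 n] by (simp add: add.commute)
    moreover have "(\<Sum>j\<le>n. c j * of_real (r\<^sup>2) ^ j)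
        = (\<Sum>j\<le>n. of_nat (n choose j) * of_nat (n choose j) * (-1) ^ j * X j * of_real (r\<^sup>2) ^ j)
          - (\<Sum>j\<le>n. of_nat (n choose j) * of_real (r\<^sup>2) ^ j) * X 0"
      unfolding c_def left_diff_distrib sum_subtractf sum_distrib_right by (simp add: mult_ac)
    ultimately show ?thesis
      by simp
  qed
  have c0: "c j = 0" if "j \<le> n" for j
  proof (rule ccontr)
    assume "c j \<noteq> 0"
    with that have "finite {z. (\<Sum>j\<le>n. c j * z ^ j) = 0}"
      by (subst polyfun_finite_roots) auto
    \<comment> \<open>The slopes r = sqrt m yield every natural number m as a root of the
      polynomial.\<close>
    then have "finite (range (\<lambda>m::nat. complex_of_real ((sqrt (real m))\<^sup>2)))"
      by (rule finite_subset[rotated]) (intro image_subsetI CollectI eq0)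
    moreover have "inj (\<lambda>m::nat. complex_of_real ((sqrt (real m))\<^sup>2))"
      by (rule injI) simp
    ultimately have "finite (UNIV :: nat set)"
      by (rule finite_imageD)
    then show False
      by simp
  qed
  \<comment> \<open>Solving c j = 0 for X j gives the values that define \<open>delta\<close>; this
    is where its binomial denominators originate.\<close>
  have X: "X j = (-1) ^ j / of_nat (n choose j) * X 0" if "j \<le> n" for j
  proof -
    have ne: "(of_nat (n choose j) :: complex) \<noteq> 0"
      using that by simp
    have "of_nat (n choose j) * (of_nat (n choose j) * ((-1) ^ j * X j)) = of_nat (n choose j) * X 0"
      using c0[OF that] by (simp add: c_def mult_ac)
    then have "of_nat (n choose j) * ((-1) ^ j * X j) = X 0"
      using ne by (metis mult_left_cancel)
    then have "(-1) ^ j * X 0 = of_nat (n choose j) * (((-1) ^ j * (-1) ^ j) * X j)"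
      by (metis mult.assoc mult.left_commute)
    also have "((-1) ^ j * (-1) ^ j :: complex) = 1"
      by (simp flip: power_mult_distrib)
    finally show ?thesis
      using ne by (simp add: field_simps)
  qed
  have X0: "X 0 = \<xi> (replicate n False @ replicate n True)"
    by (simp add: X_def)
  show ?thesis
  proof (rule vec_eqI[of _ "2 * n"])
    show "\<xi> \<in> vec (2 * n)"
      using sl by (simp add: slices_def mult_2)
    show "\<xi> (replicate n False @ replicate n True) \<cdot> delta n \<in> vec (2 * n)"
      by (simp add: vec_def delta_def smul_apply)
    fix w :: "bool list"
    assume w2: "length w = 2 * n"
    then have "length w = n + n" by simp
    then obtain a b where w: "w = a @ b" and a: "length a = n" and b: "length b = n"
      by (rule word_split)
    have le: "cnt a \<le> n"
      using cnt_le[of a] a by simp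
    show "\<xi> w = (\<xi> (replicate n False @ replicate n True) \<cdot> delta n) w"
    proof (cases "cnt a + cnt b = n")
      case True
      then have "\<xi> w = X (cnt a)"
        using \<xi>_X[OF a b] w by simp
      then show ?thesis
        using X[OF le] True a b w X0 by (simp add: smul_apply delta_append)
    next
      case False
      then show ?thesis
        using detsp_weight[OF \<xi> w2] w a b by (simp add: smul_apply delta_append)
    qed
  qed
qed

lemma subspace_detsp: "fv.subspace (detsp n)"
proof -
  have "fv.subspace (slices n n (Lsym n) (Lsym n))"
    by (intro subspace_slices subspace_Lsym)
  then show ?thesis
    unfolding detsp_eq_slices fv.subspace_def by (auto simp: act_add act_smul)
qed

text \<open>Instead of evaluating the alternant in closed form, uniqueness is applied to it: it is
  invariant and not zero, hence a nonzero multiple of \<open>delta\<close>.\<close>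

lemma delta_in_detsp: "delta n \<in> detsp n"
proof -
  define c where "c = alternant n (replicate n False @ replicate n True)"
  have "c \<noteq> 0"
    by (simp add: c_def alternant_nonzero)
  moreover have "alternant n = c \<cdot> delta n"
    unfolding c_def by (rule detsp_unique[OF alternant_in_detsp])
  ultimately have "delta n = (1 / c) \<cdot> alternant n"
    by simp
  then show ?thesis
    using fv.subspace_scale[OF subspace_detsp alternant_in_detsp] by metis
qed

lemma detsp_eq: "detsp n = range (\<lambda>c. c \<cdot> delta n)"
  using detsp_unique fv.subspace_scale[OF subspace_detsp delta_in_detsp] by blast

section \<open>Equivariance of insertion and contraction\<close>

lemma delta_invariant:
  assumes "g \<in> SU2" "length w = 2 * n"
  shows "(\<Sum>v\<in>lists_len (2 * n). mon g w v * delta n v) = delta n w"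
proof -
  have "act g (2 * n) (delta n) w = delta n w"
    using delta_in_detsp[of n] assms(1) by (simp add: detsp_def)
  then show ?thesis
    by (simp only: act_apply[OF assms(2)])
qed

text \<open>Contraction pairs \<open>delta\<close> with the row index of g instead of the column
  index, so this is invariance under the transposed matrix, again an element of SU(2).\<close>

lemma delta_invariant':
  assumes g: "g \<in> SU2" and v: "length v = 2 * n"
  shows "(\<Sum>w\<in>lists_len (2 * n). delta n w * mon g w v) = delta n v"
proof -
  have "(\<Sum>w\<in>lists_len (2 * n). delta n w * mon g w v)
      = (\<Sum>w\<in>lists_len (2 * n). mon (\<lambda>i j. g j i) v w * delta n w)"
  proof (intro sum.cong refl)
    fix w assume "w \<in> lists_len (2 * n)"
    then show "delta n w * mon g w v = mon (\<lambda>i j. g j i) v w * delta n w"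
      using mon_transpose[of w v g] v by simp
  qed
  then show ?thesis
    by (simp add: delta_invariant[OF SU2_transpose[OF g] v])
qed

lemma act_Ins:
  assumes g: "g \<in> SU2" and f: "f \<in> vec K" and p: "p \<le> K" and n: "1 \<le> n" and M: "M = K + 2 * n"
  shows "act g M (Ins n p f) = Ins n p (act g K f)"
proof (rule vec_eqI[of _ M])
  show "Ins n p (act g K f) \<in> vec M"
    by (rule Ins_vec[OF act_vec M n])
  fix w :: "bool list"
  assume len: "length w = M"
  obtain r where K: "K = p + r"
    using p le_Suc_ex by blast
  then have "length w = p + (2 * n + r)"
    using len M by simp
  then obtain x v y where w: "w = x @ v @ y" and x: "length x = p" and v: "length v = 2 * n" and y: "length y = r"
    by (rule word_split3)
  have M': "M = p + (2 * n + r)"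
    using K M by simp
  have "act g M (Ins n p f) w = (\<Sum>x'\<in>lists_len p. \<Sum>v'\<in>lists_len (2 * n). \<Sum>y'\<in>lists_len r.
      (mon g v v' * delta n v') * (mon g x x' * mon g y y' * f (x' @ y')))"
    unfolding act_apply[OF len] unfolding M' sum_lists_len_add
    using x v y by (intro sum.cong refl) (auto simp: w mon_append Ins_append)
  also have "\<dots> = (\<Sum>x'\<in>lists_len p. \<Sum>y'\<in>lists_len r.
      (\<Sum>v'\<in>lists_len (2 * n). mon g v v' * delta n v') * (mon g x x' * mon g y y' * f (x' @ y')))"
    unfolding sum_distrib_right by (intro sum.cong refl sum.swap)
  also have "\<dots> = (\<Sum>x'\<in>lists_len p. \<Sum>y'\<in>lists_len r. delta n v * (mon g x x' * mon g y y' * f (x' @ y')))"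
    by (simp add: delta_invariant[OF g v])
  also have "\<dots> = delta n v * act g K f (x @ y)"
    using x y K by (auto simp: act_apply sum_lists_len_add mon_append sum_distrib_left intro!: sum.cong)
  also have "\<dots> = Ins n p (act g K f) w"
    using x v by (simp add: w Ins_append)
  finally show "act g M (Ins n p f) w = Ins n p (act g K f) w" .
qed simp

lemma act_Con:
  assumes g: "g \<in> SU2" and p: "p \<le> K" and M: "M = K + 2 * n"
  shows "act g K (Con n p f) = Con n p (act g M f)"
proof (rule vec_eqI[of _ K])
  show "Con n p (act g M f) \<in> vec K"
    by (rule Con_vec[OF act_vec M])
  fix w :: "bool list"
  assume len: "length w = K"
  obtain r where K: "K = p + r"
    using p le_Suc_ex by blast
  then obtain x y where w: "w = x @ y" and x: "length x = p" and y: "length y = r"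
    using len word_split by metis
  have M': "M = p + (2 * n + r)"
    using K M by simp
  have "Con n p (act g M f) w = (\<Sum>u\<in>lists_len (2 * n). \<Sum>x'\<in>lists_len p. \<Sum>v\<in>lists_len (2 * n). \<Sum>y'\<in>lists_len r.
      (delta n u * mon g u v) * (mon g x x' * mon g y y' * f (x' @ v @ y')))"
    using x y M'
    by (auto simp: w Con_append act_apply sum_lists_len_add mon_append sum_distrib_left intro!: sum.cong)
  also have "\<dots> = (\<Sum>x'\<in>lists_len p. \<Sum>u\<in>lists_len (2 * n). \<Sum>v\<in>lists_len (2 * n). \<Sum>y'\<in>lists_len r.
      (delta n u * mon g u v) * (mon g x x' * mon g y y' * f (x' @ v @ y')))"
    by (rule sum.swap)
  also have "\<dots> = (\<Sum>x'\<in>lists_len p. \<Sum>v\<in>lists_len (2 * n). \<Sum>u\<in>lists_len (2 * n). \<Sum>y'\<in>lists_len r.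
      (delta n u * mon g u v) * (mon g x x' * mon g y y' * f (x' @ v @ y')))"
    by (intro sum.cong refl sum.swap)
  also have "\<dots> = (\<Sum>x'\<in>lists_len p. \<Sum>v\<in>lists_len (2 * n). \<Sum>y'\<in>lists_len r.
      (\<Sum>u\<in>lists_len (2 * n). delta n u * mon g u v) * (mon g x x' * mon g y y' * f (x' @ v @ y')))"
    unfolding sum_distrib_right by (intro sum.cong refl sum.swap)
  also have "\<dots> = (\<Sum>x'\<in>lists_len p. \<Sum>v\<in>lists_len (2 * n). \<Sum>y'\<in>lists_len r.
      delta n v * (mon g x x' * mon g y y' * f (x' @ v @ y')))"
    by (intro sum.cong refl) (simp add: delta_invariant'[OF g])
  also have "\<dots> = (\<Sum>x'\<in>lists_len p. \<Sum>y'\<in>lists_len r. \<Sum>v\<in>lists_len (2 * n).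
      delta n v * (mon g x x' * mon g y y' * f (x' @ v @ y')))"
    by (intro sum.cong refl sum.swap)
  also have "\<dots> = act g K (Con n p f) w"
    using x y K by (auto simp: w Con_append act_apply sum_lists_len_add mon_append sum_distrib_left intro!: sum.cong)
  finally show "act g K (Con n p f) w = Con n p (act g M f) w" ..
qed simp

lemma symat_act:
  assumes s: "symat n p f" and p: "p + n \<le> N"
  shows "symat n p (act g N f)"
  unfolding symat_def
proof (intro allI impI, elim conjE)
  fix x a b y :: "bool list"
  assume x: "length x = p" and a: "length a = n" and b: "length b = n" and ab: "cnt a = cnt b"
  show "act g N f (x @ a @ y) = act g N f (x @ b @ y)"
  proof (cases "length (x @ a @ y) = N")
    case True
    then have len: "length (x @ a @ y) = N" "length (x @ b @ y) = N"
      using a b by auto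
    obtain r where y: "length y = r" and N: "N = p + (n + r)"
      using True x a by auto
    have *: "act g N f (x @ e @ y) = (\<Sum>x'\<in>lists_len p. \<Sum>y'\<in>lists_len r. mon g x x' * mon g y y'
        * (\<Sum>e'\<in>lists_len n. mon g e e' * f (x' @ e' @ y')))" if e: "length e = n" for e
    proof -
      have "act g N f (x @ e @ y) = (\<Sum>x'\<in>lists_len p. \<Sum>e'\<in>lists_len n. \<Sum>y'\<in>lists_len r.
          mon g x x' * mon g y y' * (mon g e e' * f (x' @ e' @ y')))"
        using x y e N by (auto simp: act_apply sum_lists_len_add mon_append intro!: sum.cong)
      also have "\<dots> = (\<Sum>x'\<in>lists_len p. \<Sum>y'\<in>lists_len r. \<Sum>e'\<in>lists_len n.
          mon g x x' * mon g y y' * (mon g e e' * f (x' @ e' @ y')))"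
        by (intro sum.cong refl sum.swap)
      finally show ?thesis
        by (simp only: sum_distrib_left)
    qed
    have "(\<Sum>e\<in>lists_len n. mon g a e * f (x' @ e @ y')) = (\<Sum>e\<in>lists_len n. mon g b e * f (x' @ e @ y'))"
      if "length x' = p" for x' y'
      by (rule sum_mon_cnt_cong[OF _ a b ab]) (rule symatD[OF s that])
    then show ?thesis
      unfolding *[OF a] *[OF b] by (intro sum.cong refl) auto
  next
    case False
    then show ?thesis
      using a b by (simp add: vecD[OF act_vec])
  qed
qed

subsection \<open>Slotwise symmetric tensors\<close>

lemma symatI_vec:
  assumes "f \<in> vec N"
    and "\<And>x a b y. length x = p \<Longrightarrow> length a = n \<Longrightarrow> length b = n \<Longrightarrow> cnt a = cnt b
      \<Longrightarrow> p + (n + length y) = N \<Longrightarrow> f (x @ a @ y) = f (x @ b @ y)"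
  shows "symat n p f"
  unfolding symat_def
proof (intro allI impI, elim conjE)
  fix x a b y :: "bool list"
  assume xab: "length x = p" "length a = n" "length b = n" "cnt a = cnt b"
  show "f (x @ a @ y) = f (x @ b @ y)"
  proof (cases "p + (n + length y) = N")
    case True
    with assms(2) xab show ?thesis
      by blast
  next
    case False
    then show ?thesis
      using xab by (simp add: vecD[OF assms(1)])
  qed
qed

lemma symat_add: "symat n p f \<Longrightarrow> symat n p h \<Longrightarrow> symat n p (f + h)"
  unfolding symat_def plus_fun_apply by metis

lemma symat_smul: "symat n p f \<Longrightarrow> symat n p (c \<cdot> f)"
  unfolding symat_def smul_apply by metis

lemma symat_zero: "symat n p 0"
  by (simp add: symat_def zero_fun_apply)

lemma symat_slice_left: "symat n p f \<Longrightarrow> symat n p (\<lambda>u. f (u @ v))"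
  unfolding symat_def by (metis append_assoc)

lemma symat_slice_right:
  assumes "symat n (length u + p) f"
  shows "symat n p (\<lambda>v. f (u @ v))"
  unfolding symat_def
proof (intro allI impI, elim conjE)
  fix x a b y :: "bool list"
  assume "length x = p" "length a = n" "length b = n" "cnt a = cnt b"
  then show "f (u @ x @ a @ y) = f (u @ x @ b @ y)"
    using symatD[OF assms, of "u @ x" a b y] by simp
qed

lemma symat_from_left:
  assumes f: "f \<in> vec (A + B)" and p: "p + n \<le> A"
    and s: "\<And>v. length v = B \<Longrightarrow> symat n p (\<lambda>u. f (u @ v))"
  shows "symat n p f"
proof (rule symatI_vec[OF f])
  fix x a b y :: "bool list"
  assume xab: "length x = p" "length a = n" "length b = n" "cnt a = cnt b" "p + (n + length y) = A + B"
  then have "length y = (A - p - n) + B"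
    using p by simp
  then obtain y1 y2 where "y = y1 @ y2" "length y2 = B"
    by (rule word_split)
  then show "f (x @ a @ y) = f (x @ b @ y)"
    using symatD[OF s[of y2] xab(1-4), of y1] by simp
qed

lemma symat_from_right:
  assumes s: "\<And>u. length u = A \<Longrightarrow> symat n p (\<lambda>v. f (u @ v))"
  shows "symat n (A + p) f"
  unfolding symat_def
proof (intro allI impI, elim conjE)
  fix x a b y :: "bool list"
  assume x: "length x = A + p" and ab: "length a = n" "length b = n" "cnt a = cnt b"
  obtain x1 x2 where "x = x1 @ x2" "length x1 = A" "length x2 = p"
    using x by (rule word_split)
  then show "f (x @ a @ y) = f (x @ b @ y)"
    using symatD[OF s[of x1] _ ab, of x2 y] by simp
qed

text \<open>This is L_n^{\<otimes>m}, by \<open>tpow_Lsym\<close>. Expressed through slots it is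
  easily tracked under insertion, contraction and slicing.\<close>

definition Sy :: "nat \<Rightarrow> nat \<Rightarrow> (bool list \<Rightarrow> complex) set" where
  "Sy n m = {f \<in> vec (n * m). \<forall>i<m. symat n (n * i) f}"

lemma SyD: "f \<in> Sy n m \<Longrightarrow> i < m \<Longrightarrow> symat n (n * i) f"
  by (simp add: Sy_def)

lemma Sy_vec: "f \<in> Sy n m \<Longrightarrow> f \<in> vec (n * m)"
  by (simp add: Sy_def)

lemma Sy_subset_vec: "Sy n m \<subseteq> vec (n * m)"
  by (auto simp: Sy_def)

lemma subspace_Sy: "fv.subspace (Sy n m)"
  using subspace_vec[of "n * m"]
  by (simp add: fv.subspace_def Sy_def symat_add symat_smul symat_zero)

lemma Lsym_eq_Sy: "Lsym n = Sy n 1"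
proof
  show "Lsym n \<subseteq> Sy n 1"
  proof
    fix f assume f: "f \<in> Lsym n"
    have "symat n 0 f"
    proof (rule symatI_vec)
      show "f \<in> vec n"
        using f Lsym_subset_vec by blast
      fix x a b y :: "bool list"
      assume "length x = 0" "length a = n" "length b = n" "cnt a = cnt b" "0 + (n + length y) = n"
      then show "f (x @ a @ y) = f (x @ b @ y)"
        using LsymD[OF f, of a b] by simp
    qed
    then show "f \<in> Sy n 1"
      using f Lsym_subset_vec by (auto simp: Sy_def)
  qed
  show "Sy n 1 \<subseteq> Lsym n"
  proof
    fix f assume f: "f \<in> Sy n 1"
    show "f \<in> Lsym n"
    proof (rule LsymI)
      show "f \<in> vec n"
        using Sy_vec[OF f] by simp
      fix a b :: "bool list"
      assume "length a = n" "length b = n" "cnt a = cnt b"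
      then show "f a = f b"
        using symatD[OF SyD[OF f, of 0], of "[]" a b "[]"] by simp
    qed
  qed
qed

text \<open>Every slot lies entirely to the left or entirely to the right of the cut, so each
  symmetry condition concerns columns only or rows only.\<close>

lemma Sy_add_eq_slices: "Sy n (i + j) = slices (n * i) (n * j) (Sy n i) (Sy n j)"
proof
  show "Sy n (i + j) \<subseteq> slices (n * i) (n * j) (Sy n i) (Sy n j)"
  proof
    fix f assume f: "f \<in> Sy n (i + j)"
    have fv: "f \<in> vec (n * i + n * j)"
      using Sy_vec[OF f] by (simp add: algebra_simps mult_2_right)
    have "(\<lambda>u. f (u @ v)) \<in> Sy n i" if "length v = n * j" for v
      using that vecD[OF fv] SyD[OF f] by (auto simp: Sy_def vec_def intro!: symat_slice_left)
    moreover have "(\<lambda>v. f (u @ v)) \<in> Sy n j" if u: "length u = n * i" for u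
    proof -
      have "symat n (n * s) (\<lambda>v. f (u @ v))" if "s < j" for s
        using SyD[OF f, of "i + s"] that u by (intro symat_slice_right) (simp add: algebra_simps mult_2_right)
      then show ?thesis
        using u vecD[OF fv] by (auto simp: Sy_def vec_def)
    qed
    ultimately show "f \<in> slices (n * i) (n * j) (Sy n i) (Sy n j)"
      using fv by (simp add: slices_def)
  qed
  show "slices (n * i) (n * j) (Sy n i) (Sy n j) \<subseteq> Sy n (i + j)"
  proof
    fix f assume "f \<in> slices (n * i) (n * j) (Sy n i) (Sy n j)"
    then have fv: "f \<in> vec (n * i + n * j)"
      and l: "\<And>v. length v = n * j \<Longrightarrow> (\<lambda>u. f (u @ v)) \<in> Sy n i"
      and r: "\<And>u. length u = n * i \<Longrightarrow> (\<lambda>v. f (u @ v)) \<in> Sy n j"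
      by (auto simp: slices_def)
    have "symat n (n * s) f" if s: "s < i + j" for s
    proof (cases "s < i")
      case True
      then have "n * s + n \<le> n * i"
        by (metis Suc_leI mult_Suc_right mult_le_mono2 add.commute)
      then show ?thesis
        using SyD[OF l True] by (intro symat_from_left[OF fv]) auto
    next
      case False
      then have "n * s = n * i + n * (s - i)"
        by (simp flip: distrib_left)
      moreover have "symat n (n * i + n * (s - i)) f"
        using s False SyD[OF r, of _ "s - i"] by (intro symat_from_right) auto
      ultimately show ?thesis
        by simp
    qed
    then show "f \<in> Sy n (i + j)"
      using fv by (simp add: Sy_def algebra_simps)
  qed
qed

lemma tpow_Lsym: "tpow n m (Lsym n) = Sy n m"
proof (induction m)
  case 0
  show ?case
    by (simp add: Sy_def)
next
  case (Suc m)
  have "tpow n (Suc m) (Lsym n) = tens (n * m) (Sy n m) (Sy n 1)"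
    by (simp only: tpow.simps Suc.IH) (simp only: Lsym_eq_Sy)
  also have "\<dots> = slices (n * m) (n * 1) (Sy n m) (Sy n 1)"
    by (intro tens_eq_slices subspace_Sy Sy_subset_vec)
  also have "\<dots> = Sy n (Suc m)"
    by (simp only: Sy_add_eq_slices[symmetric] Suc_eq_plus1)
  finally show ?case .
qed

section \<open>Insertion and contraction preserve slotwise symmetry\<close>

lemma symat_Con_before:
  assumes f: "f \<in> vec (N + 2 * n)" and s: "symat n p f" and pq: "p + n \<le> q" "q \<le> N"
  shows "symat n p (Con n q f)"
proof (rule symatI_vec)
  show "Con n q f \<in> vec N"
    using f by (rule Con_vec) simp
  fix x a b y :: "bool list"
  assume x: "length x = p" and ab: "length a = n" "length b = n" "cnt a = cnt b" and y: "p + (n + length y) = N"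
  then have "length y = (q - p - n) + (N - q)"
    using pq by simp
  then obtain y1 y2 where y12: "y = y1 @ y2" "length y1 = q - p - n"
    by (rule word_split)
  have *: "Con n q f (x @ e @ y) = (\<Sum>v\<in>lists_len (2 * n). delta n v * f (x @ e @ y1 @ v @ y2))"
    if "length e = n" for e
    using Con_append[of "x @ e @ y1" q n f y2] x that y12 pq by simp
  show "Con n q f (x @ a @ y) = Con n q f (x @ b @ y)"
    unfolding *[OF ab(1)] *[OF ab(2)]
    by (intro sum.cong refl arg_cong2[of _ _ _ _ "(*)"] symatD[OF s x ab])
qed

lemma symat_Con_after:
  assumes s: "symat n (p + 2 * n) f" and pq: "q \<le> p"
  shows "symat n p (Con n q f)"
  unfolding symat_def
proof (intro allI impI, elim conjE)
  fix x a b y :: "bool list"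
  assume x: "length x = p" and ab: "length a = n" "length b = n" "cnt a = cnt b"
  have "length x = q + (p - q)"
    using x pq by simp
  then obtain x1 x2 where x12: "x = x1 @ x2" "length x1 = q" "length x2 = p - q"
    by (rule word_split)
  have *: "Con n q f (x @ e @ y) = (\<Sum>v\<in>lists_len (2 * n). delta n v * f ((x1 @ v @ x2) @ e @ y))" for e
    using x12 by (simp add: Con_append)
  show "Con n q f (x @ a @ y) = Con n q f (x @ b @ y)"
    unfolding * using x12 pq
    by (intro sum.cong refl arg_cong2[of _ _ _ _ "(*)"] symatD[OF s _ ab]) auto
qed

lemma symat_Ins_before:
  assumes f: "f \<in> vec N" and n: "1 \<le> n" and s: "symat n p f" and pq: "p + n \<le> q" "q \<le> N"
  shows "symat n p (Ins n q f)"
proof (rule symatI_vec)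
  show "Ins n q f \<in> vec (N + 2 * n)"
    using f n by (intro Ins_vec) auto
  fix x a b y :: "bool list"
  assume x: "length x = p" and ab: "length a = n" "length b = n" "cnt a = cnt b" and y: "p + (n + length y) = N + 2 * n"
  then have "length y = (q - p - n) + (2 * n + (N - q))"
    using pq by simp
  then obtain y1 v y2 where y12: "y = y1 @ v @ y2" "length y1 = q - p - n" "length v = 2 * n"
    by (rule word_split3)
  have *: "Ins n q f (x @ e @ y) = delta n v * f (x @ e @ y1 @ y2)"
    if "length e = n" for e
    using Ins_append[of "x @ e @ y1" q v n f y2] x that y12 pq by simp
  show "Ins n q f (x @ a @ y) = Ins n q f (x @ b @ y)"
    unfolding *[OF ab(1)] *[OF ab(2)] by (intro arg_cong2[of _ _ _ _ "(*)"] refl symatD[OF s x ab])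
qed

lemma symat_Ins_after:
  assumes s: "symat n p f" and pq: "q \<le> p"
  shows "symat n (p + 2 * n) (Ins n q f)"
  unfolding symat_def
proof (intro allI impI, elim conjE)
  fix x a b y :: "bool list"
  assume x: "length x = p + 2 * n" and ab: "length a = n" "length b = n" "cnt a = cnt b"
  have "length x = q + (2 * n + (p - q))"
    using x pq by simp
  then obtain x1 v x2 where x12: "x = x1 @ v @ x2" "length x1 = q" "length v = 2 * n" "length x2 = p - q"
    by (rule word_split3)
  have *: "Ins n q f (x @ e @ y) = delta n v * f ((x1 @ x2) @ e @ y)" for e
    using x12 by (simp add: Ins_append)
  show "Ins n q f (x @ a @ y) = Ins n q f (x @ b @ y)"
    unfolding * using x12 pq by (intro arg_cong2[of _ _ _ _ "(*)"] refl symatD[OF s _ ab]) auto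
qed

lemma delta_cnt_cong:
  "length a = n \<Longrightarrow> length a' = n \<Longrightarrow> length b = n \<Longrightarrow> length b' = n \<Longrightarrow> cnt a = cnt a' \<Longrightarrow> cnt b = cnt b'
    \<Longrightarrow> delta n (a @ b) = delta n (a' @ b')"
  by (simp add: delta_append)

text \<open>The two new slots are symmetric because \<open>delta\<close> depends on each of its
  halves only through \<open>cnt\<close>.\<close>

lemma symat_Ins_at:
  assumes f: "f \<in> vec N" and n: "1 \<le> n" and p: "p \<le> N"
  shows "symat n p (Ins n p f)" "symat n (p + n) (Ins n p f)"
proof -
  have v: "Ins n p f \<in> vec (N + 2 * n)"
    using f n by (intro Ins_vec) auto
  show "symat n p (Ins n p f)"
  proof (rule symatI_vec[OF v])
    fix x a b y :: "bool list"
    assume x: "length x = p" and ab: "length a = n" "length b = n" "cnt a = cnt b"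
      and y: "p + (n + length y) = N + 2 * n"
    then have "length y = n + (N - p)"
      using p by simp
    then obtain c z where c: "y = c @ z" "length c = n"
      by (rule word_split)
    have "Ins n p f (x @ e @ y) = delta n (e @ c) * f (x @ z)" if "length e = n" for e
      using Ins_append[of x p "e @ c" n f z] x that c by simp
    then show "Ins n p f (x @ a @ y) = Ins n p f (x @ b @ y)"
      using ab c delta_cnt_cong[of a n b c c] by simp
  qed
  show "symat n (p + n) (Ins n p f)"
    unfolding symat_def
  proof (intro allI impI, elim conjE)
    fix x a b y :: "bool list"
    assume x: "length x = p + n" and ab: "length a = n" "length b = n" "cnt a = cnt b"
    obtain z c where c: "x = z @ c" "length z = p" "length c = n"
      using x by (rule word_split)
    have "Ins n p f (x @ e @ y) = delta n (c @ e) * f (z @ y)" if "length e = n" for e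
      using Ins_append[of z p "c @ e" n f y] that c by simp
    then show "Ins n p f (x @ a @ y) = Ins n p f (x @ b @ y)"
      using ab c delta_cnt_cong[of c n c a b] by simp
  qed
qed

lemma slot_le: "i < j \<Longrightarrow> n * i + n \<le> n * (j::nat)"
  by (metis Suc_leI mult_Suc_right mult_le_mono2 add.commute)

lemma Sy_Con:
  assumes f: "f \<in> Sy n (m + 2)" and i: "i \<le> m"
  shows "Con n (n * i) f \<in> Sy n m"
proof -
  have fv: "f \<in> vec (n * m + 2 * n)"
    using Sy_vec[OF f] by (simp add: algebra_simps mult_2_right)
  have "symat n (n * j) (Con n (n * i) f)" if j: "j < m" for j
  proof (cases "j < i")
    case True
    then show ?thesis
      using SyD[OF f, of j] j i by (intro symat_Con_before[OF fv] slot_le) auto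
  next
    case False
    have "symat n (n * j + 2 * n) f"
      using SyD[OF f, of "j + 2"] j by (simp add: algebra_simps mult_2_right)
    then show ?thesis
      using False by (intro symat_Con_after) auto
  qed
  then show ?thesis
    using Con_vec[OF fv refl] by (simp add: Sy_def)
qed

lemma Sy_Ins:
  assumes f: "f \<in> Sy n m" and i: "i \<le> m" and n: "1 \<le> n"
  shows "Ins n (n * i) f \<in> Sy n (m + 2)"
proof -
  have fv: "f \<in> vec (n * m)"
    using Sy_vec[OF f] .
  have "symat n (n * j) (Ins n (n * i) f)" if j: "j < m + 2" for j
  proof -
    consider "j < i" | "j = i" | "j = i + 1" | "j \<ge> i + 2"
      by linarith
    then show ?thesis
    proof cases
      case 1
      then show ?thesis
        using SyD[OF f, of j] j i by (intro symat_Ins_before[OF fv n] slot_le) auto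
    next
      case 2
      then show ?thesis
        using symat_Ins_at(1)[OF fv n, of "n * i"] i by simp
    next
      case 3
      then show ?thesis
        using symat_Ins_at(2)[OF fv n, of "n * i"] i by (simp add: algebra_simps mult_2_right)
    next
      case 4
      then obtain k where k: "j = k + 2" "i \<le> k"
        by (metis le_add_diff_inverse2 add_le_imp_le_right add_leD2)
      then show ?thesis
        using symat_Ins_after[OF SyD[OF f, of k], of "n * i"] j by (simp add: algebra_simps mult_2_right)
    qed
  qed
  then show ?thesis
    using Ins_vec[OF fv _ n, of "n * (m + 2)"] by (simp add: Sy_def algebra_simps)
qed

subsection \<open>The subproduct system as a joint kernel of contractions\<close>

text \<open>The contraction at i joins the slots i and i + 1, counted from 0, so the condition on a
  omits the one across a cut after the first a slots. For a = 0 nothing is omitted and this is E_m;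
  with m = k + l and a = k it is E_k \<otimes> E_l.\<close>

definition Ker :: "nat \<Rightarrow> nat \<Rightarrow> nat \<Rightarrow> (bool list \<Rightarrow> complex) set" where
  "Ker n m a = {f \<in> Sy n m. \<forall>i. i + 2 \<le> m \<and> i + 1 \<noteq> a \<longrightarrow> Con n (n * i) f = 0}"

lemma Con_slice_left: "p \<le> length u \<Longrightarrow> Con n p (\<lambda>u. f (u @ v)) u = Con n p f (u @ v)"
  by (simp add: Con_def)

lemma Con_slice_right: "Con n p (\<lambda>v. f (u @ v)) v = Con n (length u + p) f (u @ v)"
  by (simp add: Con_def)

lemma subspace_Ker: "fv.subspace (Ker n m a)"
  using subspace_Sy[of n m] by (simp add: fv.subspace_def Ker_def Con_add Con_smul)

lemma Ker_subset_vec: "Ker n m a \<subseteq> vec (n * m)"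
  using Sy_subset_vec by (auto simp: Ker_def)

text \<open>Contractions left of the cut act on columns and those right of it on rows; the omitted
  one is the only contraction that mixes them.\<close>

lemma slices_Ker: "slices (n * k) (n * l) (Ker n k 0) (Ker n l 0) = Ker n (k + l) k"
proof
  show "slices (n * k) (n * l) (Ker n k 0) (Ker n l 0) \<subseteq> Ker n (k + l) k"
  proof
    fix f assume f: "f \<in> slices (n * k) (n * l) (Ker n k 0) (Ker n l 0)"
    then have fv: "f \<in> vec (n * k + n * l)"
      and l: "\<And>v. length v = n * l \<Longrightarrow> (\<lambda>u. f (u @ v)) \<in> Ker n k 0"
      and r: "\<And>u. length u = n * k \<Longrightarrow> (\<lambda>v. f (u @ v)) \<in> Ker n l 0"
      by (auto simp: slices_def)
    have fS: "f \<in> Sy n (k + l)"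
      using f unfolding Sy_add_eq_slices by (auto simp: slices_def Ker_def)
    have "Con n (n * i) f = 0" if i: "i + 2 \<le> k + l" "i + 1 \<noteq> k" for i
    proof (cases "i + 2 \<le> k")
      case True
      then obtain q where q: "k = i + 2 + q"
        using le_Suc_ex by blast
      have fv': "f \<in> vec ((n * (i + q) + n * l) + 2 * n)"
        using fv q by (simp add: algebra_simps mult_2_right)
      show ?thesis
      proof (rule vec_eqI[OF Con_vec[OF fv' refl]])
        fix w :: "bool list"
        assume "length w = n * (i + q) + n * l"
        then obtain u v where w: "w = u @ v" "length u = n * (i + q)" "length v = n * l"
          by (rule word_split)
        have "Con n (n * i) (\<lambda>u. f (u @ v)) u = 0"
          using l[OF w(3)] True by (simp add: Ker_def zero_fun_apply)
        then show "Con n (n * i) f w = 0 w"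
          using w Con_slice_left[of "n * i" u n f v] by (simp add: zero_fun_apply)
      qed (rule fv.subspace_0[OF subspace_vec])
    next
      case False
      with i have "k \<le> i" by simp
      then obtain q where q: "i = k + q"
        using le_Suc_ex by blast
      with i obtain s where s: "l = q + 2 + s"
        using le_Suc_ex[of "q + 2" l] by auto
      have fv': "f \<in> vec ((n * k + n * (q + s)) + 2 * n)"
        using fv s by (simp add: algebra_simps mult_2_right)
      show ?thesis
      proof (rule vec_eqI[OF Con_vec[OF fv' refl]])
        fix w :: "bool list"
        assume "length w = n * k + n * (q + s)"
        then obtain u v where w: "w = u @ v" "length u = n * k" "length v = n * (q + s)"
          by (rule word_split)
        have "Con n (n * q) (\<lambda>v. f (u @ v)) v = 0"
          using r[OF w(2)] s by (simp add: Ker_def zero_fun_apply)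
        then show "Con n (n * i) f w = 0 w"
          using w Con_slice_right[of n "n * q" f u v] by (simp add: zero_fun_apply q distrib_left)
      qed (rule fv.subspace_0[OF subspace_vec])
    qed
    then show "f \<in> Ker n (k + l) k"
      using fS by (simp add: Ker_def)
  qed
  show "Ker n (k + l) k \<subseteq> slices (n * k) (n * l) (Ker n k 0) (Ker n l 0)"
  proof
    fix f assume f: "f \<in> Ker n (k + l) k"
    then have "f \<in> slices (n * k) (n * l) (Sy n k) (Sy n l)"
      unfolding Sy_add_eq_slices[symmetric] by (simp add: Ker_def)
    then have fv: "f \<in> vec (n * k + n * l)"
      and l: "\<And>v. length v = n * l \<Longrightarrow> (\<lambda>u. f (u @ v)) \<in> Sy n k"
      and r: "\<And>u. length u = n * k \<Longrightarrow> (\<lambda>v. f (u @ v)) \<in> Sy n l"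
      by (auto simp: slices_def)
    have C: "Con n (n * i) f = 0" if "i + 2 \<le> k + l" "i + 1 \<noteq> k" for i
      using f that by (simp add: Ker_def)
    have "Con n (n * i) (\<lambda>u. f (u @ v)) = 0" if v: "length v = n * l" and i: "i + 2 \<le> k" for v i
    proof -
      obtain q where q: "k = i + 2 + q"
        using i le_Suc_ex by blast
      have "(\<lambda>u. f (u @ v)) \<in> vec (n * (i + q) + 2 * n)"
        using Sy_vec[OF l[OF v]] q by (simp add: algebra_simps mult_2_right)
      from Con_vec[OF this refl] show ?thesis
      proof (rule vec_eqI)
        fix u :: "bool list" assume "length u = n * (i + q)"
        then show "Con n (n * i) (\<lambda>u. f (u @ v)) u = 0 u"
          using Con_slice_left[of "n * i" u n f v] C[of i] i by (simp add: zero_fun_apply)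
      qed (rule fv.subspace_0[OF subspace_vec])
    qed
    moreover have "Con n (n * i) (\<lambda>v. f (u @ v)) = 0" if u: "length u = n * k" and i: "i + 2 \<le> l" for u i
    proof
      fix v
      show "Con n (n * i) (\<lambda>v. f (u @ v)) v = 0 v"
        using Con_slice_right[of n "n * i" f u v] C[of "k + i"] u i by (simp add: zero_fun_apply distrib_left)
    qed
    ultimately show "f \<in> slices (n * k) (n * l) (Ker n k 0) (Ker n l 0)"
      using fv l r by (simp add: slices_def Ker_def)
  qed
qed

lemma Kgen_eq_slices:
  "tens (n * (i + 2)) (tens (n * i) (Sy n i) (detsp n)) (Sy n r)
    = slices (n * (i + 2)) (n * r) (slices (n * i) (2 * n) (Sy n i) (detsp n)) (Sy n r)"
proof -
  have d: "detsp n \<subseteq> vec (2 * n)"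
    by (auto simp: detsp_eq_slices slices_def mult_2)
  have 1: "tens (n * i) (Sy n i) (detsp n) = slices (n * i) (2 * n) (Sy n i) (detsp n)"
    by (intro tens_eq_slices subspace_Sy subspace_detsp d Sy_subset_vec)
  have "slices (n * i) (2 * n) (Sy n i) (detsp n) \<subseteq> vec (n * (i + 2))"
    using slices_subset_vec[of "n * i" "2 * n"] by (simp add: algebra_simps mult_2_right)
  then show ?thesis
    unfolding 1 by (intro tens_eq_slices subspace_slices subspace_Sy subspace_detsp Sy_subset_vec)
qed

text \<open>Since the determinant is one-dimensional, h is c(x, y) \<open>delta\<close> in the two
  distinguished slots, and the sum over these slots in the inner product is the contraction of
  f.\<close>

lemma Kgen_orthogonal:
  assumes h: "h \<in> slices (n * (i + 2)) (n * r) (slices (n * i) (2 * n) (Sy n i) (detsp n)) (Sy n r)"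
    and f: "Con n (n * i) f = 0"
  shows "cinner (n * (i + 2 + r)) h f = 0"
proof -
  have len: "n * (i + 2 + r) = n * i + (2 * n + n * r)"
    by (simp add: algebra_simps mult_2_right)
  have "\<exists>c. \<forall>v. h (x @ v @ y) = c * delta n v" if "length x = n * i" "length y = n * r" for x y
  proof -
    have "(\<lambda>w. h (w @ y)) \<in> slices (n * i) (2 * n) (Sy n i) (detsp n)"
      using h that by (simp add: slices_def)
    then have "(\<lambda>v. h ((x @ v) @ y)) \<in> detsp n"
      using that by (simp add: slices_def)
    then obtain c where "(\<lambda>v. h ((x @ v) @ y)) = c \<cdot> delta n"
      unfolding detsp_eq by blast
    then have "\<forall>v. h ((x @ v) @ y) = (c \<cdot> delta n) v"
      by metis
    then show ?thesis
      by (auto simp: smul_apply)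
  qed
  then obtain c where c: "\<And>x y v. length x = n * i \<Longrightarrow> length y = n * r \<Longrightarrow> h (x @ v @ y) = c x y * delta n v"
    by metis
  have "cinner (n * (i + 2 + r)) h f = (\<Sum>x\<in>lists_len (n * i). \<Sum>v\<in>lists_len (2 * n). \<Sum>y\<in>lists_len (n * r).
      cnj (c x y) * (delta n v * f (x @ v @ y)))"
    unfolding cinner_def len sum_lists_len_add by (intro sum.cong refl) (simp add: c)
  also have "\<dots> = (\<Sum>x\<in>lists_len (n * i). \<Sum>y\<in>lists_len (n * r). \<Sum>v\<in>lists_len (2 * n).
      cnj (c x y) * (delta n v * f (x @ v @ y)))"
    by (intro sum.cong refl sum.swap)
  also have "\<dots> = (\<Sum>x\<in>lists_len (n * i). \<Sum>y\<in>lists_len (n * r). cnj (c x y) * Con n (n * i) f (x @ y))"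
    by (intro sum.cong refl) (simp add: Con_append sum_distrib_left)
  also have "\<dots> = 0"
    by (simp add: f zero_fun_apply)
  finally show ?thesis .
qed

lemma Ins_in_Kgen:
  assumes f: "f \<in> Sy n (i + r)" and n: "1 \<le> n"
  shows "Ins n (n * i) f \<in> slices (n * (i + 2)) (n * r) (slices (n * i) (2 * n) (Sy n i) (detsp n)) (Sy n r)"
proof -
  have len: "n * (i + 2) = n * i + 2 * n"
    by (simp add: algebra_simps mult_2_right)
  have fsl: "f \<in> slices (n * i) (n * r) (Sy n i) (Sy n r)"
    using f by (simp add: Sy_add_eq_slices)
  then have fv: "f \<in> vec (n * i + n * r)"
    and l: "\<And>v. length v = n * r \<Longrightarrow> (\<lambda>u. f (u @ v)) \<in> Sy n i"
    and r: "\<And>u. length u = n * i \<Longrightarrow> (\<lambda>v. f (u @ v)) \<in> Sy n r"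
    by (auto simp: slices_def)
  have Iv: "Ins n (n * i) f \<in> vec ((n * i + 2 * n) + n * r)"
    using n by (intro Ins_vec[OF fv]) auto
  have 1: "(\<lambda>x. Ins n (n * i) f (x @ v @ y)) = delta n v \<cdot> (\<lambda>x. f (x @ y))"
    if "length v = 2 * n" "length y = n * r" for v y
  proof
    fix x
    show "Ins n (n * i) f (x @ v @ y) = (delta n v \<cdot> (\<lambda>x. f (x @ y))) x"
      using that vecD[OF Iv, of "x @ v @ y"] vecD[OF fv, of "x @ y"]
      by (cases "length x = n * i") (auto simp: smul_apply Ins_append)
  qed
  have 2: "(\<lambda>v. Ins n (n * i) f (x @ v @ y)) = f (x @ y) \<cdot> delta n"
    if "length x = n * i" "length y = n * r" for x y
  proof
    fix v
    show "Ins n (n * i) f (x @ v @ y) = (f (x @ y) \<cdot> delta n) v"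
      using that vecD[OF Iv, of "x @ v @ y"]
      by (cases "length v = 2 * n") (auto simp: smul_apply Ins_append delta_eq_0)
  qed
  have 3: "(\<lambda>w. Ins n (n * i) f (w @ y)) \<in> slices (n * i) (2 * n) (Sy n i) (detsp n)"
    if y: "length y = n * r" for y
  proof -
    have "(\<lambda>w. Ins n (n * i) f (w @ y)) \<in> vec (n * i + 2 * n)"
      using vecD[OF Iv] y by (auto simp: vec_def)
    then show ?thesis
      using y 1 2 l[OF y]
      by (auto simp: slices_def detsp_eq intro: fv.subspace_scale[OF subspace_Sy])
  qed
  have 4: "(\<lambda>y. Ins n (n * i) f (w @ y)) \<in> Sy n r" if w0: "length w = n * i + 2 * n" for w
  proof -
    obtain x v where w: "w = x @ v" "length x = n * i" "length v = 2 * n"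
      using w0 by (rule word_split)
    have "(\<lambda>y. Ins n (n * i) f (w @ y)) = delta n v \<cdot> (\<lambda>y. f (x @ y))"
      using w by (simp add: fun_eq_iff smul_apply Ins_append)
    then show ?thesis
      using r[OF w(2)] by (simp add: fv.subspace_scale[OF subspace_Sy])
  qed
  show ?thesis
    unfolding len using Iv 3 4 by (simp add: slices_def)
qed

text \<open>Vanishing contractions give orthogonality to every generator. Conversely, testing f
  against the insertion of its own contraction, an element of K_m, yields the squared norm of that
  contraction.\<close>

lemma Esp_eq_Ker:
  assumes n: "1 \<le> n"
  shows "Esp n m = Ker n m 0"
proof
  let ?G = "\<lambda>i. tens (n * (i + 2)) (tens (n * i) (Sy n i) (detsp n)) (Sy n (m - i - 2))"
  have K: "Kspace n m = fv.span (\<Union>i\<in>{i. i + 2 \<le> m}. ?G i)"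
    by (simp only: Kspace_def tpow_Lsym cspan_eq_span)
  show "Ker n m 0 \<subseteq> Esp n m"
  proof
    fix f assume f: "f \<in> Ker n m 0"
    have "cinner (n * m) h f = 0" if "h \<in> Kspace n m" for h
      using that unfolding K
    proof (induction rule: fv.span_induct_alt)
      case (step c x y)
      then obtain i where i: "i + 2 \<le> m" "x \<in> ?G i"
        by auto
      then have "i + 2 + (m - i - 2) = m" by simp
      then have "cinner (n * m) x f = 0"
        using Kgen_orthogonal[of x n i "m - i - 2" f] i f unfolding Kgen_eq_slices by (simp add: Ker_def)
      with step show ?case
        by (simp add: cinner_add_left cinner_smul_left)
    qed simp
    then show "f \<in> Esp n m"
      using f by (simp add: Esp_def orth_def tpow_Lsym Ker_def)
  qed
  show "Esp n m \<subseteq> Ker n m 0"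
  proof
    fix f assume "f \<in> Esp n m"
    then have f: "f \<in> Sy n m" and orth: "\<And>h. h \<in> Kspace n m \<Longrightarrow> cinner (n * m) h f = 0"
      by (auto simp: Esp_def orth_def tpow_Lsym)
    have "Con n (n * i) f = 0" if i: "i + 2 \<le> m" for i
    proof -
      obtain r where r: "m = i + r + 2"
        using i le_Suc_ex[of "i + 2" m] by auto
      have C: "Con n (n * i) f \<in> Sy n (i + r)"
        using f r by (intro Sy_Con) auto
      have "Ins n (n * i) (Con n (n * i) f) \<in> ?G i"
        using Ins_in_Kgen[OF C n] r unfolding Kgen_eq_slices by simp
      then have "Ins n (n * i) (Con n (n * i) f) \<in> Kspace n m"
        unfolding K using i by (intro fv.span_base) blast
      then have "cinner (n * m) (Ins n (n * i) (Con n (n * i) f)) f = 0"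
        by (rule orth)
      then have "cinner (n * (i + r)) (Con n (n * i) f) (Con n (n * i) f) = 0"
        by (subst (asm) cinner_Ins[where K = "n * (i + r)"]) (auto simp: r algebra_simps mult_2_right)
      then show ?thesis
        using cinner_self_eq_0[OF Sy_vec[OF C]] by blast
    qed
    then show "f \<in> Ker n m 0"
      using f by (simp add: Ker_def)
  qed
qed

lemma tens_Esp:
  assumes "1 \<le> n"
  shows "tens (n * k) (Esp n k) (Esp n l) = Ker n (k + l) k"
  unfolding Esp_eq_Ker[OF assms] slices_Ker[symmetric]
  by (intro tens_eq_slices subspace_Ker Ker_subset_vec)

subsection \<open>Quantum integers\<close>

text \<open>The Chebyshev recursion: for d = q + 1/q these are the quantum integers of q, and for d
  = 2 the ordinary integers.\<close>

fun qn :: "real \<Rightarrow> nat \<Rightarrow> real" where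
  "qn d 0 = 0"
| "qn d (Suc 0) = 1"
| "qn d (Suc (Suc k)) = d * qn d (Suc k) - qn d k"

text \<open>For d \<ge> 2 the recursion makes the increments nondecreasing, and the first increment
  is 1.\<close>

lemma qn_step:
  assumes "2 \<le> d"
  shows "0 \<le> qn d k \<and> qn d k + 1 \<le> qn d (Suc k)"
proof (induction k)
  case (Suc k)
  then have k: "0 \<le> qn d k" "qn d k + 1 \<le> qn d (Suc k)"
    by auto
  then have "2 * qn d (Suc k) \<le> d * qn d (Suc k)"
    using assms by (intro mult_right_mono) auto
  with k show ?case
    unfolding qn.simps by (intro conjI; linarith)
qed simp

text \<open>The solution, with value 1 at 0, of (n+1) t_m + (-1)^n (t_{m-1} + t_{m+1}) = 0 and
  t_{-1} = 0. The alternating factor absorbs the zigzag sign and leaves quantum integers.\<close>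

definition tc :: "nat \<Rightarrow> nat \<Rightarrow> complex" where
  "tc n i = (- ((-1) ^ n)) ^ i * of_real (qn (real n + 1) (Suc i))"

text \<open>The scalar of the contraction at m after the insertion at i: the loop value for equal
  positions, the zigzag sign for neighbours, and 0 for positions far apart, under the vanishing
  conditions in \<open>con_ins\<close>.\<close>

definition kap :: "nat \<Rightarrow> nat \<Rightarrow> nat \<Rightarrow> complex" where
  "kap n m i = (if i = m then of_nat (n + 1) else if i = Suc m \<or> m = Suc i then (-1) ^ n else 0)"

lemma sign_mult_sign [simp]: "(-1) ^ n * ((-1) ^ n * x) = (x :: complex)"
  by (simp add: mult.assoc[symmetric] flip: power_mult_distrib)

lemma tc_0 [simp]: "tc n 0 = 1"
  by (simp add: tc_def)

lemma tc_rec_0: "of_nat (n + 1) * tc n 0 = - ((-1) ^ n * tc n 1)"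
  by (simp add: tc_def)

lemma tc_rec: "of_nat (n + 1) * tc n (Suc i) + (-1) ^ n * tc n i = - ((-1) ^ n * tc n (Suc (Suc i)))"
  by (simp add: tc_def algebra_simps)

text \<open>The sum is the recursion of \<open>tc\<close> at m. It is complete for m < a; for m = a
  the term with index a + 1 is missing, and its negative remains.\<close>

lemma sum_tc_kap:
  assumes "m \<le> a"
  shows "(\<Sum>i\<le>a. tc n i * kap n m i) = (if m = a then - ((-1) ^ n * tc n (Suc a)) else 0)"
  using assms
proof (induction a rule: dec_induct)
  case base
  show ?case
  proof (cases m)
    case 0
    then show ?thesis
      using tc_rec_0[of n] by (simp add: kap_def)
  next
    case (Suc k)
    have "(\<Sum>i<k. tc n i * kap n m i) = 0"
      by (intro sum.neutral) (auto simp: kap_def Suc)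
    then have "(\<Sum>i\<le>m. tc n i * kap n m i) = tc n k * (-1) ^ n + tc n (Suc k) * of_nat (n + 1)"
      using Suc by (simp add: kap_def flip: lessThan_Suc_atMost)
    then show ?thesis
      using tc_rec[of n k] Suc by (simp add: mult.commute add.commute)
  qed
next
  case (step a)
  then show ?case
    by (auto simp: kap_def)
qed

lemma sum_tc_kap_rev:
  assumes "a \<le> m" "m \<le> a + b"
  shows "(\<Sum>j\<le>b. tc n (b - j) * kap n m (a + j)) = (if m = a then - ((-1) ^ n * tc n (Suc b)) else 0)"
proof -
  have k: "kap n (a + b - m) (b - j) = kap n m (a + j)" if "j \<le> b" for j
  proof -
    have "b - j = a + b - m \<longleftrightarrow> a + j = m" "b - j = Suc (a + b - m) \<longleftrightarrow> m = Suc (a + j)"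
      "a + b - m = Suc (b - j) \<longleftrightarrow> a + j = Suc m"
      using assms that by arith+
    then show ?thesis
      by (simp only: kap_def disj_commute)
  qed
  have "(\<Sum>j\<le>b. tc n (b - j) * kap n m (a + j)) = (\<Sum>i\<le>b. tc n i * kap n (a + b - m) i)"
    by (rule sum.reindex_bij_witness[of _ "\<lambda>i. b - i" "\<lambda>j. b - j"]) (simp_all add: k)
  also have "\<dots> = (if a + b - m = b then - ((-1) ^ n * tc n (Suc b)) else 0)"
    using assms by (intro sum_tc_kap) auto
  also have "a + b - m = b \<longleftrightarrow> m = a"
    using assms by arith
  finally show ?thesis .
qed

subsection \<open>Temperley--Lieb relations\<close>

abbreviation ins :: "nat \<Rightarrow> nat \<Rightarrow> (bool list \<Rightarrow> complex) \<Rightarrow> (bool list \<Rightarrow> complex)" where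
  "ins n i \<equiv> Ins n (n * i)"

abbreviation con :: "nat \<Rightarrow> nat \<Rightarrow> (bool list \<Rightarrow> complex) \<Rightarrow> (bool list \<Rightarrow> complex)" where
  "con n i \<equiv> Con n (n * i)"

lemma ge2E:
  assumes "2 \<le> (N::nat)"
  obtains M where "N = M + 2"
  using le_Suc_ex[OF assms] by (auto simp: add.commute)

lemma con_ins_far:
  assumes y: "y \<in> Sy n (m + 2)" and ij: "i \<le> j" "j \<le> m" and n: "1 \<le> n"
  shows "con n i (ins n (Suc (Suc j)) y) = ins n j (con n i y)"
proof -
  have "y \<in> vec (n * m + 2 * n)"
    using Sy_vec[OF y] by (simp add: algebra_simps mult_2_right)
  from Con_Ins_far[OF this, of "n * i" "n * j"] show ?thesis
    using ij n by (simp add: algebra_simps mult_2_right)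
qed

lemma con_ins_far':
  assumes y: "y \<in> Sy n (m + 2)" and ij: "i \<le> j" "j \<le> m" and n: "1 \<le> n"
  shows "con n (Suc (Suc j)) (ins n i y) = ins n i (con n j y)"
proof -
  have "y \<in> vec (n * m + 2 * n)"
    using Sy_vec[OF y] by (simp add: algebra_simps mult_2_right)
  from Con_Ins_far'[OF this, of "n * i" "n * j"] show ?thesis
    using ij n by (simp add: algebra_simps mult_2_right)
qed

lemma con_con:
  assumes y: "y \<in> Sy n (m + 4)" and ij: "i \<le> j" "j \<le> m" and n: "1 \<le> n"
  shows "con n i (con n (Suc (Suc j)) y) = con n j (con n i y)"
proof -
  have "y \<in> vec (n * m + 2 * n + 2 * n)"
    using Sy_vec[OF y] by (simp add: algebra_simps)
  from Con_Con[OF this, of "n * i" "n * j"] show ?thesis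
    using ij n by (simp add: algebra_simps mult_2_right)
qed

lemma con_ins_same: "y \<in> Sy n m \<Longrightarrow> i \<le> m \<Longrightarrow> 1 \<le> n \<Longrightarrow> con n i (ins n i y) = of_nat (n + 1) \<cdot> y"
  by (rule Con_Ins_same[OF Sy_vec]) auto

lemma con_ins_up:
  assumes "y \<in> Sy n m" "i < m" "1 \<le> n"
  shows "con n i (ins n (Suc i) y) = (-1) ^ n \<cdot> y"
  using Con_Ins_up[OF Sy_vec[OF assms(1)] slot_le[OF assms(2)] assms(3) SyD[OF assms(1,2)]]
  by (simp add: add.commute)

lemma con_ins_down:
  assumes "y \<in> Sy n m" "i < m" "1 \<le> n"
  shows "con n (Suc i) (ins n i y) = (-1) ^ n \<cdot> y"
  using Con_Ins_down[OF Sy_vec[OF assms(1)] slot_le[OF assms(2)] assms(3) SyD[OF assms(1,2)]]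
  by (simp add: add.commute)

text \<open>If the positions are at least two slots apart, the contraction moves past the insertion
  and acts on y, at m or at m - 2, where it vanishes by assumption.\<close>

lemma con_ins:
  assumes y: "y \<in> Sy n N" and i: "i \<le> N" and m: "m \<le> N" and n: "1 \<le> n"
    and 1: "m + 2 \<le> i \<Longrightarrow> con n m y = 0" and 2: "i + 2 \<le> m \<Longrightarrow> con n (m - 2) y = 0"
  shows "con n m (ins n i y) = kap n m i \<cdot> y"
proof -
  consider "i = m" | "i = Suc m" | "m = Suc i" | "m + 2 \<le> i" | "i + 2 \<le> m"
    by linarith
  then show ?thesis
  proof cases
    case 1
    then show ?thesis
      using con_ins_same[OF y m n] by (simp add: kap_def)
  next
    case 2
    then show ?thesis
      using con_ins_up[OF y _ n, of m] i by (simp add: kap_def)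
  next
    case 3
    then show ?thesis
      using con_ins_down[OF y _ n, of i] m by (simp add: kap_def)
  next
    case 4
    then obtain j where j: "i = Suc (Suc j)" "m \<le> j"
      using le_Suc_ex[OF 4] by auto
    obtain M where M: "N = M + 2"
      using i j by (auto intro: ge2E[of N])
    have "con n m (ins n i y) = ins n j (con n m y)"
      unfolding j(1) using y j i M n by (intro con_ins_far) auto
    then show ?thesis
      using 1 4 by (simp add: kap_def)
  next
    case 5
    then obtain j where j: "m = Suc (Suc j)" "i \<le> j"
      using le_Suc_ex[OF 5] by auto
    obtain M where M: "N = M + 2"
      using m j by (auto intro: ge2E[of N])
    have "con n m (ins n i y) = ins n i (con n j y)"
      unfolding j(1) using y j m M n by (intro con_ins_far') auto
    then show ?thesis
      using 2 5 j by (simp add: kap_def)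
  qed
qed

section \<open>The contraction across the cut and its adjoint\<close>

lemma KerD: "f \<in> Ker n m a \<Longrightarrow> i + 2 \<le> m \<Longrightarrow> i + 1 \<noteq> a \<Longrightarrow> con n i f = 0"
  by (simp add: Ker_def)

lemma Ker_Sy: "f \<in> Ker n m a \<Longrightarrow> f \<in> Sy n m"
  by (simp add: Ker_def)

lemma con_Ker:
  assumes x: "x \<in> Ker n (a + b + 2) (Suc a)" and n: "1 \<le> n"
  shows "con n a x \<in> Ker n (a + b) a"
proof -
  have xS: "x \<in> Sy n (a + b + 2)"
    using x by (rule Ker_Sy)
  have "con n i (con n a x) = 0" if i: "i + 2 \<le> a + b" "i + 1 \<noteq> a" for i
  proof -
    obtain M where M: "a + b = M + 2"
      using i by (auto intro: ge2E[of "a + b"])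
    have xS': "x \<in> Sy n (M + 4)"
      using xS M by (simp add: numeral_eq_Suc)
    show ?thesis
    proof (cases "i + 2 \<le> a")
      case True
      then obtain j where j: "a = Suc (Suc j)" "i \<le> j"
        using le_Suc_ex[OF True] by auto
      have "con n i (con n a x) = con n j (con n i x)"
        unfolding j(1) using j M by (intro con_con[OF xS' _ _ n]) auto
      also have "con n i x = 0"
        using True i by (intro KerD[OF x]) auto
      finally show ?thesis by simp
    next
      case False
      then have ai: "a \<le> i"
        using i by simp
      have "con n i (con n a x) = con n a (con n (Suc (Suc i)) x)"
        using ai i M by (intro con_con[OF xS' _ _ n, symmetric]) auto
      also have "con n (Suc (Suc i)) x = 0"
        using ai i by (intro KerD[OF x]) auto
      finally show ?thesis by simp
    qed
  qed
  then show ?thesis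
    using Sy_Con[OF xS, of a] by (simp add: Ker_def)
qed

lemma kernel_con:
  assumes "x \<in> Ker n (a + b + 2) (Suc a)" "con n a x = 0"
  shows "x \<in> Ker n (a + b + 2) 0"
  using assms by (auto simp: Ker_def)

lemma Ker_0_subset: "Ker n m 0 \<subseteq> Ker n m a"
  by (auto simp: Ker_def)

lemma tc_nonzero: "1 \<le> n \<Longrightarrow> tc n i \<noteq> 0"
  using qn_step[of "real n + 1" i] by (auto simp: tc_def)

text \<open>The insertion at a, corrected by insertions to its left so that all contractions left of
  a vanish (\<open>con_Lop\<close>). The prefactor gives the insertion at a the coefficient 1, on
  which adjointness depends.\<close>

definition Lop :: "nat \<Rightarrow> nat \<Rightarrow> (bool list \<Rightarrow> complex) \<Rightarrow> (bool list \<Rightarrow> complex)" where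
  "Lop n a y = (1 / tc n a) \<cdot> (\<Sum>i\<le>a. tc n i \<cdot> ins n i y)"

text \<open>Up to the Jones--Wenzl projections onto the two factors, this is the insertion at
  position \<open>a\<close>; it is adjoint to the contraction there.\<close>

definition Dop :: "nat \<Rightarrow> nat \<Rightarrow> nat \<Rightarrow> (bool list \<Rightarrow> complex) \<Rightarrow> (bool list \<Rightarrow> complex)" where
  "Dop n a b y = Lop n a y
     + ((-1) ^ n / tc n b) \<cdot> (\<Sum>j<b. tc n (b - Suc j) \<cdot> ins n (Suc a + j) (con n (Suc a) (Lop n a y)))"

lemma Lop_add: "Lop n a (y + z) = Lop n a y + Lop n a z"
  by (simp add: Lop_def Ins_add fv.scale_right_distrib sum.distrib)

lemma Lop_smul: "Lop n a (c \<cdot> y) = c \<cdot> Lop n a y"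
  by (simp add: Lop_def Ins_smul fv.scale_sum_right mult_ac)

lemma Dop_add: "Dop n a b (y + z) = Dop n a b y + Dop n a b z"
  by (simp add: Dop_def Lop_add Con_add Ins_add fv.scale_right_distrib sum.distrib)

lemma Dop_smul: "Dop n a b (c \<cdot> y) = c \<cdot> Dop n a b y"
  by (simp add: Dop_def Lop_smul Con_smul Ins_smul fv.scale_right_distrib fv.scale_sum_right mult_ac)

lemma Lop_Sy:
  assumes "y \<in> Sy n (a + b)" "1 \<le> n"
  shows "Lop n a y \<in> Sy n (a + b + 2)"
  unfolding Lop_def using assms
  by (intro fv.subspace_scale[OF subspace_Sy] fv.subspace_sum[OF subspace_Sy] Sy_Ins) auto

lemma con_Lop:
  assumes y: "y \<in> Sy n (a + b)" and m: "m \<le> a" and n: "1 \<le> n"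
    and 1: "m + 2 \<le> a \<Longrightarrow> con n m y = 0" and 2: "2 \<le> m \<Longrightarrow> con n (m - 2) y = 0"
  shows "con n m (Lop n a y) = (if m = a then - ((-1) ^ n * tc n (Suc a) / tc n a) \<cdot> y else 0)"
proof -
  have "con n m (Lop n a y) = (1 / tc n a) \<cdot> (\<Sum>i\<le>a. tc n i \<cdot> con n m (ins n i y))"
    by (simp add: Lop_def Con_smul Con_sum)
  also have "(\<Sum>i\<le>a. tc n i \<cdot> con n m (ins n i y)) = (\<Sum>i\<le>a. (tc n i * kap n m i) \<cdot> y)"
  proof (intro sum.cong refl)
    fix i assume "i \<in> {..a}"
    then have "con n m (ins n i y) = kap n m i \<cdot> y"
      using m by (intro con_ins[OF y _ _ n] 1 2) auto
    then show "tc n i \<cdot> con n m (ins n i y) = (tc n i * kap n m i) \<cdot> y"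
      by simp
  qed
  also have "\<dots> = (\<Sum>i\<le>a. tc n i * kap n m i) \<cdot> y"
    by (rule fv.scale_sum_left[symmetric])
  finally show ?thesis
    by (simp add: sum_tc_kap[OF m])
qed

text \<open>After the left correction only the contractions at a and a + 1 can be nonzero. The
  second sum is the mirrored correction to the right, which must cancel the one at a + 1 without
  disturbing the others.\<close>

lemma Dop_Ker:
  assumes y: "y \<in> Ker n (a + b) a" and n: "1 \<le> n"
  shows "Dop n a b y \<in> Ker n (a + b + 2) (Suc a)"
proof -
  define Z where "Z = Lop n a y"
  define x where "x = con n (Suc a) Z"
  have yS: "y \<in> Sy n (a + b)"
    using y by (rule Ker_Sy)
  have ZS: "Z \<in> Sy n (a + b + 2)"
    unfolding Z_def using yS n by (rule Lop_Sy)
  have Z1: "con n m Z = 0" if "m < a" for m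
    unfolding Z_def using that
    by (subst con_Lop[OF yS _ n]) (auto intro!: KerD[OF y])
  have Z2: "con n m Z = 0" if m: "Suc a < m" "m \<le> a + b" for m
  proof -
    obtain j where j: "m = Suc (Suc j)" "a \<le> j"
      using le_Suc_ex[of "a + 2" m] m by auto
    obtain M where M: "a + b = M + 2"
      using m j by (auto intro: ge2E[of "a + b"])
    have "con n m (ins n i y) = 0" if "i \<le> a" for i
    proof -
      have "con n m (ins n i y) = ins n i (con n j y)"
        unfolding j(1) using that j m M yS by (intro con_ins_far'[OF _ _ _ n, where m = M]) auto
      also have "con n j y = 0"
        using j m by (intro KerD[OF y]) auto
      finally show ?thesis by simp
    qed
    then show ?thesis
      by (simp add: Z_def Lop_def Con_smul Con_sum)
  qed
  show ?thesis
  proof (cases b)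
    case 0
    have "Dop n a b y = Z"
      by (simp add: Dop_def Z_def 0)
    then show ?thesis
      using ZS Z1 0 by (simp add: Ker_def)
  next
    case (Suc b')
    have xS: "x \<in> Sy n (a + b)"
      unfolding x_def using ZS Suc by (intro Sy_Con) auto
    \<comment> \<open>Together with the next fact: x inherits the vanishing of contractions from Z
      at every position except a, which is all that the far terms in \<open>con_ins\<close>
      require.\<close>
    have x1: "con n m x = 0" if m: "m < a" for m
    proof -
      obtain j where j: "Suc a = Suc (Suc j)" "m \<le> j"
        using m by (cases a) auto
      obtain M where M: "a + b = M + 2"
        using j Suc by (cases a) auto
      have "con n m x = con n j (con n m Z)"
        unfolding x_def j(1) using ZS j M Suc by (intro con_con[OF _ _ _ n, where m = M]) (auto simp: numeral_eq_Suc)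
      then show ?thesis
        using Z1[OF m] by simp
    qed
    have x2: "con n m x = 0" if m: "Suc a \<le> m" "m + 2 \<le> a + b" for m
    proof -
      obtain M where M: "a + b = M + 2"
        using m by (auto intro: ge2E[of "a + b"])
      have "con n m x = con n (Suc a) (con n (Suc (Suc m)) Z)"
        unfolding x_def using ZS m M
        by (intro con_con[OF _ _ _ n, where m = M, symmetric]) (auto simp: numeral_eq_Suc)
      then show ?thesis
        using Z2[of "Suc (Suc m)"] m by simp
    qed
    define R where "R = (\<Sum>j\<le>b'. tc n (b' - j) \<cdot> ins n (Suc a + j) x)"
    have D: "Dop n a b y = Z + ((-1) ^ n / tc n b) \<cdot> R"
      by (simp only: Dop_def Suc lessThan_Suc_atMost diff_Suc_Suc flip: Z_def x_def R_def)
    have RS: "R \<in> Sy n (a + b + 2)"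
      unfolding R_def using xS n Suc
      by (intro fv.subspace_scale[OF subspace_Sy] fv.subspace_sum[OF subspace_Sy] Sy_Ins) auto
    \<comment> \<open>This fixes the constant in \<open>Dop\<close>: multiplied by (-1)^n / t_b, the
      contraction at a + 1 becomes -x and cancels that of Z.\<close>
    have R1: "con n m R = (if m = Suc a then - ((-1) ^ n * tc n b) \<cdot> x else 0)"
      if m: "Suc a \<le> m" "m \<le> a + b" for m
    proof -
      have "con n m R = (\<Sum>j\<le>b'. (tc n (b' - j) * kap n m (Suc a + j)) \<cdot> x)"
        unfolding R_def Con_sum
      proof (intro sum.cong refl)
        fix j assume "j \<in> {..b'}"
        then have "con n m (ins n (Suc a + j) x) = kap n m (Suc a + j) \<cdot> x"
          using m Suc by (intro con_ins[OF xS _ _ n] x2) auto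
        then show "con n m (tc n (b' - j) \<cdot> ins n (Suc a + j) x) = (tc n (b' - j) * kap n m (Suc a + j)) \<cdot> x"
          by (simp add: Con_smul)
      qed
      also have "\<dots> = (\<Sum>j\<le>b'. tc n (b' - j) * kap n m (Suc a + j)) \<cdot> x"
        by (rule fv.scale_sum_left[symmetric])
      finally show ?thesis
        using sum_tc_kap_rev[of "Suc a" m b' n] m Suc by simp
    qed
    have R2: "con n m R = 0" if m: "m < a" for m
    proof -
      obtain a' where a': "a = Suc a'"
        using m by (cases a) auto
      have "con n m (ins n (Suc a + j) x) = 0" if j: "j \<le> b'" for j
      proof -
        have "con n m (ins n (Suc a + j) x) = ins n (a' + j) (con n m x)"
          using con_ins_far[of x n "a' + b'" m "a' + j"] xS a' Suc m j n by simp
        then show ?thesis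
          using x1[OF m] by simp
      qed
      then show ?thesis
        by (simp add: R_def Con_sum Con_smul)
    qed
    have "con n m (Dop n a b y) = 0" if m: "m \<le> a + b" "m \<noteq> a" for m
    proof -
      consider "m < a" | "m = Suc a" | "Suc a < m"
        using m by linarith
      then show ?thesis
      proof cases
        case 1
        then show ?thesis
          by (simp add: D Con_add Con_smul Z1 R2)
      next
        case 2
        then show ?thesis
          using R1[of m] m tc_nonzero[OF n, of b] by (simp add: D Con_add Con_smul x_def)
      next
        case 3
        then show ?thesis
          using R1[of m] Z2[of m] m by (simp add: D Con_add Con_smul)
      qed
    qed
    moreover have "Dop n a b y \<in> Sy n (a + b + 2)"
      unfolding D using ZS RS by (intro fv.subspace_add[OF subspace_Sy] fv.subspace_scale[OF subspace_Sy])
    ultimately show ?thesis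
      by (simp add: Ker_def)
  qed
qed

section \<open>The contraction after its adjoint\<close>

definition alp :: "nat \<Rightarrow> nat \<Rightarrow> nat \<Rightarrow> real" where
  "alp n a b = qn (real n + 1) (a + 2) / qn (real n + 1) (Suc a) - qn (real n + 1) b / qn (real n + 1) (Suc b)"

definition bet :: "nat \<Rightarrow> nat \<Rightarrow> nat \<Rightarrow> real" where
  "bet n a b = (qn (real n + 1) a / qn (real n + 1) (Suc a)) * (qn (real n + 1) b / qn (real n + 1) (Suc b))"

lemma qn_pos: "1 \<le> n \<Longrightarrow> 0 < qn (real n + 1) (Suc a)"
  using qn_step[of "real n + 1" a] by auto

text \<open>Growth of the quantum integers puts the first ratio at 1 or above and the second
  strictly below 1.\<close>

lemma alp_pos:
  assumes "1 \<le> n"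
  shows "0 < alp n a b"
proof -
  have "1 \<le> qn (real n + 1) (Suc (Suc a)) / qn (real n + 1) (Suc a)"
    using qn_step[of "real n + 1" "Suc a"] qn_pos[OF assms, of a] assms by (simp add: field_simps)
  moreover have "qn (real n + 1) b / qn (real n + 1) (Suc b) < 1"
    using qn_step[of "real n + 1" b] qn_pos[OF assms, of b] assms by (simp add: field_simps)
  ultimately show ?thesis
    by (simp add: alp_def)
qed

lemma bet_nonneg: "1 \<le> n \<Longrightarrow> 0 \<le> bet n a b"
  using qn_step[of "real n + 1"] by (simp add: bet_def)

lemma tc_ratio_up: "1 \<le> n \<Longrightarrow> - ((-1) ^ n * tc n (Suc a) / tc n a) = of_real (qn (real n + 1) (a + 2) / qn (real n + 1) (Suc a))"
  by (simp add: tc_def)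

lemma tc_ratio_down: "1 \<le> n \<Longrightarrow> tc n b / tc n (Suc b) = - ((-1) ^ n) * of_real (qn (real n + 1) (Suc b) / qn (real n + 1) (Suc (Suc b)))"
  by (cases "even n") (simp_all add: tc_def field_simps del: qn.simps)

text \<open>The operator D' C' on E_k \<otimes> E_l. If a factor is E_0, there is no contraction
  across the cut, and the value 0 starts the induction on its eigenvalues.\<close>

definition Qop :: "nat \<Rightarrow> nat \<Rightarrow> nat \<Rightarrow> (bool list \<Rightarrow> complex) \<Rightarrow> (bool list \<Rightarrow> complex)" where
  "Qop n k l x = (if k = 0 \<or> l = 0 then 0 else Dop n (k - 1) (l - 1) (con n (k - 1) x))"

text \<open>The contraction sees the left correction, the first term of the right correction as a
  zigzag, and passes through all later terms. Writing x as a multiple of y plus a multiple of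
  \<open>Lop\<close> applied to the contraction z of y, the parts in y add up to \<alpha>, while the
  parts in z reassemble into D' C' y.\<close>

lemma con_Dop:
  assumes y: "y \<in> Ker n (a + b) a" and n: "1 \<le> n"
  shows "con n a (Dop n a b y) = of_real (alp n a b) \<cdot> y + of_real (bet n a b) \<cdot> Qop n a b y"
proof -
  define e :: complex where "e = (-1) ^ n"
  have ee: "e * e = 1"
    by (simp add: e_def flip: power_mult_distrib)
  define Z where "Z = Lop n a y"
  define x where "x = con n (Suc a) Z"
  have yS: "y \<in> Sy n (a + b)"
    using y by (rule Ker_Sy)
  have cZ: "con n a Z = of_real (qn (real n + 1) (a + 2) / qn (real n + 1) (Suc a)) \<cdot> y"
  proof -
    have "con n a Z = - ((-1) ^ n * tc n (Suc a) / tc n a) \<cdot> y"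
      unfolding Z_def by (subst con_Lop[OF yS order.refl n]) (auto intro!: KerD[OF y])
    then show ?thesis
      by (simp only: tc_ratio_up[OF n])
  qed
  show ?thesis
  proof (cases b)
    case 0
    have "Dop n a b y = Z"
      by (simp add: Dop_def Z_def 0)
    then show ?thesis
      using cZ by (simp add: alp_def bet_def 0)
  next
    case (Suc b')
    define r where "r = tc n b' / tc n b"
    have re: "r * e = - of_real (qn (real n + 1) b / qn (real n + 1) (Suc b))"
      using tc_ratio_down[OF n, of b'] ee by (simp add: r_def Suc e_def del: qn.simps)
    have xS: "x \<in> Sy n (a + b)"
      unfolding x_def Z_def using Lop_Sy[OF yS n] Suc by (intro Sy_Con) auto
    \<comment> \<open>What remains of the right correction beyond its first term: the contraction at
      a has moved past the insertions and lowered their positions by two slots.\<close>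
    define T where "T = (\<Sum>j<b'. tc n (b' - Suc j) \<cdot> ins n (a + j) (con n a x))"
    have far: "con n a (ins n (Suc a + Suc j) x) = ins n (a + j) (con n a x)" if j: "j < b'" for j
    proof -
      obtain b'' where "b' = Suc b''"
        using j by (cases b') auto
      then show ?thesis
        using con_ins_far[of x n "a + b''" a "a + j"] xS n Suc j by simp
    qed
    have "con n a (\<Sum>j<b. tc n (b - Suc j) \<cdot> ins n (Suc a + j) x)
        = tc n b' \<cdot> con n a (ins n (Suc a) x) + (\<Sum>j<b'. tc n (b' - Suc j) \<cdot> con n a (ins n (Suc a + Suc j) x))"
      by (simp only: Suc sum.lessThan_Suc_shift Con_add Con_sum Con_smul diff_Suc_Suc diff_zero add_0_right)
    also have "\<dots> = tc n b' \<cdot> con n a (ins n (Suc a) x) + T"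
      unfolding T_def by (intro arg_cong2[of _ _ _ _ "(+)"] refl sum.cong) (auto simp only: far lessThan_iff)
    also have "con n a (ins n (Suc a) x) = e \<cdot> x"
      unfolding e_def by (rule con_ins_up[OF xS _ n]) (simp add: Suc)
    finally have sum: "con n a (\<Sum>j<b. tc n (b - Suc j) \<cdot> ins n (Suc a + j) x) = tc n b' \<cdot> e \<cdot> x + T" .
    have "con n a (Dop n a b y) = con n a Z + (e / tc n b) \<cdot> (tc n b' \<cdot> e \<cdot> x + T)"
      unfolding Dop_def Z_def[symmetric] x_def[symmetric] e_def[symmetric] by (simp only: Con_add Con_smul sum)
    also have "(e / tc n b) \<cdot> (tc n b' \<cdot> e \<cdot> x + T) = r \<cdot> x + (e / tc n b) \<cdot> T"
    proof -
      have "e / tc n b * (tc n b' * e) = r"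
        using ee by (simp add: r_def mult.commute mult.left_commute)
      then show ?thesis
        by (simp add: fv.scale_right_distrib)
    qed
    finally have main: "con n a (Dop n a b y) = con n a Z + (r \<cdot> x + (e / tc n b) \<cdot> T)" .
    \<comment> \<open>For b = 1 this contraction does not exist, but then T is an empty sum.\<close>
    have cay: "con n a y = 0" if "b' \<noteq> 0"
      using that Suc by (intro KerD[OF y]) auto
    have cZr: "con n a Z + (r * e) \<cdot> y = of_real (alp n a b) \<cdot> y"
      by (simp add: cZ re alp_def fv.scale_left_diff_distrib del: qn.simps)
    show ?thesis
    proof (cases a)
      case 0
      have "Z = ins n 0 y"
        by (simp add: Z_def Lop_def 0)
      then have x: "x = e \<cdot> y"
        unfolding x_def e_def using con_ins_down[OF yS _ n, of 0] Suc 0 by simp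
      have "T = 0"
        unfolding T_def using cay by (cases "b' = 0") (simp_all add: x Con_smul)
      then have "con n a (Dop n a b y) = con n a Z + (r * e) \<cdot> y"
        using main by (simp add: x)
      also note cZr
      finally show ?thesis
        by (simp add: bet_def 0)
    next
      case a: (Suc a')
      define z where "z = con n a' y"
      define s where "s = tc n a' / tc n a"
      have se: "s = - e * of_real (qn (real n + 1) a / qn (real n + 1) (Suc a))"
        using tc_ratio_down[OF n, of a'] by (simp add: s_def a e_def del: qn.simps)
      have "(r * e) * (s * e) = of_real (bet n a b)"
        unfolding re se bet_def using ee by (simp add: mult_ac del: qn.simps)
      then have rs: "r * s = of_real (bet n a b)"
        using ee by (metis mult.assoc mult.commute mult.right_neutral)
      have t: "tc n a \<noteq> 0" "tc n b \<noteq> 0" "tc n a' \<noteq> 0" "tc n b' \<noteq> 0"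
        using n by (simp_all add: tc_nonzero)
      \<comment> \<open>All insertions in \<open>Lop\<close> except the last are far from the slots
        contracted here; past them the contraction acts on y at a', across the cut, and produces
        z.\<close>
      have far2: "con n (Suc a) (ins n i y) = ins n i z" if "i \<le> a'" for i
        using con_ins_far'[of y n "a' + b'" i a'] yS n that by (simp add: z_def a Suc)
      have "x = (1 / tc n a) \<cdot> ((\<Sum>i\<le>a'. tc n i \<cdot> con n (Suc a) (ins n i y)) + tc n a \<cdot> con n (Suc a) (ins n a y))"
        unfolding x_def Z_def Lop_def by (simp only: a sum.atMost_Suc Con_smul Con_add Con_sum)
      also have "con n (Suc a) (ins n a y) = e \<cdot> y"
        unfolding e_def by (rule con_ins_down[OF yS _ n]) (simp add: Suc)
      also have "(\<Sum>i\<le>a'. tc n i \<cdot> con n (Suc a) (ins n i y)) = (\<Sum>i\<le>a'. tc n i \<cdot> ins n i z)"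
        by (intro sum.cong refl) (simp only: far2 atMost_iff)
      also have "\<dots> = tc n a' \<cdot> Lop n a' z"
        using t by (simp add: Lop_def)
      also have "(1 / tc n a) \<cdot> (tc n a' \<cdot> Lop n a' z + tc n a \<cdot> e \<cdot> y) = s \<cdot> Lop n a' z + e \<cdot> y"
        using t by (simp add: fv.scale_right_distrib s_def)
      finally have x: "x = s \<cdot> Lop n a' z + e \<cdot> y" .
      define T' where "T' = (\<Sum>j<b'. tc n (b' - Suc j) \<cdot> ins n (Suc a' + j) (con n (Suc a') (Lop n a' z)))"
      have T: "T = s \<cdot> T'"
      proof (cases "b' = 0")
        case False
        then have "con n a x = s \<cdot> con n a (Lop n a' z)"
          using cay by (simp add: x Con_add Con_smul)
        then show ?thesis
          unfolding T_def T'_def a[symmetric] by (simp only: Ins_smul fv.scale_sum_right fv.scale_left_commute)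
      qed (simp add: T_def T'_def)
      have Q: "Qop n a b y = Lop n a' z + (e / tc n b') \<cdot> T'"
        by (simp only: Qop_def Dop_def T'_def e_def z_def a Suc diff_Suc_1 nat.distinct simp_thms if_False)
      \<comment> \<open>The constant of the right correction at level b becomes the one at level b -
        1, with r s = \<beta> left as the common factor.\<close>
      have c: "e / tc n b * s = (r * s) * (e / tc n b')"
        using t by (simp add: r_def field_simps)
      have "con n a (Dop n a b y) = con n a Z + (r * e) \<cdot> y + (r * s) \<cdot> Qop n a b y"
        unfolding main x T Q fv.scale_right_distrib fv.scale_scale c by (simp add: add_ac)
      then show ?thesis
        by (simp only: cZr rs)
    qed
  qed
qed

section \<open>Adjointness and equivariance of \<open>Dop\<close>\<close>

lemma cinner_sum_left: "cinner N (\<Sum>i\<in>A. f i) h = (\<Sum>i\<in>A. cinner N (f i) h)"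
  by (induction A rule: infinite_finite_induct) (simp_all add: cinner_add_left)

text \<open>Insertions are adjoint to contractions, and x survives only the contraction at a. Only
  the last term of \<open>Lop\<close> contributes, with coefficient 1; the right correction sits at
  positions beyond a and is orthogonal to x.\<close>

lemma cinner_Dop:
  assumes x: "x \<in> Ker n (a + b + 2) (Suc a)" and n: "1 \<le> n"
  shows "cinner (n * (a + b + 2)) (Dop n a b y) x = cinner (n * (a + b)) y (con n a x)"
proof -
  define N where "N = n * (a + b + 2)"
  have ins: "cinner N (ins n i w) x = cinner (n * (a + b)) w (con n i x)" if "i \<le> a + b" for i w
    unfolding N_def using that by (intro cinner_Ins mult_le_mono2) (auto simp: algebra_simps mult_2_right)
  have ins0: "cinner N (ins n i w) x = 0" if "i \<le> a + b" "i \<noteq> a" for i w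
  proof -
    have "con n i x = 0"
      using that by (intro KerD[OF x]) auto
    then show ?thesis
      using ins[OF that(1)] by simp
  qed
  have "(\<Sum>i\<le>a. cnj (tc n i) * cinner N (ins n i y) x)
      = (\<Sum>i\<le>a. if i = a then cnj (tc n a) * cinner (n * (a + b)) y (con n a x) else 0)"
  proof (intro sum.cong refl)
    fix i assume "i \<in> {..a}"
    then show "cnj (tc n i) * cinner N (ins n i y) x
        = (if i = a then cnj (tc n a) * cinner (n * (a + b)) y (con n a x) else 0)"
      using ins[of a y] ins0[of i y] by (cases "i = a") auto
  qed
  then have "cinner N (Lop n a y) x = cinner (n * (a + b)) y (con n a x)"
    using tc_nonzero[OF n, of a] by (simp add: Lop_def cinner_smul_left cinner_sum_left)
  moreover have "(\<Sum>j<b. cnj (tc n (b - Suc j)) * cinner N (ins n (Suc a + j) w) x) = 0" for w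
  proof (intro sum.neutral ballI)
    fix j assume "j \<in> {..<b}"
    then show "cnj (tc n (b - Suc j)) * cinner N (ins n (Suc a + j) w) x = 0"
      by (subst ins0) auto
  qed
  ultimately show ?thesis
    unfolding N_def[symmetric] by (simp only: Dop_def cinner_add_left cinner_smul_left cinner_sum_left mult_zero_right add_0_right)
qed

lemma act_ins:
  assumes "g \<in> SU2" "w \<in> Sy n m" "i \<le> m" "1 \<le> n"
  shows "act g (n * (m + 2)) (ins n i w) = ins n i (act g (n * m) w)"
  using assms by (intro act_Ins Sy_vec) (auto simp: algebra_simps mult_2_right)

lemma act_con:
  assumes "g \<in> SU2" "i \<le> m"
  shows "act g (n * m) (con n i w) = con n i (act g (n * (m + 2)) w)"
  using assms by (intro act_Con) (auto simp: algebra_simps mult_2_right)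

lemma act_Sy:
  assumes "f \<in> Sy n m"
  shows "act g (n * m) f \<in> Sy n m"
  using assms by (auto simp: Sy_def intro!: symat_act slot_le)

lemma act_Ker:
  assumes f: "f \<in> Ker n m a" and g: "g \<in> SU2"
  shows "act g (n * m) f \<in> Ker n m a"
proof -
  have "con n i (act g (n * m) f) = 0" if i: "i + 2 \<le> m" "i + 1 \<noteq> a" for i
  proof -
    obtain M where M: "m = M + 2"
      using i by (auto intro: ge2E[of m])
    then have "con n i (act g (n * m) f) = act g (n * M) (con n i f)"
      using act_con[OF g, of i M n f] i by simp
    then show ?thesis
      using KerD[OF f i] by simp
  qed
  then show ?thesis
    using act_Sy[OF Ker_Sy[OF f]] by (simp add: Ker_def)
qed

lemma act_Lop:
  assumes "g \<in> SU2" "y \<in> Sy n (a + b)" "1 \<le> n"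
  shows "act g (n * (a + b + 2)) (Lop n a y) = Lop n a (act g (n * (a + b)) y)"
  unfolding Lop_def act_smul act_sum using assms
  by (intro arg_cong2[of _ _ _ _ smul] refl sum.cong) (simp only: act_ins atMost_iff trans_le_add1)

lemma act_Dop:
  assumes g: "g \<in> SU2" and y: "y \<in> Sy n (a + b)" and n: "1 \<le> n"
  shows "act g (n * (a + b + 2)) (Dop n a b y) = Dop n a b (act g (n * (a + b)) y)"
proof -
  have "act g (n * (a + b + 2)) (ins n (Suc a + j) (con n (Suc a) (Lop n a y)))
      = ins n (Suc a + j) (con n (Suc a) (Lop n a (act g (n * (a + b)) y)))" if "j < b" for j
  proof -
    have "con n (Suc a) (Lop n a y) \<in> Sy n (a + b)"
      using that by (intro Sy_Con Lop_Sy y n) auto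
    then have "act g (n * (a + b + 2)) (ins n (Suc a + j) (con n (Suc a) (Lop n a y)))
        = ins n (Suc a + j) (act g (n * (a + b)) (con n (Suc a) (Lop n a y)))"
      using that by (intro act_ins g n) auto
    also have "act g (n * (a + b)) (con n (Suc a) (Lop n a y)) = con n (Suc a) (Lop n a (act g (n * (a + b)) y))"
      using that act_con[OF g, of "Suc a" "a + b" n "Lop n a y"] by (simp only: act_Lop[OF g y n])
    finally show ?thesis .
  qed
  then show ?thesis
    unfolding Dop_def act_add act_smul act_sum act_Lop[OF g y n]
    by (intro arg_cong2[of _ _ _ _ "(+)"] arg_cong2[of _ _ _ _ smul] refl sum.cong) (simp only: lessThan_iff)
qed

subsection \<open>The direct sum\<close>

lemma DS_iff:
  assumes "1 \<le> n"
  shows "F \<in> DS n k l \<longleftrightarrow> (\<forall>j\<le>min k l. F j \<in> Ker n (k + l - 2 * j) 0) \<and> (\<forall>j>min k l. F j = 0)"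
  by (auto simp: DS_def Esp_eq_Ker[OF assms] zero_fun_def)

lemma DS_add: "1 \<le> n \<Longrightarrow> F \<in> DS n k l \<Longrightarrow> G \<in> DS n k l \<Longrightarrow> F + G \<in> DS n k l"
  by (simp add: DS_iff plus_fun_apply[of F G] fv.subspace_add[OF subspace_Ker])

lemma DS_scale: "1 \<le> n \<Longrightarrow> F \<in> DS n k l \<Longrightarrow> (\<lambda>j. c j \<cdot> F j) \<in> DS n k l"
  by (simp add: DS_iff fv.subspace_scale[OF subspace_Ker])

lemma DS_act: "1 \<le> n \<Longrightarrow> F \<in> DS n k l \<Longrightarrow> g \<in> SU2 \<Longrightarrow> ds_act n k l g F \<in> DS n k l"
  unfolding ds_act_def zero_fun_def[symmetric] by (auto simp: DS_iff act_Ker)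

text \<open>Raising k, l and j by one leaves k + l - 2j unchanged, so the summands below the top one
  form the direct sum one level down.\<close>

lemma DS_shift:
  assumes n: "1 \<le> n" and F: "F \<in> DS n (Suc k) (Suc l)"
  shows "(\<lambda>j. F (Suc j)) \<in> DS n k l"
  unfolding DS_iff[OF n]
proof (intro conjI allI impI)
  fix j assume "j \<le> min k l"
  then show "F (Suc j) \<in> Ker n (k + l - 2 * j) 0"
    using F unfolding DS_iff[OF n] by (auto dest: spec[of _ "Suc j"])
next
  fix j assume "min k l < j"
  then show "F (Suc j) = 0"
    using F unfolding DS_iff[OF n] by auto
qed

lemma DS_cons:
  assumes n: "1 \<le> n" and f: "f \<in> Ker n (k + l + 2) 0" and G: "G \<in> DS n k l"
  shows "case_nat f G \<in> DS n (Suc k) (Suc l)"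
  using f G unfolding DS_iff[OF n] by (auto split: nat.split)

lemma DS_0: "1 \<le> n \<Longrightarrow> F \<in> DS n k l \<Longrightarrow> F 0 \<in> Ker n (k + l) 0"
  unfolding DS_iff by auto

lemma ds_inner_Suc:
  "ds_inner n (Suc k) (Suc l) F G
    = cinner (n * (k + l + 2)) (F 0) (G 0) + ds_inner n k l (\<lambda>j. F (Suc j)) (\<lambda>j. G (Suc j))"
  by (simp add: ds_inner_def sum.atMost_Suc_shift del: sum.atMost_Suc)

lemma ds_act_Suc:
  "ds_act n (Suc k) (Suc l) g F 0 = act g (n * (k + l + 2)) (F 0)"
  "(\<lambda>j. ds_act n (Suc k) (Suc l) g F (Suc j)) = ds_act n k l g (\<lambda>j. F (Suc j))"
  by (auto simp: ds_act_def)

lemma ds_act_scale: "ds_act n k l g (\<lambda>j. c j \<cdot> F j) = (\<lambda>j. c j \<cdot> ds_act n k l g F j)"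
  by (auto simp: ds_act_def act_smul fun_eq_iff smul_apply)

subsection \<open>Fusion rules\<close>

text \<open>The last clause, with scalars \<open>lam\<close>, is what makes the recursion in \<open>k\<close> and \<open>l\<close> unitary:
  it diagonalises the contraction across the tensor sign followed by its adjoint.\<close>

definition fusion :: "nat \<Rightarrow> nat \<Rightarrow> nat \<Rightarrow> ((nat \<Rightarrow> bool list \<Rightarrow> complex) \<Rightarrow> bool list \<Rightarrow> complex) \<Rightarrow> (nat \<Rightarrow> real) \<Rightarrow> bool" where
  "fusion n k l V lam \<longleftrightarrow>
     bij_betw V (DS n k l) (Ker n (k + l) k)
   \<and> (\<forall>F\<in>DS n k l. \<forall>G\<in>DS n k l. V (F + G) = V F + V G)
   \<and> (\<forall>c. \<forall>F\<in>DS n k l. V (\<lambda>j. c \<cdot> F j) = c \<cdot> V F)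
   \<and> (\<forall>F\<in>DS n k l. \<forall>G\<in>DS n k l. cinner (n * (k + l)) (V F) (V G) = ds_inner n k l F G)
   \<and> (\<forall>g\<in>SU2. \<forall>F\<in>DS n k l. V (ds_act n k l g F) = act g (n * (k + l)) (V F))
   \<and> (\<forall>j. 0 \<le> lam j)
   \<and> (\<forall>F\<in>DS n k l. Qop n k l (V F) = V (\<lambda>j. of_real (lam j) \<cdot> F j))"

lemma fusion_base:
  assumes n: "1 \<le> n" and kl: "k = 0 \<or> l = 0"
  shows "fusion n k l (\<lambda>F. F 0) (\<lambda>_. 0)"
proof -
  have min: "min k l = 0"
    using kl by auto
  have K: "Ker n (k + l) k = Ker n (k + l) 0"
    using kl by (auto simp: Ker_def)
  have DS: "F \<in> DS n k l \<longleftrightarrow> F 0 \<in> Ker n (k + l) 0 \<and> (\<forall>j>0. F j = 0)" for F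
    by (simp add: DS_iff[OF n] min)
  have "bij_betw (\<lambda>F. F 0) (DS n k l) (Ker n (k + l) k)"
    unfolding K
  proof (rule bij_betwI[where g = "\<lambda>f j. if j = 0 then f else 0"])
    show "(\<lambda>F. F 0) \<in> DS n k l \<rightarrow> Ker n (k + l) 0"
      by (simp add: DS)
    show "(\<lambda>f j. if j = 0 then f else 0) \<in> Ker n (k + l) 0 \<rightarrow> DS n k l"
      by (simp add: DS)
    show "(\<lambda>j. if j = 0 then F 0 else 0) = F" if "F \<in> DS n k l" for F
      using that by (auto simp: DS)
  qed simp
  then show ?thesis
    using kl by (auto simp: fusion_def plus_fun_apply[of _ _ 0] ds_inner_def ds_act_def Qop_def min)
qed

text \<open>On the summand j one level down, C D is the scalar \<open>mu j\<close>, so D scaled by 1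
  / sqrt (mu j) is isometric there. D C kills the new top summand and is \<open>mu j\<close> on the
  others, which explains the list of scalars passed on.\<close>

lemma fusion_step:
  assumes n: "1 \<le> n" and fus: "fusion n k l V lam"
  defines "mu \<equiv> \<lambda>j. alp n k l + bet n k l * lam j"
  shows "fusion n (Suc k) (Suc l)
    (\<lambda>F. F 0 + Dop n k l (V (\<lambda>j. of_real (1 / sqrt (mu j)) \<cdot> F (Suc j)))) (case_nat 0 mu)"
proof -
  have bij: "bij_betw V (DS n k l) (Ker n (k + l) k)"
    and Vadd: "\<And>F G. F \<in> DS n k l \<Longrightarrow> G \<in> DS n k l \<Longrightarrow> V (F + G) = V F + V G"
    and Vscale: "\<And>c F. F \<in> DS n k l \<Longrightarrow> V (\<lambda>j. c \<cdot> F j) = c \<cdot> V F"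
    and Vinner: "\<And>F G. F \<in> DS n k l \<Longrightarrow> G \<in> DS n k l \<Longrightarrow> cinner (n * (k + l)) (V F) (V G) = ds_inner n k l F G"
    and Vact: "\<And>g F. g \<in> SU2 \<Longrightarrow> F \<in> DS n k l \<Longrightarrow> V (ds_act n k l g F) = act g (n * (k + l)) (V F)"
    and lam: "\<And>j. 0 \<le> lam j"
    and VQ: "\<And>F. F \<in> DS n k l \<Longrightarrow> Qop n k l (V F) = V (\<lambda>j. of_real (lam j) \<cdot> F j)"
    using fus by (simp_all add: fusion_def)
  have VK: "V F \<in> Ker n (k + l) k" if "F \<in> DS n k l" for F
    using bij that by (rule bij_betw_apply)
  have mu: "0 < mu j" for j
    using alp_pos[OF n, of k l] bet_nonneg[OF n, of k l] lam[of j] by (simp add: mu_def add_pos_nonneg)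
  have mu1: "complex_of_real (mu j) * complex_of_real (1 / mu j) = 1" for j
    using mu[of j] by simp
  have mu2: "complex_of_real (mu j) * complex_of_real (1 / sqrt (mu j)) = complex_of_real (sqrt (mu j))" for j
    using mu[of j] by (simp add: real_div_sqrt flip: of_real_mult of_real_divide)
  have mu3: "complex_of_real (1 / sqrt (mu j)) * complex_of_real (sqrt (mu j)) = 1" for j
    using mu[of j] by simp
  define S where "S F = (\<lambda>j. of_real (1 / sqrt (mu j)) \<cdot> F (Suc j))" for F :: "nat \<Rightarrow> bool list \<Rightarrow> complex"
  define W where "W F = F 0 + Dop n k l (V (S F))" for F
  have SDS: "S F \<in> DS n k l" if "F \<in> DS n (Suc k) (Suc l)" for F
    unfolding S_def by (rule DS_scale[OF n DS_shift[OF n that]])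
  have F0: "F 0 \<in> Ker n (k + l + 2) 0" if "F \<in> DS n (Suc k) (Suc l)" for F
    using DS_0[OF n that] by simp
  have cF0: "con n k (F 0) = 0" if "F \<in> DS n (Suc k) (Suc l)" for F
    by (rule KerD[OF F0[OF that]]) auto
  have DK: "Dop n k l (V G) \<in> Ker n (k + l + 2) (Suc k)" if "G \<in> DS n k l" for G
    by (rule Dop_Ker[OF VK[OF that] n])
  have conD: "con n k (Dop n k l (V G)) = V (\<lambda>j. of_real (mu j) \<cdot> G j)" if G: "G \<in> DS n k l" for G
  proof -
    have "con n k (Dop n k l (V G))
        = of_real (alp n k l) \<cdot> V G + of_real (bet n k l) \<cdot> V (\<lambda>j. of_real (lam j) \<cdot> G j)"
      by (simp add: con_Dop[OF VK[OF G] n] VQ[OF G])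
    also have "\<dots> = V ((\<lambda>j. of_real (alp n k l) \<cdot> G j) + (\<lambda>j. of_real (bet n k l) \<cdot> (of_real (lam j) \<cdot> G j)))"
      by (simp only: Vscale[symmetric] Vadd[symmetric] G DS_scale[OF n])
    also have "(\<lambda>j. of_real (alp n k l) \<cdot> G j) + (\<lambda>j. of_real (bet n k l) \<cdot> (of_real (lam j) \<cdot> G j))
        = (\<lambda>j. of_real (mu j) \<cdot> G j)"
      by (simp add: plus_fun_def mu_def fv.scale_left_distrib)
    finally show ?thesis .
  qed
  have conW: "con n k (W F) = V (\<lambda>j. of_real (sqrt (mu j)) \<cdot> F (Suc j))" if F: "F \<in> DS n (Suc k) (Suc l)" for F
  proof -
    have "con n k (W F) = V (\<lambda>j. of_real (mu j) \<cdot> S F j)"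
      by (simp add: W_def Con_add cF0[OF F] conD[OF SDS[OF F]])
    then show ?thesis
      by (simp only: S_def fv.scale_scale mu2)
  qed
  have len: "Suc k + Suc l = k + l + 2"
    by simp
  have "W F \<in> Ker n (k + l + 2) (Suc k)" if "F \<in> DS n (Suc k) (Suc l)" for F
    unfolding W_def using F0[OF that] DK[OF SDS[OF that]] Ker_0_subset
    by (intro fv.subspace_add[OF subspace_Ker]) auto
  \<comment> \<open>The contraction of W F reveals all components but the top one, since V is
    injective and the factors are nonzero; the top one follows by subtraction.\<close>
  moreover have "inj_on W (DS n (Suc k) (Suc l))"
  proof (rule inj_onI)
    fix F G
    assume F: "F \<in> DS n (Suc k) (Suc l)" and G: "G \<in> DS n (Suc k) (Suc l)" and eq: "W F = W G"
    have "V (\<lambda>j. of_real (sqrt (mu j)) \<cdot> F (Suc j)) = V (\<lambda>j. of_real (sqrt (mu j)) \<cdot> G (Suc j))"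
      using conW[OF F] conW[OF G] eq by simp
    then have "(\<lambda>j. of_real (sqrt (mu j)) \<cdot> F (Suc j)) = (\<lambda>j. of_real (sqrt (mu j)) \<cdot> G (Suc j))"
      by (rule inj_onD[OF bij_betw_imp_inj_on[OF bij]]) (intro DS_scale[OF n] DS_shift[OF n] F G)+
    then have "of_real (sqrt (mu j)) \<cdot> F (Suc j) = of_real (sqrt (mu j)) \<cdot> G (Suc j)" for j
      by (rule fun_cong)
    moreover have "complex_of_real (sqrt (mu j)) \<noteq> 0" for j
      using mu[of j] by simp
    ultimately have suc: "F (Suc j) = G (Suc j)" for j
      using fv.scale_left_imp_eq by blast
    then have "S F = S G"
      by (simp add: S_def)
    with eq have "F 0 = G 0"
      by (simp add: W_def)
    with suc show "F = G"
      by (metis ext old.nat.exhaust)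
  qed
  moreover have "\<exists>F\<in>DS n (Suc k) (Suc l). W F = x" if x: "x \<in> Ker n (k + l + 2) (Suc k)" for x
  proof -
    obtain G where G: "G \<in> DS n k l" "V G = con n k x"
      using con_Ker[OF x n] bij by (metis bij_betw_iff_bijections)
    \<comment> \<open>V H is the inverse of C D applied to C x, so that x - D (V H) is killed by C
      and lies in the top summand.\<close>
    define H where "H = (\<lambda>j. of_real (1 / mu j) \<cdot> G j)"
    have H: "H \<in> DS n k l"
      unfolding H_def by (rule DS_scale[OF n G(1)])
    have "con n k (Dop n k l (V H)) = con n k x"
      unfolding conD[OF H] unfolding H_def fv.scale_scale mu1 fv.scale_one by (rule G(2))
    moreover have "con n k (x - Dop n k l (V H)) = con n k x + con n k ((-1) \<cdot> Dop n k l (V H))"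
      by (simp flip: Con_add)
    ultimately have "con n k (x - Dop n k l (V H)) = 0"
      by (simp only: Con_smul) simp
    then have f: "x - Dop n k l (V H) \<in> Ker n (k + l + 2) 0"
      using fv.subspace_diff[OF subspace_Ker x DK[OF H]] by (intro kernel_con) auto
    \<comment> \<open>The scaling in S contributes a second factor 1 / sqrt (mu j), which turns
      these components into those of H.\<close>
    define F where "F = case_nat (x - Dop n k l (V H)) (\<lambda>j. of_real (1 / sqrt (mu j)) \<cdot> G j)"
    have F: "F \<in> DS n (Suc k) (Suc l)"
      unfolding F_def by (rule DS_cons[OF n f DS_scale[OF n G(1)]])
    have "complex_of_real (1 / sqrt (mu j)) * complex_of_real (1 / sqrt (mu j)) = complex_of_real (1 / mu j)" for j
      using mu[of j] by (simp flip: of_real_mult)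
    then have "S F = H"
      by (simp only: S_def F_def H_def nat.case fv.scale_scale)
    then have "W F = x"
      by (simp add: W_def) (simp add: F_def)
    with F show ?thesis
      by blast
  qed
  ultimately have "bij_betw W (DS n (Suc k) (Suc l)) (Ker n (Suc k + Suc l) (Suc k))"
    unfolding len bij_betw_def by blast
  moreover have "W (F + G) = W F + W G" if F: "F \<in> DS n (Suc k) (Suc l)" and G: "G \<in> DS n (Suc k) (Suc l)" for F G
  proof -
    have "S (F + G) = S F + S G"
    proof
      fix j
      show "S (F + G) j = (S F + S G) j"
        unfolding plus_fun_apply[of "S F" "S G"] by (simp add: S_def plus_fun_apply[of F G] fv.scale_right_distrib)
    qed
    then show ?thesis
      by (simp add: W_def plus_fun_apply[of F G] Vadd SDS F G Dop_add)
  qed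
  moreover have "W (\<lambda>j. c \<cdot> F j) = c \<cdot> W F" if F: "F \<in> DS n (Suc k) (Suc l)" for c F
  proof -
    have "S (\<lambda>j. c \<cdot> F j) = (\<lambda>j. c \<cdot> S F j)"
      by (simp add: S_def mult.commute)
    then show ?thesis
      by (simp add: W_def Vscale SDS F Dop_smul fv.scale_right_distrib)
  qed
  moreover have "cinner (n * (Suc k + Suc l)) (W F) (W G) = ds_inner n (Suc k) (Suc l) F G"
    if F: "F \<in> DS n (Suc k) (Suc l)" and G: "G \<in> DS n (Suc k) (Suc l)" for F G
  proof -
    let ?N = "n * (k + l + 2)"
    \<comment> \<open>The top summand is the kernel of C and therefore orthogonal to the range of
      its adjoint D.\<close>
    have 1: "cinner ?N (Dop n k l u) (H 0) = 0" if H: "H \<in> DS n (Suc k) (Suc l)" for u H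
    proof -
      have "H 0 \<in> Ker n (k + l + 2) (Suc k)"
        using F0[OF H] Ker_0_subset by blast
      from cinner_Dop[OF this n] show ?thesis
        by (simp only: cF0[OF H] cinner_zero_right)
    qed
    have 2: "cinner ?N (F 0) (Dop n k l u) = 0" for u
      using cinner_cnj[of ?N "Dop n k l u" "F 0"] 1[OF F, of u] by (simp only: complex_cnj_zero)
    have "cinner ?N (Dop n k l (V (S F))) (Dop n k l (V (S G)))
        = cinner (n * (k + l)) (V (S F)) (V (\<lambda>j. of_real (mu j) \<cdot> S G j))"
      by (simp only: cinner_Dop[OF DK[OF SDS[OF G]] n] conD[OF SDS[OF G]])
    also have "\<dots> = ds_inner n k l (S F) (\<lambda>j. of_real (sqrt (mu j)) \<cdot> G (Suc j))"
      by (simp only: Vinner SDS F G DS_scale[OF n] DS_shift[OF n]) (simp only: S_def fv.scale_scale mu2)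
    also have "\<dots> = ds_inner n k l (\<lambda>j. F (Suc j)) (\<lambda>j. G (Suc j))"
      unfolding ds_inner_def S_def cinner_smul_left cinner_smul_right complex_cnj_complex_of_real
        mult.assoc[symmetric] mu3 by (simp add: mu[THEN less_imp_neq, symmetric])
    finally show ?thesis
      unfolding len ds_inner_Suc W_def by (simp only: cinner_add_left cinner_add_right 1[OF G] 2 add_0_left add_0_right)
  qed
  moreover have "W (ds_act n (Suc k) (Suc l) g F) = act g (n * (Suc k + Suc l)) (W F)"
    if g: "g \<in> SU2" and F: "F \<in> DS n (Suc k) (Suc l)" for g F
  proof -
    have "S (ds_act n (Suc k) (Suc l) g F) = ds_act n k l g (S F)"
      unfolding S_def ds_act_scale ds_act_Suc(2)[symmetric] ..
    then have "W (ds_act n (Suc k) (Suc l) g F) = act g (n * (k + l + 2)) (F 0) + Dop n k l (act g (n * (k + l)) (V (S F)))"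
      by (simp only: W_def ds_act_Suc(1) Vact[OF g SDS[OF F]])
    also have "\<dots> = act g (n * (k + l + 2)) (W F)"
      by (simp only: W_def act_add act_Dop[OF g Ker_Sy[OF VK[OF SDS[OF F]]] n])
    finally show ?thesis
      by (simp only: len)
  qed
  moreover have "0 \<le> (case_nat 0 mu j :: real)" for j
    using mu by (cases j) (auto intro: less_imp_le)
  moreover have "Qop n (Suc k) (Suc l) (W F) = W (\<lambda>j. of_real (case_nat 0 mu j) \<cdot> F j)"
    if F: "F \<in> DS n (Suc k) (Suc l)" for F
  proof -
    have "Qop n (Suc k) (Suc l) (W F) = Dop n k l (con n k (W F))"
      by (simp add: Qop_def)
    \<comment> \<open>The factor sqrt (mu j) produced by C is rewritten as mu j / sqrt (mu j), the
      scaling of S applied to the components multiplied by mu j; the scalar 0 removes the top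
      component.\<close>
    also have "\<dots> = Dop n k l (V (S (\<lambda>j. of_real (case_nat 0 mu j) \<cdot> F j)))"
      unfolding conW[OF F] by (simp only: S_def nat.case fv.scale_scale mu2 mult.commute[of "of_real (1 / sqrt _)"])
    finally show ?thesis
      by (simp add: W_def)
  qed
  ultimately show ?thesis
    unfolding fusion_def W_def[symmetric] S_def[symmetric] by blast
qed

lemma fusion_exists:
  assumes n: "1 \<le> n"
  shows "\<exists>V lam. fusion n k l V lam"
proof (induction k arbitrary: l)
  case 0
  show ?case
    using fusion_base[OF n] by blast
next
  case (Suc k)
  show ?case
  proof (cases l)
    case 0
    then show ?thesis
      using fusion_base[OF n] by blast
  next
    case l: (Suc l')
    obtain V lam where "fusion n k l' V lam"
      using Suc.IH by blast
    from fusion_step[OF n this] show ?thesis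
      unfolding l by blast
  qed
qed

theorem theorem3p1:
  fixes n k l :: nat
  assumes "1 \<le> n"
  shows "\<exists>U :: (bool list \<Rightarrow> complex) \<Rightarrow> (nat \<Rightarrow> bool list \<Rightarrow> complex).
    bij_betw U (tens (n * k) (Esp n k) (Esp n l)) (DS n k l)
    \<and> (\<forall>x\<in>tens (n * k) (Esp n k) (Esp n l). \<forall>y\<in>tens (n * k) (Esp n k) (Esp n l).
          U (\<lambda>w. x w + y w) = (\<lambda>j w. U x j w + U y j w))
    \<and> (\<forall>c. \<forall>x\<in>tens (n * k) (Esp n k) (Esp n l). U (\<lambda>w. c * x w) = (\<lambda>j w. c * U x j w))
    \<and> (\<forall>x\<in>tens (n * k) (Esp n k) (Esp n l). \<forall>y\<in>tens (n * k) (Esp n k) (Esp n l).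
          ds_inner n k l (U x) (U y) = cinner (n * (k + l)) x y)
    \<and> (\<forall>g\<in>SU2. \<forall>x\<in>tens (n * k) (Esp n k) (Esp n l).
          U (act g (n * (k + l)) x) = ds_act n k l g (U x))"
proof -
  obtain V lam where fus: "fusion n k l V lam"
    using fusion_exists[OF assms] by blast
  then have bij: "bij_betw V (DS n k l) (Ker n (k + l) k)"
    and Vadd: "\<And>F G. F \<in> DS n k l \<Longrightarrow> G \<in> DS n k l \<Longrightarrow> V (F + G) = V F + V G"
    and Vscale: "\<And>c F. F \<in> DS n k l \<Longrightarrow> V (\<lambda>j. c \<cdot> F j) = c \<cdot> V F"
    and Vinner: "\<And>F G. F \<in> DS n k l \<Longrightarrow> G \<in> DS n k l \<Longrightarrow> cinner (n * (k + l)) (V F) (V G) = ds_inner n k l F G"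
    and Vact: "\<And>g F. g \<in> SU2 \<Longrightarrow> F \<in> DS n k l \<Longrightarrow> V (ds_act n k l g F) = act g (n * (k + l)) (V F)"
    by (simp_all add: fusion_def)
  \<comment> \<open>The recursion builds the isometry out of the direct sum; the required map goes
    the other way.\<close>
  define U where "U = inv_into (DS n k l) V"
  have Ubij: "bij_betw U (Ker n (k + l) k) (DS n k l)"
    unfolding U_def by (rule bij_betw_inv_into[OF bij])
  have U: "U x \<in> DS n k l" "V (U x) = x" if "x \<in> Ker n (k + l) k" for x
    using bij_betw_apply[OF Ubij that] bij_betw_inv_into_right[OF bij that] by (auto simp: U_def)
  have UV: "U (V F) = F" if "F \<in> DS n k l" for F
    unfolding U_def by (rule bij_betw_inv_into_left[OF bij that])
  have "U (\<lambda>w. x w + y w) = (\<lambda>j w. U x j w + U y j w)" if "x \<in> Ker n (k + l) k" "y \<in> Ker n (k + l) k" for x y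
  proof -
    have "U (x + y) = U x + U y"
      using UV[OF DS_add[OF assms U(1) U(1)], OF that] Vadd[OF U(1) U(1), OF that] U(2) that by simp
    then show ?thesis
      by (simp add: plus_fun_def)
  qed
  moreover have "U (\<lambda>w. c * x w) = (\<lambda>j w. c * U x j w)" if "x \<in> Ker n (k + l) k" for c x
  proof -
    have "U (c \<cdot> x) = (\<lambda>j. c \<cdot> U x j)"
      using UV[OF DS_scale[OF assms U(1)[OF that], of "\<lambda>_. c"]] Vscale[OF U(1)[OF that], of c] U(2)[OF that] by simp
    then show ?thesis
      by (simp add: smul_def)
  qed
  moreover have "ds_inner n k l (U x) (U y) = cinner (n * (k + l)) x y"
    if "x \<in> Ker n (k + l) k" "y \<in> Ker n (k + l) k" for x y
    using Vinner[OF U(1) U(1), OF that] U(2) that by simp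
  moreover have "U (act g (n * (k + l)) x) = ds_act n k l g (U x)" if "g \<in> SU2" "x \<in> Ker n (k + l) k" for g x
    using UV[OF DS_act[OF assms U(1)[OF that(2)] that(1)]] Vact[OF that(1) U(1)[OF that(2)]] U(2)[OF that(2)] by simp
  ultimately show ?thesis
    unfolding tens_Esp[OF assms] using Ubij by (intro exI[of _ U]) blast
qed

end
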